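(* Let $\mathcal C$ be a category of orthogonal or symplectic type with parameters $(r,q)$ as in the context. (a) If $\mathcal C$ has the Grothendieck semiring of an orthogonal group $O(N)$ or of one of its associated fusion categories (label sets (ii), (iv), (v) of the context), then $r=q^{N-1}$ or, if $N$ is odd, $r=-q^{N-1}$ (i.e. $r=q^{N-1}$, or $N$ is odd and $r=-q^{N-1}$). (b) If $\mathcal C$ has the Grothendieck semiring of a symplectic group $Sp(N)$ or of one of its associated fusion categories (label sets (iii), (vi) of the context), then $r=-q^{2N+1}$.
   Context: All categories are rigid, strictly monoidal, semisimple, braided abelian $\mathbb C$-linear tensor categories: morphism spaces are finite dimensional complex vector spaces, composition and $\otimes$ are bilinear, endomorphism algebras are semisimple; an object $Y$ is simple if $\mathrm{End}(Y)=\mathbb C$; $\mathbf 1$ is simple. Young diagrams: $[n]$ is one row of $n$ boxes, $[1^n]$ one column of $n$ boxes. Such a category $\mathcal C$ is of orthogonal or symplectic type if its Grothendieck semiring is one of the following: the isomorphism classes of simple objects $X_\lambda$ are labeled by the diagrams $\lambda$ in one of the label sets below, $X_\emptyset=\mathbf 1$, and, with $X=X_{[1]}$ (the "vector representation"), $X_\lambda\otimes X\cong\bigoplus_\mu X_\mu$, summed over all $\mu$ in the label set obtained from $\lambda$ by adding or removing one box. Label sets: (i) type $O(\infty)$: all Young diagrams; (ii) type $O(N)$: diagrams with at most $N$ boxes in the first two columns (together); (iii) type $Sp(N)$: diagrams with at most $N$ rows; (iv) orthogonal fusion: $\le N$ boxes in the first two columns and $\le M$ boxes in the first two rows; (v)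 ortho-symplectic fusion: $\le N$ boxes in the first two columns and $\le M$ boxes in the first row; (vi) symplectic fusion: $\le N$ boxes in the first column and $\le M$ boxes in the first row. It is assumed that $[2]$ and $[1^2]$ belong to the label set, so $X\otimes X\cong X_{[2]}\oplus X_{[1^2]}\oplus\mathbf 1$. Parameters: there are $q,r\in\mathbb C^*$ and a fourth root of unity $\gamma$ such that $t=\gamma c_{X,X}$ ($c$ the braiding) acts on the summands $X_{[2]},X_{[1^2]},\mathbf 1$ of $X\otimes X$ by $q,-q^{-1},r^{-1}$ respectively; $c_{X,X}$ acts by different scalars on $X_{[2]}$ and $X_{[1^2]}$, i.e. $q\ne -q^{-1}$. *)

theory Defs
  imports Complex_Main "HOL-Algebra.Module" "HOL-Algebra.AbelCoset" "HOL-Algebra.Algebraic_Closure_Type"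
begin

section \<open>Finite-dimensional spaces and semisimple rings\<close>

no_notation var (\<open>X\<index>\<close>)

abbreviation complex_ring :: "complex ring" where
  "complex_ring \<equiv> ring_of_type_algebra"

definition fin_dim :: "(complex, 'm) module \<Rightarrow> bool" where
  "fin_dim M \<longleftrightarrow> (\<exists>B. finite B \<and> B \<subseteq> carrier M \<and>
     (\<forall>f\<in>carrier M. \<exists>a. f = (\<Oplus>\<^bsub>M\<^esub>b\<in>B. a b \<odot>\<^bsub>M\<^esub> b)))"

definition left_ideal :: "'a set \<Rightarrow> 'a ring \<Rightarrow> bool" where
  "left_ideal I R \<longleftrightarrow> additive_subgroup I R \<and> (\<forall>a\<in>carrier R. \<forall>x\<in>I. a \<otimes>\<^bsub>R\<^esub> x \<in> I)"

text \<open>A ring is semisimple if it is semisimple as a left module over itself: every left ideal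
  is a direct summand.\<close>

definition semisimple_ring :: "'a ring \<Rightarrow> bool" where
  "semisimple_ring R \<longleftrightarrow> ring R \<and>
     (\<forall>I. left_ideal I R \<longrightarrow>
        (\<exists>J. left_ideal J R \<and> I \<inter> J = {\<zero>\<^bsub>R\<^esub>} \<and> I <+>\<^bsub>R\<^esub> J = carrier R))"


section \<open>Strict braided tensor categories\<close>

text \<open>Every element of the type \<open>'o\<close> is an object. The morphisms from \<open>X\<close> to \<open>Y\<close> are the
  elements of the carrier of the complex vector space \<open>Hom C X Y\<close>; the ring components
  \<open>mult\<close> and \<open>one\<close>, which the record type \<open>module\<close> inherits, are never used (composition
  and identities are the separate components \<open>cmp\<close> and \<open>ident\<close>).\<close>

record ('o, 'm) tensor_cat =
  Hom :: "'o \<Rightarrow> 'o \<Rightarrow> (complex, 'm) module"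
  cmp :: "'m \<Rightarrow> 'm \<Rightarrow> 'm" (infixr \<open>\<cdot>\<index>\<close> 75)
  ident :: "'o \<Rightarrow> 'm"
  unit :: "'o" (\<open>\<I>\<index>\<close>)
  tens_ob :: "'o \<Rightarrow> 'o \<Rightarrow> 'o" (infixr \<open>\<otimes>\<^sub>o\<index>\<close> 78)
  tens_mor :: "'m \<Rightarrow> 'm \<Rightarrow> 'm" (infixr \<open>\<otimes>\<^sub>m\<index>\<close> 78)
  braid :: "'o \<Rightarrow> 'o \<Rightarrow> 'm"

abbreviation mor :: "('o, 'm) tensor_cat \<Rightarrow> 'o \<Rightarrow> 'o \<Rightarrow> 'm set" where
  "mor C X Y \<equiv> carrier (Hom C X Y)"

abbreviation zero_mor :: "('o, 'm) tensor_cat \<Rightarrow> 'o \<Rightarrow> 'o \<Rightarrow> 'm" where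
  "zero_mor C X Y \<equiv> \<zero>\<^bsub>Hom C X Y\<^esub>"

definition End_ring :: "('o, 'm) tensor_cat \<Rightarrow> 'o \<Rightarrow> 'm ring" where
  "End_ring C X = \<lparr>carrier = mor C X X, monoid.mult = cmp C, one = ident C X,
     ring.zero = zero_mor C X X, add = add (Hom C X X)\<rparr>"

context
  fixes C :: "('o, 'm) tensor_cat" (structure)
begin

definition is_iso :: "'m \<Rightarrow> 'o \<Rightarrow> 'o \<Rightarrow> bool" where
  "is_iso f X Y \<longleftrightarrow> f \<in> mor C X Y \<and>
     (\<exists>g\<in>mor C Y X. g \<cdot> f = ident C X \<and> f \<cdot> g = ident C Y)"

definition isomorphic :: "'o \<Rightarrow> 'o \<Rightarrow> bool" where
  "isomorphic X Y \<longleftrightarrow> (\<exists>f. is_iso f X Y)"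

text \<open>\<open>End(X) = \<complex>\<close>; the second conjunct excludes the zero object.\<close>

definition simple_ob :: "'o \<Rightarrow> bool" where
  "simple_ob X \<longleftrightarrow> mor C X X = range (\<lambda>a. a \<odot>\<^bsub>Hom C X X\<^esub> ident C X) \<and>
     ident C X \<noteq> zero_mor C X X"

text \<open>\<open>Y\<close> is a direct sum of the finite family \<open>Z i\<close>, \<open>i \<in> I\<close>. For \<open>I = {}\<close> this says that
  the identity of \<open>Y\<close> vanishes, i.e. that \<open>Y\<close> is a zero object.\<close>

definition is_direct_sum :: "'o \<Rightarrow> 'i set \<Rightarrow> ('i \<Rightarrow> 'o) \<Rightarrow> bool" where
  "is_direct_sum Y I Z \<longleftrightarrow> finite I \<and>
     (\<exists>inj prj.
        (\<forall>i\<in>I. inj i \<in> mor C (Z i) Y \<and> prj i \<in> mor C Y (Z i)) \<and>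
        (\<forall>i\<in>I. prj i \<cdot> inj i = ident C (Z i)) \<and>
        (\<forall>i\<in>I. \<forall>j\<in>I. i \<noteq> j \<longrightarrow> prj j \<cdot> inj i = zero_mor C (Z i) (Z j)) \<and>
        (\<Oplus>\<^bsub>Hom C Y Y\<^esub>i\<in>I. inj i \<cdot> prj i) = ident C Y)"

definition is_monic :: "'m \<Rightarrow> 'o \<Rightarrow> 'o \<Rightarrow> bool" where
  "is_monic f X Y \<longleftrightarrow> f \<in> mor C X Y \<and>
     (\<forall>W. \<forall>g\<in>mor C W X. \<forall>h\<in>mor C W X. f \<cdot> g = f \<cdot> h \<longrightarrow> g = h)"

definition is_epic :: "'m \<Rightarrow> 'o \<Rightarrow> 'o \<Rightarrow> bool" where
  "is_epic f X Y \<longleftrightarrow> f \<in> mor C X Y \<and>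
     (\<forall>W. \<forall>g\<in>mor C Y W. \<forall>h\<in>mor C Y W. g \<cdot> f = h \<cdot> f \<longrightarrow> g = h)"

definition is_kernel :: "'m \<Rightarrow> 'o \<Rightarrow> 'm \<Rightarrow> 'o \<Rightarrow> 'o \<Rightarrow> bool" where
  "is_kernel k K f X Y \<longleftrightarrow> f \<in> mor C X Y \<and> k \<in> mor C K X \<and> f \<cdot> k = zero_mor C K Y \<and>
     (\<forall>W. \<forall>g\<in>mor C W X. f \<cdot> g = zero_mor C W Y \<longrightarrow> (\<exists>!h. h \<in> mor C W K \<and> k \<cdot> h = g))"

definition is_cokernel :: "'m \<Rightarrow> 'o \<Rightarrow> 'm \<Rightarrow> 'o \<Rightarrow> 'o \<Rightarrow> bool" where
  "is_cokernel p Q f X Y \<longleftrightarrow> f \<in> mor C X Y \<and> p \<in> mor C Y Q \<and> p \<cdot> f = zero_mor C X Q \<and>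
     (\<forall>W. \<forall>g\<in>mor C Y W. g \<cdot> f = zero_mor C X W \<longrightarrow> (\<exists>!h. h \<in> mor C Q W \<and> h \<cdot> p = g))"

text \<open>\<open>(Y, ev, coev)\<close> is a left dual of \<open>X\<close>, equivalently \<open>X\<close> is a right dual of \<open>Y\<close>.\<close>

definition is_dual :: "'o \<Rightarrow> 'o \<Rightarrow> 'm \<Rightarrow> 'm \<Rightarrow> bool" where
  "is_dual Y X ev coev \<longleftrightarrow> ev \<in> mor C (Y \<otimes>\<^sub>o X) \<I> \<and> coev \<in> mor C \<I> (X \<otimes>\<^sub>o Y) \<and>
     (ident C X \<otimes>\<^sub>m ev) \<cdot> (coev \<otimes>\<^sub>m ident C X) = ident C X \<and>
     (ev \<otimes>\<^sub>m ident C Y) \<cdot> (ident C Y \<otimes>\<^sub>m coev) = ident C Y"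

end

locale linear_cat =
  fixes C :: "('o, 'm) tensor_cat" (structure)
  assumes vector_space: "module complex_ring (Hom C X Y)"
    and finite_dimensional: "fin_dim (Hom C X Y)"
    and mor_disjoint: "mor C X Y \<inter> mor C X' Y' \<noteq> {} \<Longrightarrow> X = X' \<and> Y = Y'"
    and ident_mor: "ident C X \<in> mor C X X"
    and comp_mor: "\<lbrakk>g \<in> mor C Y Z; f \<in> mor C X Y\<rbrakk> \<Longrightarrow> g \<cdot> f \<in> mor C X Z"
    and comp_assoc: "\<lbrakk>h \<in> mor C Z W; g \<in> mor C Y Z; f \<in> mor C X Y\<rbrakk>
          \<Longrightarrow> (h \<cdot> g) \<cdot> f = h \<cdot> (g \<cdot> f)"
    and ident_left: "f \<in> mor C X Y \<Longrightarrow> ident C Y \<cdot> f = f"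
    and ident_right: "f \<in> mor C X Y \<Longrightarrow> f \<cdot> ident C X = f"
    and comp_add_left: "\<lbrakk>g \<in> mor C Y Z; g' \<in> mor C Y Z; f \<in> mor C X Y\<rbrakk>
          \<Longrightarrow> (g \<oplus>\<^bsub>Hom C Y Z\<^esub> g') \<cdot> f = g \<cdot> f \<oplus>\<^bsub>Hom C X Z\<^esub> g' \<cdot> f"
    and comp_add_right: "\<lbrakk>g \<in> mor C Y Z; f \<in> mor C X Y; f' \<in> mor C X Y\<rbrakk>
          \<Longrightarrow> g \<cdot> (f \<oplus>\<^bsub>Hom C X Y\<^esub> f') = g \<cdot> f \<oplus>\<^bsub>Hom C X Z\<^esub> g \<cdot> f'"
    and comp_smult_left: "\<lbrakk>g \<in> mor C Y Z; f \<in> mor C X Y\<rbrakk>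
          \<Longrightarrow> (a \<odot>\<^bsub>Hom C Y Z\<^esub> g) \<cdot> f = a \<odot>\<^bsub>Hom C X Z\<^esub> (g \<cdot> f)"
    and comp_smult_right: "\<lbrakk>g \<in> mor C Y Z; f \<in> mor C X Y\<rbrakk>
          \<Longrightarrow> g \<cdot> (a \<odot>\<^bsub>Hom C X Y\<^esub> f) = a \<odot>\<^bsub>Hom C X Z\<^esub> (g \<cdot> f)"

locale abelian_linear_cat = linear_cat +
  assumes direct_sums: "\<exists>Y. is_direct_sum C Y {..<(n::nat)} Z"
    and kernels: "f \<in> mor C X Y \<Longrightarrow> \<exists>k K. is_kernel C k K f X Y"
    and cokernels: "f \<in> mor C X Y \<Longrightarrow> \<exists>p Q. is_cokernel C p Q f X Y"
    and monic_normal: "is_monic C f X Y \<Longrightarrow> \<exists>g Z. is_kernel C f X g Y Z"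
    and epic_normal: "is_epic C f X Y \<Longrightarrow> \<exists>g Z. is_cokernel C f Y g Z X"

locale strict_tensor_cat = abelian_linear_cat +
  assumes tens_ob_assoc: "(X \<otimes>\<^sub>o Y) \<otimes>\<^sub>o Z = X \<otimes>\<^sub>o (Y \<otimes>\<^sub>o Z)"
    and unit_left: "\<I> \<otimes>\<^sub>o X = X"
    and unit_right: "X \<otimes>\<^sub>o \<I> = X"
    and tens_mor: "\<lbrakk>f \<in> mor C X Y; f' \<in> mor C X' Y'\<rbrakk>
          \<Longrightarrow> f \<otimes>\<^sub>m f' \<in> mor C (X \<otimes>\<^sub>o X') (Y \<otimes>\<^sub>o Y')"
    and tens_ident: "ident C X \<otimes>\<^sub>m ident C Y = ident C (X \<otimes>\<^sub>o Y)"
    and tens_comp: "\<lbrakk>g \<in> mor C Y Z; f \<in> mor C X Y; g' \<in> mor C Y' Z'; f' \<in> mor C X' Y'\<rbrakk>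
          \<Longrightarrow> (g \<cdot> f) \<otimes>\<^sub>m (g' \<cdot> f') = (g \<otimes>\<^sub>m g') \<cdot> (f \<otimes>\<^sub>m f')"
    and tens_mor_assoc: "\<lbrakk>f \<in> mor C X X'; g \<in> mor C Y Y'; h \<in> mor C Z Z'\<rbrakk>
          \<Longrightarrow> (f \<otimes>\<^sub>m g) \<otimes>\<^sub>m h = f \<otimes>\<^sub>m (g \<otimes>\<^sub>m h)"
    and tens_ident_unit_left: "f \<in> mor C X Y \<Longrightarrow> ident C \<I> \<otimes>\<^sub>m f = f"
    and tens_ident_unit_right: "f \<in> mor C X Y \<Longrightarrow> f \<otimes>\<^sub>m ident C \<I> = f"
    and tens_add_left: "\<lbrakk>f \<in> mor C X Y; g \<in> mor C X Y; h \<in> mor C X' Y'\<rbrakk>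
          \<Longrightarrow> (f \<oplus>\<^bsub>Hom C X Y\<^esub> g) \<otimes>\<^sub>m h
              = (f \<otimes>\<^sub>m h) \<oplus>\<^bsub>Hom C (X \<otimes>\<^sub>o X') (Y \<otimes>\<^sub>o Y')\<^esub> (g \<otimes>\<^sub>m h)"
    and tens_add_right: "\<lbrakk>h \<in> mor C X Y; f \<in> mor C X' Y'; g \<in> mor C X' Y'\<rbrakk>
          \<Longrightarrow> h \<otimes>\<^sub>m (f \<oplus>\<^bsub>Hom C X' Y'\<^esub> g)
              = (h \<otimes>\<^sub>m f) \<oplus>\<^bsub>Hom C (X \<otimes>\<^sub>o X') (Y \<otimes>\<^sub>o Y')\<^esub> (h \<otimes>\<^sub>m g)"
    and tens_smult_left: "\<lbrakk>f \<in> mor C X Y; g \<in> mor C X' Y'\<rbrakk>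
          \<Longrightarrow> (a \<odot>\<^bsub>Hom C X Y\<^esub> f) \<otimes>\<^sub>m g
              = a \<odot>\<^bsub>Hom C (X \<otimes>\<^sub>o X') (Y \<otimes>\<^sub>o Y')\<^esub> (f \<otimes>\<^sub>m g)"
    and tens_smult_right: "\<lbrakk>f \<in> mor C X Y; g \<in> mor C X' Y'\<rbrakk>
          \<Longrightarrow> f \<otimes>\<^sub>m (a \<odot>\<^bsub>Hom C X' Y'\<^esub> g)
              = a \<odot>\<^bsub>Hom C (X \<otimes>\<^sub>o X') (Y \<otimes>\<^sub>o Y')\<^esub> (f \<otimes>\<^sub>m g)"

locale braided_tensor_cat = strict_tensor_cat +
  assumes braid_iso: "is_iso C (braid C X Y) (X \<otimes>\<^sub>o Y) (Y \<otimes>\<^sub>o X)"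
    and braid_natural: "\<lbrakk>f \<in> mor C X X'; g \<in> mor C Y Y'\<rbrakk>
          \<Longrightarrow> braid C X' Y' \<cdot> (f \<otimes>\<^sub>m g) = (g \<otimes>\<^sub>m f) \<cdot> braid C X Y"
    and hexagon_left: "braid C (X \<otimes>\<^sub>o Y) Z
          = (braid C X Z \<otimes>\<^sub>m ident C Y) \<cdot> (ident C X \<otimes>\<^sub>m braid C Y Z)"
    and hexagon_right: "braid C X (Y \<otimes>\<^sub>o Z)
          = (ident C Y \<otimes>\<^sub>m braid C X Z) \<cdot> (braid C X Y \<otimes>\<^sub>m ident C Z)"

locale rigid_semisimple_braided_cat = braided_tensor_cat +
  assumes left_dual: "\<exists>Y ev coev. is_dual C Y X ev coev"
    and right_dual: "\<exists>Y ev coev. is_dual C X Y ev coev"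
    and semisimple: "semisimple_ring (End_ring C X)"
    and unit_simple: "simple_ob C \<I>"


section \<open>Young diagrams\<close>

text \<open>A Young diagram is the set of its boxes \<open>(row, column)\<close>, counted from \<open>0\<close>.\<close>

type_synonym diagram = "(nat \<times> nat) set"

definition young :: "diagram \<Rightarrow> bool" where
  "young \<nu> \<longleftrightarrow> finite \<nu> \<and>
     (\<forall>i j i' j'. (i, j) \<in> \<nu> \<and> i' \<le> i \<and> j' \<le> j \<longrightarrow> (i', j') \<in> \<nu>)"

definition row_diagram :: "nat \<Rightarrow> diagram" where
  "row_diagram n = {0} \<times> {..<n}"

definition column_diagram :: "nat \<Rightarrow> diagram" where
  "column_diagram n = {..<n} \<times> {0}"

definition row_length :: "diagram \<Rightarrow> nat \<Rightarrow> nat" where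
  "row_length \<nu> i = card {j. (i, j) \<in> \<nu>}"

definition column_length :: "diagram \<Rightarrow> nat \<Rightarrow> nat" where
  "column_length \<nu> j = card {i. (i, j) \<in> \<nu>}"

definition differ_by_box :: "diagram \<Rightarrow> diagram \<Rightarrow> bool" where
  "differ_by_box \<nu> \<mu> \<longleftrightarrow> (\<exists>b. b \<notin> \<nu> \<and> \<mu> = insert b \<nu>) \<or> (\<exists>b. b \<notin> \<mu> \<and> \<nu> = insert b \<mu>)"

definition labels_O_infinity :: "diagram set" where
  "labels_O_infinity = {\<nu>. young \<nu>}"

definition labels_O :: "nat \<Rightarrow> diagram set" where
  "labels_O N = {\<nu>. young \<nu> \<and> column_length \<nu> 0 + column_length \<nu> 1 \<le> N}"

definition labels_Sp :: "nat \<Rightarrow> diagram set" where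
  "labels_Sp N = {\<nu>. young \<nu> \<and> column_length \<nu> 0 \<le> N}"

definition labels_O_fusion :: "nat \<Rightarrow> nat \<Rightarrow> diagram set" where
  "labels_O_fusion N M = {\<nu>. young \<nu> \<and> column_length \<nu> 0 + column_length \<nu> 1 \<le> N \<and>
     row_length \<nu> 0 + row_length \<nu> 1 \<le> M}"

definition labels_OSp_fusion :: "nat \<Rightarrow> nat \<Rightarrow> diagram set" where
  "labels_OSp_fusion N M = {\<nu>. young \<nu> \<and> column_length \<nu> 0 + column_length \<nu> 1 \<le> N \<and>
     row_length \<nu> 0 \<le> M}"

definition labels_Sp_fusion :: "nat \<Rightarrow> nat \<Rightarrow> diagram set" where
  "labels_Sp_fusion N M = {\<nu>. young \<nu> \<and> column_length \<nu> 0 \<le> N \<and> row_length \<nu> 0 \<le> M}"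


section \<open>Categories of orthogonal or symplectic type\<close>

definition orthogonal_labels :: "nat \<Rightarrow> diagram set \<Rightarrow> bool" where
  "orthogonal_labels N L \<longleftrightarrow> L = labels_O N \<or>
     (\<exists>M. L = labels_O_fusion N M) \<or> (\<exists>M. L = labels_OSp_fusion N M)"

definition symplectic_labels :: "nat \<Rightarrow> diagram set \<Rightarrow> bool" where
  "symplectic_labels N L \<longleftrightarrow> L = labels_Sp N \<or> (\<exists>M. L = labels_Sp_fusion N M)"

text \<open>\<open>V\<close> chooses a representative \<open>V \<nu>\<close> of the isomorphism class of simple objects with
  label \<open>\<nu> \<in> L\<close>; values of \<open>V\<close> outside \<open>L\<close> are irrelevant.\<close>

definition has_fusion_rules ::
    "('o, 'm) tensor_cat \<Rightarrow> diagram set \<Rightarrow> (diagram \<Rightarrow> 'o) \<Rightarrow> bool" where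
  "has_fusion_rules C L V \<longleftrightarrow>
     (\<forall>\<nu>\<in>L. simple_ob C (V \<nu>)) \<and>
     (\<forall>X. simple_ob C X \<longrightarrow> (\<exists>\<nu>\<in>L. isomorphic C X (V \<nu>))) \<and>
     (\<forall>\<nu>\<in>L. \<forall>\<mu>\<in>L. isomorphic C (V \<nu>) (V \<mu>) \<longrightarrow> \<nu> = \<mu>) \<and>
     isomorphic C (V {}) (unit C) \<and>
     (\<forall>\<nu>\<in>L. is_direct_sum C (tens_ob C (V \<nu>) (V (row_diagram 1)))
                {\<mu>\<in>L. differ_by_box \<nu> \<mu>} V)"

definition orth_sympl_type ::
    "('o, 'm) tensor_cat \<Rightarrow> diagram set \<Rightarrow> (diagram \<Rightarrow> 'o) \<Rightarrow> bool" where
  "orth_sympl_type C L V \<longleftrightarrow>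
     rigid_semisimple_braided_cat C \<and>
     (L = labels_O_infinity \<or> (\<exists>N. orthogonal_labels N L) \<or> (\<exists>N. symplectic_labels N L)) \<and>
     row_diagram 2 \<in> L \<and> column_diagram 2 \<in> L \<and>
     has_fusion_rules C L V"

text \<open>\<open>t \<in> End(Y)\<close> acts by the scalar \<open>a\<close> on the summands of \<open>Y\<close> isomorphic to \<open>Z\<close>.\<close>

definition acts_by ::
    "('o, 'm) tensor_cat \<Rightarrow> 'm \<Rightarrow> 'o \<Rightarrow> 'o \<Rightarrow> complex \<Rightarrow> bool" where
  "acts_by C t Y Z a \<longleftrightarrow> (\<forall>f\<in>mor C Z Y. cmp C t f = a \<odot>\<^bsub>Hom C Z Y\<^esub> f)"

definition has_parameters ::
    "('o, 'm) tensor_cat \<Rightarrow> (diagram \<Rightarrow> 'o) \<Rightarrow> complex \<Rightarrow> complex \<Rightarrow> bool" where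
  "has_parameters C V r q \<longleftrightarrow> r \<noteq> 0 \<and> q \<noteq> 0 \<and> q \<noteq> - inverse q \<and>
     (\<exists>\<gamma>. \<gamma> ^ 4 = 1 \<and>
        (let X = V (row_diagram 1); XX = tens_ob C X X;
             t = \<gamma> \<odot>\<^bsub>Hom C XX XX\<^esub> braid C X X
         in acts_by C t XX (V (row_diagram 2)) q \<and>
            acts_by C t XX (V (column_diagram 2)) (- inverse q) \<and>
            acts_by C t XX (unit C) (inverse r)))"

end

theory Submission
  imports Defs "HOL-Library.Function_Algebras"
begin

text \<open>The braiding of \<open>X\<close> with a suitably normalised cup and cap satisfies the Kauffman skein relation.
  On the summand \<open>X\<^sub>\<mu>\<close> of \<open>X\<^sub>\<nu> \<otimes> X\<close>, the idempotent together with a crossing and a cup-cap generates a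
  commutative algebra of endomorphisms of \<open>X\<^sub>\<mu> \<otimes> X\<close>, diagonal in the fusion decomposition; its partial
  traces and the braid relation determine the eigenvalues and the ratios of dimensions one box at a
  time. Along the column diagrams \<open>[1\<^sup>n]\<close> this becomes a scalar recursion in \<open>q\<close> and \<open>r\<close>. The last
  column diagram of the label set has fewer neighbours than the others; this closes the recursion
  with one extra equation, which fixes \<open>r\<close>.\<close>

section \<open>Linear functionals\<close>

text \<open>No pivotal structure is given, so no dimensions are at hand: only the cup and cap on
  \<open>X\<close> are. Closing the last strand with them yields ratios of consecutive dimensions,
  which suffice for the recursion. A step from [1^n] has two unknown ratios, towards [1^(n+1)] and
  towards the hook [2,1^(n-1)], and two equations, the partial traces of the identity and of the
  compressed crossing. The eigenvalue on the column is -1/q. On the hook the braid relation leaves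
  two candidates; the wrong one, again -1/q, would make the crossing scalar off the old summand and
  force r = -1/q with loop value 2, which has to be excluded separately. Quotients by q - 1/q would
  lose the case q^2 = 1, so q-integers and dimension factors are kept in a form that survives there.
  The ratio of [1^(n+1)] to [1^n] contains two decisive factors. For q^2 \<noteq> 1 one vanishes at
  r = -q^(2n+1) and ends a symplectic chain, the other vanishes at r^2 = q^(2n-2), the orthogonal
  values up to sign.\<close>

definition linfun :: "(complex, 'm) module \<Rightarrow> ('m \<Rightarrow> complex) \<Rightarrow> bool" where
  "linfun M \<phi> \<longleftrightarrow> (\<forall>f\<in>carrier M. \<forall>g\<in>carrier M. \<phi> (f \<oplus>\<^bsub>M\<^esub> g) = \<phi> f + \<phi> g) \<and>
     (\<forall>a. \<forall>f\<in>carrier M. \<phi> (a \<odot>\<^bsub>M\<^esub> f) = a * \<phi> f)"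

lemma complex_ring_simps [simp]:
  "carrier complex_ring = UNIV" "add complex_ring = (+)" "monoid.mult complex_ring = (*)"
  "ring.zero complex_ring = 0" "one complex_ring = 1"
  by (simp_all add: ring_of_type_algebra_def)

lemma complex_ring_uminus [simp]: "\<ominus>\<^bsub>complex_ring\<^esub> (a::complex) = - a"
proof -
  interpret cring "complex_ring" by (rule cring_from_type_algebra)
  show ?thesis using minus_equality[of "- a" a] by simp
qed

text \<open>The coefficient functions form a vector space on a whole type, where independent sets
  extend to bases. A functional there that vanishes on the relations \<open>K\<close> and is 1 at a
  preimage of \<open>f\<close> descends to \<open>M\<close>.\<close>

lemma linfun_separates:
  fixes M :: "(complex, 'm) module"
  assumes "module complex_ring M" and fd: "fin_dim M" and fM: "f \<in> carrier M" and nz: "f \<noteq> \<zero>\<^bsub>M\<^esub>"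
  shows "\<exists>\<phi>. linfun M \<phi> \<and> \<phi> f \<noteq> 0"
proof -
  interpret M: module complex_ring M by fact
  obtain B where B: "finite B" "B \<subseteq> carrier M"
    and span: "\<And>f. f \<in> carrier M \<Longrightarrow> \<exists>a. f = (\<Oplus>\<^bsub>M\<^esub>b\<in>B. a b \<odot>\<^bsub>M\<^esub> b)"
    using fd unfolding fin_dim_def by blast
  define T where "T a = (\<Oplus>\<^bsub>M\<^esub>b\<in>B. a b \<odot>\<^bsub>M\<^esub> b)" for a :: "'m \<Rightarrow> complex"
  define sc where "sc c (a :: 'm \<Rightarrow> complex) = (\<lambda>b. c * a b)" for c a
  have fn: "(\<lambda>b. a b \<odot>\<^bsub>M\<^esub> b) \<in> B \<rightarrow> carrier M" for a using B by auto
  have Tc: "T a \<in> carrier M" for a unfolding T_def by (rule M.finsum_closed[OF fn])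
  have Tadd: "T (a + a') = T a \<oplus>\<^bsub>M\<^esub> T a'" for a a'
  proof -
    have "T (a + a') = (\<Oplus>\<^bsub>M\<^esub>b\<in>B. a b \<odot>\<^bsub>M\<^esub> b \<oplus>\<^bsub>M\<^esub> a' b \<odot>\<^bsub>M\<^esub> b)"
      unfolding T_def by (rule M.finsum_cong') (use B M.smult_l_distr in auto)
    then show ?thesis unfolding T_def using M.finsum_addf[OF fn fn] by simp
  qed
  have Tsc: "T (sc c a) = c \<odot>\<^bsub>M\<^esub> T a" for c a
  proof -
    have "T (sc c a) = (\<Oplus>\<^bsub>M\<^esub>b\<in>B. c \<odot>\<^bsub>M\<^esub> (a b \<odot>\<^bsub>M\<^esub> b))"
      unfolding T_def by (rule M.finsum_cong') (use B M.smult_assoc1 in \<open>auto simp: sc_def\<close>)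
    then show ?thesis unfolding T_def using M.finsum_smult_ldistr[OF B(1) _ fn, of c] by simp
  qed
  interpret V: vector_space sc
    by unfold_locales (auto simp: sc_def fun_eq_iff algebra_simps)
  interpret P: vector_space_pair sc "(*) :: complex \<Rightarrow> complex \<Rightarrow> complex"
    by unfold_locales (auto simp: algebra_simps)
  define K where "K = {a. T a = \<zero>\<^bsub>M\<^esub>}"
  have T0: "T 0 = \<zero>\<^bsub>M\<^esub>"
    using Tsc[of 0 0] M.smult_l_null[OF Tc[of 0]] by (simp add: sc_def zero_fun_def)
  have sub: "V.subspace K"
    unfolding V.subspace_def K_def using T0 Tadd Tsc M.smult_r_null by auto
  obtain a0 where a0: "f = T a0" using span[OF fM] unfolding T_def by blast
  obtain D where D: "D \<subseteq> K" "V.independent D" "K \<subseteq> V.span D"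
    using V.maximal_independent_subset by blast
  have spD: "V.span D = K"
    by (rule subset_antisym) (use V.span_minimal[OF D(1) sub] D(3) in auto)
  have "a0 \<notin> V.span D" using nz a0 by (auto simp: spD K_def)
  then have ind: "V.independent (insert a0 D)" by (rule V.independent_insertI[OF _ D(2)])
  obtain g where g: "Vector_Spaces.linear sc (*) g"
    and gv: "\<And>x. x \<in> insert a0 D \<Longrightarrow> g x = (if x = a0 then 1 else 0::complex)"
    using P.linear_independent_extend[OF ind, of "\<lambda>x. if x = a0 then 1 else 0"] by blast
  interpret g: Vector_Spaces.linear sc "(*)" g by fact
  have "a0 \<notin> D" using \<open>a0 \<notin> V.span D\<close> V.span_base by blast
  then have gK: "g a = 0" if "a \<in> K" for a
    using g.eq_0_on_span[of D a] gv that spD by (metis insertCI)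
  \<comment> \<open>The choice of a preimage is harmless: two preimages of \<open>v\<close> differ
    by an element of \<open>K\<close>, which \<open>g\<close> kills.\<close>
  define \<phi> where "\<phi> v = g (SOME a. v = T a)" for v
  have \<phi>T: "\<phi> (T a) = g a" for a
  proof -
    define a' where "a' = (SOME a'. T a = T a')"
    have "T a = T a'" unfolding a'_def using someI[of "\<lambda>a'. T a = T a'" a, OF refl] .
    then have "T (a - a') \<oplus>\<^bsub>M\<^esub> T a' = T a'" using Tadd[of "a - a'" a'] by simp
    then have "T (a - a') = \<zero>\<^bsub>M\<^esub>" using M.add.r_cancel_one[OF Tc Tc] by blast
    then have "g (a - a') = 0" using gK by (simp add: K_def)
    then have "g a = g a'" using g.diff by simp
    then show ?thesis by (simp add: \<phi>_def a'_def)
  qed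
  have "linfun M \<phi>" unfolding linfun_def
  proof (intro conjI ballI allI)
    fix u v assume "u \<in> carrier M" "v \<in> carrier M"
    then obtain a a' where "u = T a" "v = T a'" using span unfolding T_def by blast
    then show "\<phi> (u \<oplus>\<^bsub>M\<^esub> v) = \<phi> u + \<phi> v" using \<phi>T Tadd g.add by metis
  next
    fix c u assume "u \<in> carrier M"
    then obtain a where "u = T a" using span unfolding T_def by blast
    then show "\<phi> (c \<odot>\<^bsub>M\<^esub> u) = c * \<phi> u" using \<phi>T Tsc g.scale by metis
  qed
  moreover have "\<phi> f \<noteq> 0" using \<phi>T a0 gv by simp
  ultimately show ?thesis by blast
qed

lemma linfun_eqI:
  fixes M :: "(complex, 'm) module"
  assumes "module complex_ring M" and "fin_dim M" and "f \<in> carrier M" and "g \<in> carrier M"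
    and eq: "\<And>\<phi>. linfun M \<phi> \<Longrightarrow> \<phi> f = \<phi> g"
  shows "f = g"
proof (rule ccontr)
  interpret M: module complex_ring M by fact
  define h where "h = f \<oplus>\<^bsub>M\<^esub> ((-1) \<odot>\<^bsub>M\<^esub> g)"
  assume "f \<noteq> g"
  have "(-1) \<odot>\<^bsub>M\<^esub> g = \<ominus>\<^bsub>M\<^esub> (1 \<odot>\<^bsub>M\<^esub> g)" using M.smult_l_minus[of 1 g] assms(4) by simp
  also have "1 \<odot>\<^bsub>M\<^esub> g = g" using M.smult_one[OF assms(4)] by simp
  finally have h: "h = f \<oplus>\<^bsub>M\<^esub> (\<ominus>\<^bsub>M\<^esub> g)" by (simp only: h_def)
  have "h \<noteq> \<zero>\<^bsub>M\<^esub>"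
  proof
    assume "h = \<zero>\<^bsub>M\<^esub>"
    then have e: "f \<oplus>\<^bsub>M\<^esub> (\<ominus>\<^bsub>M\<^esub> g) = \<zero>\<^bsub>M\<^esub>" by (simp only: h)
    have "\<ominus>\<^bsub>M\<^esub> g \<in> carrier M" by (rule abelian_group.a_inv_closed[OF M.abelian_group_axioms assms(4)])
    from abelian_group.minus_equality[OF M.abelian_group_axioms e this assms(3)]
    have "\<ominus>\<^bsub>M\<^esub> (\<ominus>\<^bsub>M\<^esub> g) = f" .
    then show False using \<open>f \<noteq> g\<close> abelian_group.minus_minus[OF M.abelian_group_axioms assms(4)] by metis
  qed
  moreover have hM: "h \<in> carrier M" using assms(3,4) by (simp add: h_def)
  ultimately obtain \<phi> where \<phi>: "linfun M \<phi>" "\<phi> h \<noteq> 0"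
    using linfun_separates[OF assms(1,2)] by blast
  have mg: "(-1) \<odot>\<^bsub>M\<^esub> g \<in> carrier M" by (rule M.smult_closed) (use assms(4) in auto)
  have "\<phi> h = \<phi> f + \<phi> ((-1) \<odot>\<^bsub>M\<^esub> g)"
    using \<phi>(1) assms(3) mg unfolding h_def linfun_def by blast
  also have "\<phi> ((-1) \<odot>\<^bsub>M\<^esub> g) = -1 * \<phi> g" using \<phi>(1) assms(4) unfolding linfun_def by blast
  finally have "\<phi> h = \<phi> f - \<phi> g" by simp
  then show False using \<phi> eq by simp
qed

lemma linfun_finsum:
  fixes M :: "(complex, 'm) module"
  assumes "module complex_ring M" and "linfun M \<phi>" and "finite I" and "\<And>i. i \<in> I \<Longrightarrow> f i \<in> carrier M"
  shows "\<phi> (\<Oplus>\<^bsub>M\<^esub>i\<in>I. f i) = (\<Sum>i\<in>I. \<phi> (f i))"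
proof -
  interpret M: module complex_ring M by fact
  have "\<phi> (0 \<odot>\<^bsub>M\<^esub> \<zero>\<^bsub>M\<^esub>) = 0 * \<phi> \<zero>\<^bsub>M\<^esub>"
    using assms(2) M.zero_closed unfolding linfun_def by blast
  then have z: "\<phi> \<zero>\<^bsub>M\<^esub> = 0" by simp
  show ?thesis using assms(3,4)
  proof (induction I rule: finite_induct)
    case (insert i I)
    then have "(\<Oplus>\<^bsub>M\<^esub>i\<in>insert i I. f i) = f i \<oplus>\<^bsub>M\<^esub> (\<Oplus>\<^bsub>M\<^esub>i\<in>I. f i)"
      by (intro M.finsum_insert) auto
    moreover have "(\<Oplus>\<^bsub>M\<^esub>i\<in>I. f i) \<in> carrier M" using insert by (intro M.finsum_closed) auto
    ultimately show ?case using insert assms(2) unfolding linfun_def by simp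
  qed (simp add: z)
qed

section \<open>Linear categories\<close>

context linear_cat
begin

text \<open>Different Hom spaces are disjoint, so a morphism determines its source and target.
  Typing then consists of equations between \<open>dm\<close> and \<open>cd\<close> that
  simplification can discharge.\<close>

definition arr :: "'m \<Rightarrow> bool" where "arr f \<longleftrightarrow> (\<exists>X Y. f \<in> mor C X Y)"
definition dm :: "'m \<Rightarrow> 'o" where "dm f = (THE X. \<exists>Y. f \<in> mor C X Y)"
definition cd :: "'m \<Rightarrow> 'o" where "cd f = (THE Y. \<exists>X. f \<in> mor C X Y)"

lemma mor_iff: "f \<in> mor C X Y \<longleftrightarrow> arr f \<and> dm f = X \<and> cd f = Y"
proof -
  have *: "arr f \<and> dm f = A \<and> cd f = B" if "f \<in> mor C A B" for A B
    using that mor_disjoint unfolding arr_def dm_def cd_def by blast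
  then show ?thesis unfolding arr_def using * by blast
qed

text \<open>Addition and scaling read the Hom space off a morphism, so that equations carry no
  module annotations.\<close>

definition pl :: "'m \<Rightarrow> 'm \<Rightarrow> 'm" (infixl \<open>\<boxplus>\<close> 65) where "f \<boxplus> g = f \<oplus>\<^bsub>Hom C (dm f) (cd f)\<^esub> g"
definition sc :: "complex \<Rightarrow> 'm \<Rightarrow> 'm" (infixr \<open>\<odot>\<close> 74) where "a \<odot> f = a \<odot>\<^bsub>Hom C (dm f) (cd f)\<^esub> f"

text \<open>Equations between linear combinations of morphisms are checked after applying an arbitrary linear
  functional, i.e. as equations between complex numbers.\<close>

definition lf :: "'o \<Rightarrow> 'o \<Rightarrow> ('m \<Rightarrow> complex) \<Rightarrow> bool" where "lf A B \<phi> \<longleftrightarrow> linfun (Hom C A B) \<phi>"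

lemma pl_mor: "f \<in> mor C X Y \<Longrightarrow> f \<boxplus> g = f \<oplus>\<^bsub>Hom C X Y\<^esub> g" 
  by (simp add: pl_def mor_iff)
lemma sc_mor: "f \<in> mor C X Y \<Longrightarrow> a \<odot> f = a \<odot>\<^bsub>Hom C X Y\<^esub> f"
  by (simp add: sc_def mor_iff)

lemma sc_closed: "f \<in> mor C X Y \<Longrightarrow> a \<odot> f \<in> mor C X Y"
  using module.smult_closed[OF vector_space, of a f] by (simp add: sc_mor)
lemma pl_closed: "f \<in> mor C X Y \<Longrightarrow> g \<in> mor C X Y \<Longrightarrow> f \<boxplus> g \<in> mor C X Y"
  using abelian_monoid.a_closed[OF abelian_group.axioms(1)[OF module.axioms(2)[OF vector_space]]] 
  by (simp add: pl_mor)
lemma zero_closed: "zero_mor C X Y \<in> mor C X Y"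
  using abelian_monoid.zero_closed[OF abelian_group.axioms(1)[OF module.axioms(2)[OF vector_space]]] .

lemma arr_simps [simp]:
  "arr (ident C X)" "dm (ident C X) = X" "cd (ident C X) = X"
  "arr (zero_mor C X Y)" "dm (zero_mor C X Y) = X" "cd (zero_mor C X Y) = Y"
  "arr f \<Longrightarrow> arr (a \<odot> f)" "arr f \<Longrightarrow> dm (a \<odot> f) = dm f" "arr f \<Longrightarrow> cd (a \<odot> f) = cd f"
  "\<lbrakk>arr f; arr g; dm f = dm g; cd f = cd g\<rbrakk> \<Longrightarrow> arr (f \<boxplus> g)"
  "\<lbrakk>arr f; arr g; dm f = dm g; cd f = cd g\<rbrakk> \<Longrightarrow> dm (f \<boxplus> g) = dm g"
  "\<lbrakk>arr f; arr g; dm f = dm g; cd f = cd g\<rbrakk> \<Longrightarrow> cd (f \<boxplus> g) = cd g"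
  "\<lbrakk>arr f; arr g; dm g = cd f\<rbrakk> \<Longrightarrow> arr (g \<cdot> f)"
  "\<lbrakk>arr f; arr g; dm g = cd f\<rbrakk> \<Longrightarrow> dm (g \<cdot> f) = dm f"
  "\<lbrakk>arr f; arr g; dm g = cd f\<rbrakk> \<Longrightarrow> cd (g \<cdot> f) = cd g"
  using ident_mor[of X] zero_closed[of X Y] sc_closed[of f "dm f" "cd f" a]
    pl_closed[of f "dm f" "cd f" g] comp_mor[of g "dm g" "cd g" f "dm f"] by (auto simp: mor_iff)

lemma mor_eqI:
  assumes "arr f" "arr g" "dm f = dm g" "cd f = cd g" "\<And>\<phi>. lf (dm g) (cd g) \<phi> \<Longrightarrow> \<phi> f = \<phi> g"
  shows "f = g"
  using linfun_eqI[OF vector_space finite_dimensional, of f "dm g" "cd g" g] assms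
  by (auto simp: mor_iff lf_def)

lemma lf_pl [simp]: "\<lbrakk>lf A B \<phi>; arr f; arr g; dm f = A; cd f = B; dm g = A; cd g = B\<rbrakk> \<Longrightarrow> \<phi> (f \<boxplus> g) = \<phi> f + \<phi> g"
  by (auto simp: lf_def linfun_def pl_def mor_iff)
lemma lf_sc [simp]: "\<lbrakk>lf A B \<phi>; arr f; dm f = A; cd f = B\<rbrakk> \<Longrightarrow> \<phi> (a \<odot> f) = a * \<phi> f"
  by (auto simp: lf_def linfun_def sc_def mor_iff)
lemma lf_zero [simp]: "lf A B \<phi> \<Longrightarrow> \<phi> (zero_mor C A B) = 0"
  using linfun_finsum[OF vector_space[of A B], of \<phi> "{}" "\<lambda>x. x"]
    abelian_monoid.finsum_empty[OF abelian_group.axioms(1)[OF module.axioms(2)[OF vector_space]]]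
  by (metis empty_iff finite.emptyI lf_def sum.empty)

lemma cmp_assoc: "\<lbrakk>arr f; arr g; arr h; dm h = cd g; dm g = cd f\<rbrakk> \<Longrightarrow> (h \<cdot> g) \<cdot> f = h \<cdot> (g \<cdot> f)"
  using comp_assoc[of h "dm h" "cd h" g "dm g" f "dm f"] by (simp add: mor_iff)
lemma cmp_ident [simp]: "\<lbrakk>arr f; cd f = X\<rbrakk> \<Longrightarrow> ident C X \<cdot> f = f" "\<lbrakk>arr f; dm f = X\<rbrakk> \<Longrightarrow> f \<cdot> ident C X = f"
  using ident_left ident_right mor_iff by blast+
lemma cmp_pl:
  "\<lbrakk>arr f; arr g; arr h; dm f = dm g; cd f = cd g; dm h = cd g\<rbrakk> \<Longrightarrow> h \<cdot> (f \<boxplus> g) = h \<cdot> f \<boxplus> h \<cdot> g"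
  "\<lbrakk>arr f; arr g; arr h; dm f = dm g; cd f = cd g; dm g = cd h\<rbrakk> \<Longrightarrow> (f \<boxplus> g) \<cdot> h = f \<cdot> h \<boxplus> g \<cdot> h"
  using comp_add_right[of h "dm h" "cd h" f "dm f" g] comp_add_left[of f "dm f" "cd f" g h "dm h"]
  by (simp_all add: mor_iff pl_def)
lemma cmp_sc:
  "\<lbrakk>arr f; arr h; dm h = cd f\<rbrakk> \<Longrightarrow> h \<cdot> (a \<odot> f) = a \<odot> (h \<cdot> f)"
  "\<lbrakk>arr f; arr h; dm f = cd h\<rbrakk> \<Longrightarrow> (a \<odot> f) \<cdot> h = a \<odot> (f \<cdot> h)"
  using comp_smult_right[of h "dm h" "cd h" f "dm f" a] comp_smult_left[of f "dm f" "cd f" h "dm h" a]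
  by (simp_all add: mor_iff sc_def)

lemma sc_sc [simp]: "arr f \<Longrightarrow> a \<odot> (b \<odot> f) = (a * b) \<odot> f"
  by (rule mor_eqI) (auto simp: )
lemma sc_one [simp]: "arr f \<Longrightarrow> 1 \<odot> f = f"
  by (rule mor_eqI) auto
lemma sc_zero: "arr f \<Longrightarrow> 0 \<odot> f = zero_mor C (dm f) (cd f)"
  by (rule mor_eqI) auto
lemma sc_zero_mor [simp]: "a \<odot> zero_mor C X Y = zero_mor C X Y"
  by (rule mor_eqI) auto
lemma cmp_zero [simp]:
  "\<lbrakk>arr h; dm h = Y\<rbrakk> \<Longrightarrow> h \<cdot> zero_mor C X Y = zero_mor C X (cd h)"
  "\<lbrakk>arr h; cd h = X\<rbrakk> \<Longrightarrow> zero_mor C X Y \<cdot> h = zero_mor C (dm h) Y"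
  using cmp_sc(1)[of "zero_mor C X Y" h 0] cmp_sc(2)[of "zero_mor C X Y" h 0] 
    sc_zero[of "h \<cdot> zero_mor C X Y"] sc_zero[of "zero_mor C X Y \<cdot> h"] by auto
lemma pl_zero [simp]:
  "\<lbrakk>arr f; dm f = X; cd f = Y\<rbrakk> \<Longrightarrow> f \<boxplus> zero_mor C X Y = f"
  "\<lbrakk>arr f; dm f = X; cd f = Y\<rbrakk> \<Longrightarrow> zero_mor C X Y \<boxplus> f = f"
  by (rule mor_eqI; auto)+

lemma sc_cancel: 
  assumes "arr f" "f \<noteq> zero_mor C (dm f) (cd f)" "a \<odot> f = b \<odot> f" shows "a = b"
proof (rule ccontr)
  assume "a \<noteq> b"
  have "f = zero_mor C (dm f) (cd f)"
  proof (rule mor_eqI)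
    fix \<phi> assume "lf (dm (zero_mor C (dm f) (cd f))) (cd (zero_mor C (dm f) (cd f))) \<phi>"
    then have l: "lf (dm f) (cd f) \<phi>" by simp
    have "\<phi> (a \<odot> f) = \<phi> (b \<odot> f)" using assms by simp
    then show "\<phi> f = \<phi> (zero_mor C (dm f) (cd f))" using l \<open>a \<noteq> b\<close> assms(1) by simp
  qed (use assms in auto)
  then show False using assms by simp
qed

lemma sc_eq_zero: "arr f \<Longrightarrow> a \<odot> f = zero_mor C (dm f) (cd f) \<Longrightarrow> a = 0 \<or> f = zero_mor C (dm f) (cd f)"
  using sc_cancel[of f a 0] sc_zero by auto

text \<open>Composites are normalised to the right, which hides a known product
  \<open>g \<cdot> f\<close> inside \<open>g \<cdot> (f \<cdot> h)\<close>; this form reaches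
  it.\<close>

lemma reassoc: 
  "\<lbrakk>g \<cdot> f = k; arr g; arr f; dm g = cd f; arr h; cd h = dm f\<rbrakk> \<Longrightarrow> g \<cdot> (f \<cdot> h) = k \<cdot> h"
  by (metis cmp_assoc)

end

section \<open>Semisimplicity and Schur's lemma\<close>

lemma left_ideal_principal:
  assumes "ring R" "F \<in> carrier R"
  shows "left_ideal {h \<otimes>\<^bsub>R\<^esub> F | h. h \<in> carrier R} R"
proof -
  interpret ring R by fact
  have "subgroup {h \<otimes>\<^bsub>R\<^esub> F | h. h \<in> carrier R} (add_monoid R)"
  proof (rule add.subgroupI)
    fix a assume "a \<in> {h \<otimes>\<^bsub>R\<^esub> F | h. h \<in> carrier R}"
    then obtain h where h: "a = h \<otimes>\<^bsub>R\<^esub> F" "h \<in> carrier R" by blast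
    have "\<ominus>\<^bsub>R\<^esub> a = (\<ominus>\<^bsub>R\<^esub> h) \<otimes>\<^bsub>R\<^esub> F" using h assms l_minus by simp
    then show "\<ominus>\<^bsub>R\<^esub> a \<in> {h \<otimes>\<^bsub>R\<^esub> F | h. h \<in> carrier R}" using h(2) by blast
  next
    fix a b assume "a \<in> {h \<otimes>\<^bsub>R\<^esub> F | h. h \<in> carrier R}" "b \<in> {h \<otimes>\<^bsub>R\<^esub> F | h. h \<in> carrier R}"
    then obtain h k where h: "a = h \<otimes>\<^bsub>R\<^esub> F" "h \<in> carrier R" "b = k \<otimes>\<^bsub>R\<^esub> F" "k \<in> carrier R" by blast
    have "a \<oplus>\<^bsub>R\<^esub> b = (h \<oplus>\<^bsub>R\<^esub> k) \<otimes>\<^bsub>R\<^esub> F" using h assms l_distr by simp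
    then show "a \<oplus>\<^bsub>R\<^esub> b \<in> {h \<otimes>\<^bsub>R\<^esub> F | h. h \<in> carrier R}" using h by auto
  qed (use assms in \<open>auto intro: exI[of _ "\<zero>\<^bsub>R\<^esub>"]\<close>)
  moreover have "a \<otimes>\<^bsub>R\<^esub> x \<in> {h \<otimes>\<^bsub>R\<^esub> F | h. h \<in> carrier R}"
    if a: "a \<in> carrier R" and "x \<in> {h \<otimes>\<^bsub>R\<^esub> F | h. h \<in> carrier R}" for a x
  proof -
    from that(2) obtain h where h: "x = h \<otimes>\<^bsub>R\<^esub> F" "h \<in> carrier R" by blast
    then have "a \<otimes>\<^bsub>R\<^esub> x = (a \<otimes>\<^bsub>R\<^esub> h) \<otimes>\<^bsub>R\<^esub> F" using a assms m_assoc by simp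
    then show ?thesis using h a by auto
  qed
  ultimately show ?thesis unfolding left_ideal_def additive_subgroup_def by blast
qed

text \<open>The left ideal generated by \<open>F\<close> squares to zero, so a complement leaves no room for it.\<close>

lemma semisimple_ring_nilpotent:
  assumes ss: "semisimple_ring R" and F: "F \<in> carrier R"
    and nil: "\<And>h. h \<in> carrier R \<Longrightarrow> F \<otimes>\<^bsub>R\<^esub> (h \<otimes>\<^bsub>R\<^esub> F) = \<zero>\<^bsub>R\<^esub>"
  shows "F = \<zero>\<^bsub>R\<^esub>"
proof -
  interpret ring R using ss by (simp add: semisimple_ring_def)
  let ?I = "{h \<otimes>\<^bsub>R\<^esub> F | h. h \<in> carrier R}"
  obtain J where J: "left_ideal J R" "?I \<inter> J = {\<zero>\<^bsub>R\<^esub>}" "?I <+>\<^bsub>R\<^esub> J = carrier R"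
    using ss left_ideal_principal[OF _ F] unfolding semisimple_ring_def by meson
  obtain i j where ij: "i \<in> ?I" "j \<in> J" "\<one>\<^bsub>R\<^esub> = i \<oplus>\<^bsub>R\<^esub> j"
  proof -
    have "\<one>\<^bsub>R\<^esub> \<in> ?I <+>\<^bsub>R\<^esub> J" unfolding J(3) by (rule one_closed)
    then show ?thesis using that unfolding set_add_def set_mult_def by auto
  qed
  then obtain h where h: "i = h \<otimes>\<^bsub>R\<^esub> F" "h \<in> carrier R" by blast
  have jc: "j \<in> carrier R"
    using J(1) ij(2) additive_subgroup.a_Hcarr unfolding left_ideal_def by metis
  have "F = F \<otimes>\<^bsub>R\<^esub> i \<oplus>\<^bsub>R\<^esub> F \<otimes>\<^bsub>R\<^esub> j"
    using r_distr[of i j F] F h jc ij(3) r_one[OF F] by simp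
  also have "F \<otimes>\<^bsub>R\<^esub> i = \<zero>\<^bsub>R\<^esub>" using nil h by simp
  finally have "F = F \<otimes>\<^bsub>R\<^esub> j" unfolding l_zero[OF m_closed[OF F jc]] .
  moreover have "F \<otimes>\<^bsub>R\<^esub> j \<in> J" using J(1) F ij(2) unfolding left_ideal_def by blast
  ultimately have FJ: "F \<in> J" by simp
  have "F = \<one>\<^bsub>R\<^esub> \<otimes>\<^bsub>R\<^esub> F" using F by simp
  then have "F \<in> ?I" using one_closed by blast
  then have "F \<in> ?I \<inter> J" using FJ by (rule IntI)
  then show ?thesis unfolding J(2) by (rule singletonD)
qed

section \<open>Finite direct sums, simple objects and isomorphisms\<close>

context linear_cat
begin

lemma lf_precomp: "lf W Y \<phi> \<Longrightarrow> arr f \<Longrightarrow> dm f = W \<Longrightarrow> lf (cd f) Y (\<lambda>h. \<phi> (h \<cdot> f))"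
  unfolding lf_def[of "cd f"] linfun_def
proof (intro conjI ballI allI)
  assume *: "lf W Y \<phi>" "arr f" "dm f = W"
  fix h assume h: "h \<in> mor C (cd f) Y"
  show "\<phi> ((a \<odot>\<^bsub>Hom C (cd f) Y\<^esub> h) \<cdot> f) = a * \<phi> (h \<cdot> f)" for a
    using h * sc_mor[OF h, of a, symmetric] cmp_sc(2)[of h f a] by (simp add: mor_iff)
  fix k assume k: "k \<in> mor C (cd f) Y"
  show "\<phi> ((h \<oplus>\<^bsub>Hom C (cd f) Y\<^esub> k) \<cdot> f) = \<phi> (h \<cdot> f) + \<phi> (k \<cdot> f)"
    using h k * pl_mor[OF h, of k, symmetric] cmp_pl(2)[of h k f] by (simp add: mor_iff)
qed

lemma lf_postcomp: "lf W Y \<phi> \<Longrightarrow> arr f \<Longrightarrow> cd f = Y \<Longrightarrow> lf W (dm f) (\<lambda>h. \<phi> (f \<cdot> h))"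
  unfolding lf_def[of W "dm f"] linfun_def
proof (intro conjI ballI allI)
  assume *: "lf W Y \<phi>" "arr f" "cd f = Y"
  fix h assume h: "h \<in> mor C W (dm f)"
  show "\<phi> (f \<cdot> (a \<odot>\<^bsub>Hom C W (dm f)\<^esub> h)) = a * \<phi> (f \<cdot> h)" for a
    using h * sc_mor[OF h, of a, symmetric] cmp_sc(1)[of h f a] by (simp add: mor_iff)
  fix k assume k: "k \<in> mor C W (dm f)"
  show "\<phi> (f \<cdot> (h \<oplus>\<^bsub>Hom C W (dm f)\<^esub> k)) = \<phi> (f \<cdot> h) + \<phi> (f \<cdot> k)"
    unfolding pl_mor[OF h, of k, symmetric]
    using h k * by (simp add: mor_iff cmp_pl(1))
qed

text \<open>The resolution of the identity is tested on functionals, so that sums over summands are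
  sums of complex numbers rather than of morphisms.\<close>

definition dsum :: "'o \<Rightarrow> 'i set \<Rightarrow> ('i \<Rightarrow> 'o) \<Rightarrow> ('i \<Rightarrow> 'm) \<Rightarrow> ('i \<Rightarrow> 'm) \<Rightarrow> bool" where
  "dsum Y I Z inc prj \<longleftrightarrow> finite I \<and>
     (\<forall>i\<in>I. arr (inc i) \<and> dm (inc i) = Z i \<and> cd (inc i) = Y \<and> arr (prj i) \<and> dm (prj i) = Y \<and> cd (prj i) = Z i \<and>
        prj i \<cdot> inc i = ident C (Z i)) \<and>
     (\<forall>i\<in>I. \<forall>j\<in>I. i \<noteq> j \<longrightarrow> prj j \<cdot> inc i = zero_mor C (Z i) (Z j)) \<and>
     (\<forall>\<phi>. lf Y Y \<phi> \<longrightarrow> \<phi> (ident C Y) = (\<Sum>i\<in>I. \<phi> (inc i \<cdot> prj i)))"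

lemma is_direct_sum_dsum:
  assumes "is_direct_sum C Y I Z" shows "\<exists>inc prj. dsum Y I Z inc prj"
proof -
  obtain inc prj where *: "finite I"
        "\<And>i. i\<in>I \<Longrightarrow> inc i \<in> mor C (Z i) Y \<and> prj i \<in> mor C Y (Z i)"
        "\<And>i. i\<in>I \<Longrightarrow> prj i \<cdot> inc i = ident C (Z i)"
        "\<And>i j. i\<in>I \<Longrightarrow> j\<in>I \<Longrightarrow> i \<noteq> j \<Longrightarrow> prj j \<cdot> inc i = zero_mor C (Z i) (Z j)"
        "(\<Oplus>\<^bsub>Hom C Y Y\<^esub>i\<in>I. inc i \<cdot> prj i) = ident C Y"
    using assms unfolding is_direct_sum_def by blast
  have "\<phi> (ident C Y) = (\<Sum>i\<in>I. \<phi> (inc i \<cdot> prj i))" if "lf Y Y \<phi>" for \<phi>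
  proof -
    have "inc i \<cdot> prj i \<in> mor C Y Y" if "i \<in> I" for i using *(2)[OF that] comp_mor by blast
    then show ?thesis
      using linfun_finsum[OF vector_space[of Y Y], of \<phi> I "\<lambda>i. inc i \<cdot> prj i"] *(1,5) that
      unfolding lf_def by auto
  qed
  then have "dsum Y I Z inc prj" using * unfolding dsum_def mor_iff by auto
  then show ?thesis by blast
qed

lemma dsumD:
  assumes "dsum Y I Z inc prj"
  shows "finite I" "i \<in> I \<Longrightarrow> arr (inc i)" "i \<in> I \<Longrightarrow> dm (inc i) = Z i" "i \<in> I \<Longrightarrow> cd (inc i) = Y"
    "i \<in> I \<Longrightarrow> arr (prj i)" "i \<in> I \<Longrightarrow> dm (prj i) = Y" "i \<in> I \<Longrightarrow> cd (prj i) = Z i"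
    "i \<in> I \<Longrightarrow> prj i \<cdot> inc i = ident C (Z i)"
    "i \<in> I \<Longrightarrow> j \<in> I \<Longrightarrow> i \<noteq> j \<Longrightarrow> prj j \<cdot> inc i = zero_mor C (Z i) (Z j)"
    "lf Y Y \<phi> \<Longrightarrow> \<phi> (ident C Y) = (\<Sum>i\<in>I. \<phi> (inc i \<cdot> prj i))"
  using assms unfolding dsum_def by blast+

lemma dsum_in:
  assumes d: "dsum Y I Z inc prj" and f: "arr f" "cd f = Y" and l: "lf (dm f) Y \<phi>"
  shows "\<phi> f = (\<Sum>i\<in>I. \<phi> (inc i \<cdot> (prj i \<cdot> f)))"
proof -
  have "\<phi> f = (\<lambda>h. \<phi> (h \<cdot> f)) (ident C Y)" using f by simp
  also have "\<dots> = (\<Sum>i\<in>I. \<phi> ((inc i \<cdot> prj i) \<cdot> f))"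
    using dsumD(10)[OF d, of "\<lambda>h. \<phi> (h \<cdot> f)"] lf_precomp[OF l f(1)] f by simp
  also have "\<dots> = (\<Sum>i\<in>I. \<phi> (inc i \<cdot> (prj i \<cdot> f)))"
    by (rule sum.cong) (use dsumD[OF d] f in \<open>simp_all add: cmp_assoc\<close>)
  finally show ?thesis .
qed

lemma dsum_out:
  assumes d: "dsum Y I Z inc prj" and f: "arr f" "dm f = Y" and l: "lf Y (cd f) \<phi>"
  shows "\<phi> f = (\<Sum>i\<in>I. \<phi> ((f \<cdot> inc i) \<cdot> prj i))"
proof -
  have "\<phi> f = (\<lambda>h. \<phi> (f \<cdot> h)) (ident C Y)" using f by simp
  also have "\<dots> = (\<Sum>i\<in>I. \<phi> (f \<cdot> (inc i \<cdot> prj i)))"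
    using dsumD(10)[OF d, of "\<lambda>h. \<phi> (f \<cdot> h)"] lf_postcomp[OF l f(1)] f by simp
  also have "\<dots> = (\<Sum>i\<in>I. \<phi> ((f \<cdot> inc i) \<cdot> prj i))"
    by (rule sum.cong) (use dsumD[OF d] f in \<open>simp_all add: cmp_assoc\<close>)
  finally show ?thesis .
qed

lemma dsum_in_eq:
  assumes d: "dsum Y I Z inc prj" and f: "arr f" "cd f = Y"
    and z: "\<And>i. i \<in> I \<Longrightarrow> i \<noteq> k \<Longrightarrow> prj i \<cdot> f = zero_mor C (dm f) (Z i)"
  shows "f = (if k \<in> I then inc k \<cdot> (prj k \<cdot> f) else zero_mor C (dm f) Y)"
proof (rule mor_eqI)
  fix \<phi>
  let ?g = "if k \<in> I then inc k \<cdot> (prj k \<cdot> f) else zero_mor C (dm f) Y"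
  assume "lf (dm ?g) (cd ?g) \<phi>"
  then have l: "lf (dm f) Y \<phi>" using f dsumD[OF d] by (auto split: if_splits)
  have "\<phi> f = (\<Sum>i\<in>I. if i = k then \<phi> (inc k \<cdot> (prj k \<cdot> f)) else 0)"
    unfolding dsum_in[OF d f l] by (rule sum.cong) (use z f dsumD[OF d] l in auto)
  also have "\<dots> = \<phi> ?g" using dsumD(1)[OF d] l by simp
  finally show "\<phi> f = \<phi> ?g" .
qed (use f dsumD[OF d] in auto)

lemma dsum_out_eq:
  assumes d: "dsum Y I Z inc prj" and f: "arr f" "dm f = Y"
    and z: "\<And>i. i \<in> I \<Longrightarrow> i \<noteq> k \<Longrightarrow> f \<cdot> inc i = zero_mor C (Z i) (cd f)"
  shows "f = (if k \<in> I then (f \<cdot> inc k) \<cdot> prj k else zero_mor C Y (cd f))"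
proof (rule mor_eqI)
  fix \<phi>
  let ?g = "if k \<in> I then (f \<cdot> inc k) \<cdot> prj k else zero_mor C Y (cd f)"
  assume "lf (dm ?g) (cd ?g) \<phi>"
  then have l: "lf Y (cd f) \<phi>" using f dsumD[OF d] by (auto split: if_splits)
  have "\<phi> f = (\<Sum>i\<in>I. if i = k then \<phi> ((f \<cdot> inc k) \<cdot> prj k) else 0)"
    unfolding dsum_out[OF d f l] by (rule sum.cong) (use z f dsumD[OF d] l in auto)
  also have "\<dots> = \<phi> ?g" using dsumD(1)[OF d] l by simp
  finally show "\<phi> f = \<phi> ?g" .
qed (use f dsumD[OF d] in auto)

lemma simple_scalar:
  "simple_ob C X \<Longrightarrow> arr f \<Longrightarrow> dm f = X \<Longrightarrow> cd f = X \<Longrightarrow> \<exists>a. f = a \<odot> ident C X"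
  unfolding simple_ob_def sc_mor[OF ident_mor] by (auto simp: set_eq_iff mor_iff image_iff)

lemma simple_nz: "simple_ob C X \<Longrightarrow> ident C X \<noteq> zero_mor C X X"
  unfolding simple_ob_def by blast

lemma scalar_cancel: "simple_ob C X \<Longrightarrow> a \<odot> ident C X = b \<odot> ident C X \<Longrightarrow> a = b"
  using sc_cancel[of "ident C X" a b] simple_nz by simp

lemma isomorphicI: "\<lbrakk>arr f; arr g; dm g = cd f; cd g = dm f; g \<cdot> f = ident C (dm f); f \<cdot> g = ident C (cd f)\<rbrakk>
    \<Longrightarrow> isomorphic C (dm f) (cd f)"
  unfolding isomorphic_def is_iso_def Bex_def mor_iff by blast

lemma isomorphicE:
  assumes "isomorphic C X Y"
  obtains f g where "arr f" "dm f = X" "cd f = Y" "arr g" "dm g = Y" "cd g = X" 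
    "g \<cdot> f = ident C X" "f \<cdot> g = ident C Y"
  using assms unfolding isomorphic_def is_iso_def Bex_def mor_iff by blast

lemma isomorphic_sym: "isomorphic C X Y \<Longrightarrow> isomorphic C Y X"
  by (metis isomorphicE isomorphicI)

lemma isomorphic_trans: assumes "isomorphic C X Y" "isomorphic C Y Z" shows "isomorphic C X Z"
proof -
  obtain f g where 1: "arr f" "dm f = X" "cd f = Y" "arr g" "dm g = Y" "cd g = X" 
    "g \<cdot> f = ident C X" "f \<cdot> g = ident C Y" by (rule isomorphicE[OF assms(1)])
  obtain h k where 2: "arr h" "dm h = Y" "cd h = Z" "arr k" "dm k = Z" "cd k = Y" 
    "k \<cdot> h = ident C Y" "h \<cdot> k = ident C Z" by (rule isomorphicE[OF assms(2)])
  have "isomorphic C (dm (h \<cdot> f)) (cd (h \<cdot> f))"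
    by (rule isomorphicI[of _ "g \<cdot> k"])
      (use 1 2 reassoc[OF 2(7)] reassoc[OF 1(8)] in \<open>simp_all add: cmp_assoc\<close>)
  then show ?thesis using 1 2 by simp
qed

end

section \<open>Schur's lemma from semisimple endomorphism rings\<close>

context rigid_semisimple_braided_cat
begin

text \<open>Inside the endomorphism ring of the direct sum of \<open>A\<close> and \<open>B\<close>,
  \<open>f\<close> becomes an off-diagonal element \<open>F\<close>. If every return composite
  vanished, then \<open>F h F = 0\<close> for all \<open>h\<close>, and semisimplicity would give
  \<open>F = 0\<close>.\<close>

lemma nonzero_has_return:
  assumes f: "arr f" "dm f = A" "cd f = B" and nz: "f \<noteq> zero_mor C A B"
  shows "\<exists>g. arr g \<and> dm g = B \<and> cd g = A \<and> g \<cdot> f \<noteq> zero_mor C A A"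
proof (rule ccontr)
  assume neg: "\<not> ?thesis"
  obtain Y where "is_direct_sum C Y {..<(2::nat)} (\<lambda>i. if i = 0 then A else B)" using direct_sums by blast
  then obtain inc prj where d: "dsum Y {..<(2::nat)} (\<lambda>i. if i = 0 then A else B) inc prj"
    using is_direct_sum_dsum by blast
  note D0 = dsumD(2-7)[OF d, where i=0, simplified] and D1 = dsumD(2-7)[OF d, where i=1, simplified]
  have "prj 1 \<cdot> inc 1 = ident C B" "prj 0 \<cdot> inc 0 = ident C A" using dsumD(8)[OF d] by force+
  note pi = this
  define F where "F = inc 1 \<cdot> (f \<cdot> prj 0)"
  have Fa: "arr F" "dm F = Y" "cd F = Y" using f D0 D1 by (simp_all add: F_def)
  have "F \<cdot> (h \<cdot> F) = zero_mor C Y Y" if h: "arr h" "dm h = Y" "cd h = Y" for h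
  proof -
    have z: "(prj 0 \<cdot> (h \<cdot> inc 1)) \<cdot> f = zero_mor C A A" using neg h f D0 D1 by simp
    have "F \<cdot> (h \<cdot> F) = (inc 1 \<cdot> f) \<cdot> (((prj 0 \<cdot> (h \<cdot> inc 1)) \<cdot> f) \<cdot> prj 0)"
      unfolding F_def using h f D0 D1 by (simp add: cmp_assoc)
    then show ?thesis unfolding z using f D0 D1 by simp
  qed
  then have "F = zero_mor C Y Y"
    using semisimple_ring_nilpotent[OF semisimple[of Y], of F] Fa by (simp add: End_ring_def mor_iff)
  then have "prj 1 \<cdot> (F \<cdot> inc 0) = zero_mor C A B" using D0 D1 by simp
  moreover have "prj 1 \<cdot> (F \<cdot> inc 0) = (prj 1 \<cdot> inc 1) \<cdot> (f \<cdot> (prj 0 \<cdot> inc 0))"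
    unfolding F_def using f D0 D1 by (simp add: cmp_assoc)
  ultimately show False using nz pi f by simp
qed

text \<open>Evaluating \<open>f \<cdot> g \<cdot> f\<close> in two ways shows that both composites
  are the same nonzero scalar, so a rescaled return map is a two-sided inverse.\<close>

lemma schur:
  assumes A: "simple_ob C A" and B: "simple_ob C B" and f: "arr f" "dm f = A" "cd f = B"
    and nz: "f \<noteq> zero_mor C A B"
  obtains g where "arr g" "dm g = B" "cd g = A" "g \<cdot> f = ident C A" "f \<cdot> g = ident C B"
proof -
  obtain g where g: "arr g" "dm g = B" "cd g = A" "g \<cdot> f \<noteq> zero_mor C A A"
    using nonzero_has_return[OF f nz] by blast
  obtain a where a: "g \<cdot> f = a \<odot> ident C A" using simple_scalar[OF A, of "g \<cdot> f"] f g by auto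
  have a0: "a \<noteq> 0" using a g(4) sc_zero[of "ident C A"] by auto
  obtain b where b: "f \<cdot> g = b \<odot> ident C B" using simple_scalar[OF B, of "f \<cdot> g"] f g by auto
  have "b \<odot> f = (f \<cdot> g) \<cdot> f" unfolding b using f by (simp add: cmp_sc)
  also have "\<dots> = a \<odot> f" using f g a by (simp add: cmp_assoc cmp_sc)
  finally have "b = a" using sc_cancel[of f b a] f nz by simp
  show ?thesis
    by (rule that[of "inverse a \<odot> g"]) (use f g a b a0 \<open>b = a\<close> in \<open>simp_all add: cmp_sc\<close>)
qed

lemma schur_zero:
  assumes "simple_ob C A" "simple_ob C B" "\<not> isomorphic C A B" "arr f" "dm f = A" "cd f = B"
  shows "f = zero_mor C A B"
  by (metis assms schur isomorphicI)

end

section \<open>Whiskering\<close>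

context strict_tensor_cat
begin

lemma tens_ob_simps [simp]:
  "(X \<otimes>\<^sub>o Y) \<otimes>\<^sub>o Z = X \<otimes>\<^sub>o (Y \<otimes>\<^sub>o Z)" "\<I> \<otimes>\<^sub>o X = X" "X \<otimes>\<^sub>o \<I> = X"
  by (rule tens_ob_assoc unit_left unit_right)+

lemma arr_tens [simp]:
  "arr f \<Longrightarrow> arr g \<Longrightarrow> arr (f \<otimes>\<^sub>m g)" "arr f \<Longrightarrow> arr g \<Longrightarrow> dm (f \<otimes>\<^sub>m g) = dm f \<otimes>\<^sub>o dm g"
  "arr f \<Longrightarrow> arr g \<Longrightarrow> cd (f \<otimes>\<^sub>m g) = cd f \<otimes>\<^sub>o cd g"
  using tens_mor[of f "dm f" "cd f" g "dm g" "cd g"] by (simp_all add: mor_iff)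

lemma tens_cmp: "\<lbrakk>arr f; arr g; arr f'; arr g'; dm g = cd f; dm g' = cd f'\<rbrakk>
    \<Longrightarrow> (g \<cdot> f) \<otimes>\<^sub>m (g' \<cdot> f') = (g \<otimes>\<^sub>m g') \<cdot> (f \<otimes>\<^sub>m f')"
  using tens_comp[of g "dm g" "cd g" f "dm f" g' "dm g'" "cd g'" f' "dm f'"] by (simp add: mor_iff)

lemma tens_assoc: "\<lbrakk>arr f; arr g; arr h\<rbrakk> \<Longrightarrow> (f \<otimes>\<^sub>m g) \<otimes>\<^sub>m h = f \<otimes>\<^sub>m (g \<otimes>\<^sub>m h)"
  using tens_mor_assoc[of f "dm f" "cd f" g "dm g" "cd g" h "dm h" "cd h"] by (simp add: mor_iff)

text \<open>Diagrams are composites of layers, each a single generator with identity strands on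
  either side. Layers acting on disjoint strands are exchanged by \<open>wh_swap\<close>.\<close>

definition wh where "wh A f B = ident C A \<otimes>\<^sub>m (f \<otimes>\<^sub>m ident C B)"

lemma wh_simps [simp]:
  "arr f \<Longrightarrow> arr (wh A f B)" "arr f \<Longrightarrow> dm (wh A f B) = A \<otimes>\<^sub>o (dm f \<otimes>\<^sub>o B)"
  "arr f \<Longrightarrow> cd (wh A f B) = A \<otimes>\<^sub>o (cd f \<otimes>\<^sub>o B)"
  "wh A (ident C Y) B = ident C (A \<otimes>\<^sub>o (Y \<otimes>\<^sub>o B))"
  "arr f \<Longrightarrow> wh \<I> f \<I> = f"
  by (auto simp: wh_def tens_ident mor_iff tens_ident_unit_left[of _ "dm _" "cd _"] 
     tens_ident_unit_right[of _ "dm _" "cd _"])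

lemma wh_wh [simp]: "arr f \<Longrightarrow> wh A (wh A' f B') B = wh (A \<otimes>\<^sub>o A') f (B' \<otimes>\<^sub>o B)"
  by (simp add: wh_def tens_assoc tens_ident[symmetric])

lemma wh_cmp: "\<lbrakk>arr f; arr g; dm g = cd f\<rbrakk> \<Longrightarrow> wh A (g \<cdot> f) B = wh A g B \<cdot> wh A f B"
  using tens_cmp[of f g "ident C B" "ident C B"] tens_cmp[of "ident C A" "ident C A" "f \<otimes>\<^sub>m ident C B" "g \<otimes>\<^sub>m ident C B"]
  by (simp add: wh_def)

lemma wh_pl: "\<lbrakk>arr f; arr g; dm f = dm g; cd f = cd g\<rbrakk> \<Longrightarrow> wh A (f \<boxplus> g) B = wh A f B \<boxplus> wh A g B"
  using tens_add_left[of f "dm f" "cd f" g "ident C B" B B]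
   tens_add_right[of "ident C A" A A "f \<otimes>\<^sub>m ident C B" "dm f \<otimes>\<^sub>o B" "cd f \<otimes>\<^sub>o B" "g \<otimes>\<^sub>m ident C B"]
  by (simp add: wh_def pl_def mor_iff)

lemma wh_sc: "arr f \<Longrightarrow> wh A (a \<odot> f) B = a \<odot> wh A f B"
  using tens_smult_left[of f "dm f" "cd f" "ident C B" B B a]
   tens_smult_right[of "ident C A" A A "f \<otimes>\<^sub>m ident C B" "dm f \<otimes>\<^sub>o B" "cd f \<otimes>\<^sub>o B" a]
  by (simp add: wh_def sc_def mor_iff)

lemma wh_zero [simp]: "wh A (zero_mor C X Y) B = zero_mor C (A \<otimes>\<^sub>o (X \<otimes>\<^sub>o B)) (A \<otimes>\<^sub>o (Y \<otimes>\<^sub>o B))"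
  using wh_sc[of "zero_mor C X Y" A 0 B] sc_zero[of "wh A (zero_mor C X Y) B"] by simp

lemma wh_swap:
  assumes "arr f" "arr g"
  shows "wh A f (M \<otimes>\<^sub>o (cd g \<otimes>\<^sub>o B)) \<cdot> wh (A \<otimes>\<^sub>o (dm f \<otimes>\<^sub>o M)) g B
       = wh (A \<otimes>\<^sub>o (cd f \<otimes>\<^sub>o M)) g B \<cdot> wh A f (M \<otimes>\<^sub>o (dm g \<otimes>\<^sub>o B))"
proof -
  have "(f \<otimes>\<^sub>m ident C (M \<otimes>\<^sub>o cd g)) \<cdot> (ident C (dm f \<otimes>\<^sub>o M) \<otimes>\<^sub>m g)
      = (ident C (cd f \<otimes>\<^sub>o M) \<otimes>\<^sub>m g) \<cdot> (f \<otimes>\<^sub>m ident C (M \<otimes>\<^sub>o dm g))" (is "?l = ?r")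
  proof -
    have i: "ident C (Y \<otimes>\<^sub>o M) \<otimes>\<^sub>m g = ident C Y \<otimes>\<^sub>m (ident C M \<otimes>\<^sub>m g)" for Y
      using assms by (simp add: tens_assoc tens_ident[symmetric])
    have 1: "?l = f \<otimes>\<^sub>m (ident C M \<otimes>\<^sub>m g)"
      using assms tens_cmp[of "ident C (dm f)" f "ident C M \<otimes>\<^sub>m g" "ident C (M \<otimes>\<^sub>o cd g)"] by (simp add: i)
    have 2: "?r = f \<otimes>\<^sub>m (ident C M \<otimes>\<^sub>m g)"
      using assms tens_cmp[of f "ident C (cd f)" "ident C (M \<otimes>\<^sub>o dm g)" "ident C M \<otimes>\<^sub>m g"] by (simp add: i)
    show ?thesis using 1 2 by simp
  qed
  then have "wh A ?l B = wh A ?r B" by simp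
  moreover have "wh A (f \<otimes>\<^sub>m ident C Y) B = wh A f (Y \<otimes>\<^sub>o B)" "wh A (ident C Y \<otimes>\<^sub>m g) B = wh (A \<otimes>\<^sub>o Y) g B" for Y
    using assms by (simp_all add: wh_def tens_assoc tens_ident[symmetric])
  ultimately show ?thesis using assms by (simp add: wh_cmp)
qed

lemma lf_wh: "lf (A \<otimes>\<^sub>o (X \<otimes>\<^sub>o B)) (A \<otimes>\<^sub>o (Y \<otimes>\<^sub>o B)) \<phi> \<Longrightarrow> lf X Y (\<lambda>h. \<phi> (wh A h B))"
  unfolding lf_def[of X Y] linfun_def
proof (intro conjI ballI allI)
  assume *: "lf (A \<otimes>\<^sub>o (X \<otimes>\<^sub>o B)) (A \<otimes>\<^sub>o (Y \<otimes>\<^sub>o B)) \<phi>"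
  fix h assume h: "h \<in> mor C X Y"
  show "\<phi> (wh A (a \<odot>\<^bsub>Hom C X Y\<^esub> h) B) = a * \<phi> (wh A h B)" for a
    using h * sc_mor[OF h, of a, symmetric] by (simp add: mor_iff wh_sc)
  fix k assume k: "k \<in> mor C X Y"
  show "\<phi> (wh A (h \<oplus>\<^bsub>Hom C X Y\<^esub> k) B) = \<phi> (wh A h B) + \<phi> (wh A k B)"
    using h k * pl_mor[OF h, of k, symmetric] by (simp add: mor_iff wh_pl)
qed

end

section \<open>Skein calculus\<close>

text \<open>\<open>t\<close> stands for the braiding scaled by \<gamma>. Sliding a strand across a
  cup uses two crossings and therefore costs the sign \<open>g\<close>, which is \<gamma>^2.
  \<open>x\<close> is the value of a closed loop. The coefficient \<open>\<kappa>\<close> is left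
  open here and is forced later by consistency of the relations.\<close>

locale skein = strict_tensor_cat C for C :: "('o, 'm) tensor_cat" (structure) +
  fixes X :: 'o and t ti cup cap :: 'm and r q g x \<kappa> :: complex
  assumes arr_t: "arr t" "dm t = X \<otimes>\<^sub>o X" "cd t = X \<otimes>\<^sub>o X"
    and arr_ti: "arr ti" "dm ti = X \<otimes>\<^sub>o X" "cd ti = X \<otimes>\<^sub>o X"
    and arr_cup: "arr cup" "dm cup = \<I>" "cd cup = X \<otimes>\<^sub>o X"
    and arr_cap: "arr cap" "dm cap = X \<otimes>\<^sub>o X" "cd cap = \<I>"
    and t_ti: "t \<cdot> ti = ident C (X \<otimes>\<^sub>o X)" "ti \<cdot> t = ident C (X \<otimes>\<^sub>o X)"
    and zigzag: "wh X cap \<I> \<cdot> wh \<I> cup X = ident C X" "wh \<I> cap X \<cdot> wh X cup \<I> = ident C X"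
    and t_cup: "t \<cdot> cup = inverse r \<odot> cup"
    and cap_t: "cap \<cdot> t = inverse r \<odot> cap"
    and cap_cup: "cap \<cdot> cup = x \<odot> ident C \<I>"
    and slide: "wh \<I> t X \<cdot> (wh X t \<I> \<cdot> wh \<I> cup X) = g \<odot> wh X cup \<I>"
      "wh X t \<I> \<cdot> (wh \<I> t X \<cdot> wh X cup \<I>) = g \<odot> wh \<I> cup X"
    and braid_rel: "wh \<I> t X \<cdot> (wh X t \<I> \<cdot> wh \<I> t X) = wh X t \<I> \<cdot> (wh \<I> t X \<cdot> wh X t \<I>)"
    and kauffman: "t = ti \<boxplus> (q - inverse q) \<odot> ident C (X \<otimes>\<^sub>o X) \<boxplus> \<kappa> \<odot> (cup \<cdot> cap)"
    and r_nz: "r \<noteq> 0" and q_nz: "q \<noteq> 0" and g2: "g * g = 1"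
begin

declare arr_t [simp] arr_ti [simp] arr_cup [simp] arr_cap [simp]

lemma ti_cup: "ti \<cdot> cup = r \<odot> cup"
proof -
  have "cup = (ti \<cdot> t) \<cdot> cup" by (simp add: t_ti)
  also have "\<dots> = inverse r \<odot> (ti \<cdot> cup)" by (simp add: cmp_assoc t_cup cmp_sc)
  finally have "r \<odot> cup = r \<odot> (inverse r \<odot> (ti \<cdot> cup))" by simp
  then show ?thesis using r_nz by simp
qed

lemma cap_ti: "cap \<cdot> ti = r \<odot> cap"
proof -
  have "cap = cap \<cdot> (t \<cdot> ti)" by (simp add: t_ti)
  also have "\<dots> = inverse r \<odot> (cap \<cdot> ti)" by (simp add: cmp_assoc[symmetric] cap_t cmp_sc)
  finally have "r \<odot> cap = r \<odot> (inverse r \<odot> (cap \<cdot> ti))" by simp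
  then show ?thesis using r_nz by simp
qed

lemma ti_eq: "ti = t \<boxplus> (- (q - inverse q)) \<odot> ident C (X \<otimes>\<^sub>o X) \<boxplus> (- \<kappa>) \<odot> (cup \<cdot> cap)"
proof (rule mor_eqI)
  fix \<phi> assume l: "lf (dm (t \<boxplus> (- (q - inverse q)) \<odot> ident C (X \<otimes>\<^sub>o X) \<boxplus> (- \<kappa>) \<odot> (cup \<cdot> cap)))
     (cd (t \<boxplus> (- (q - inverse q)) \<odot> ident C (X \<otimes>\<^sub>o X) \<boxplus> (- \<kappa>) \<odot> (cup \<cdot> cap))) \<phi>"
  then have l: "lf (X \<otimes>\<^sub>o X) (X \<otimes>\<^sub>o X) \<phi>" by simp
  have "\<phi> t = \<phi> (ti \<boxplus> (q - inverse q) \<odot> ident C (X \<otimes>\<^sub>o X) \<boxplus> \<kappa> \<odot> (cup \<cdot> cap))"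
    using kauffman by simp
  then have "\<phi> t = \<phi> ti + (q - inverse q) * \<phi> (ident C (X \<otimes>\<^sub>o X)) + \<kappa> * \<phi> (cup \<cdot> cap)" using l by simp
  then show "\<phi> ti = \<phi> (t \<boxplus> (- (q - inverse q)) \<odot> ident C (X \<otimes>\<^sub>o X) \<boxplus> (- \<kappa>) \<odot> (cup \<cdot> cap))"
    using l by (simp add: algebra_simps)
qed auto

lemma slide_ti: 
  "wh X t \<I> \<cdot> wh \<I> cup X = g \<odot> (wh \<I> ti X \<cdot> wh X cup \<I>)"
  "wh \<I> t X \<cdot> wh X cup \<I> = g \<odot> (wh X ti \<I> \<cdot> wh \<I> cup X)"
proof -
  have "wh \<I> ti X \<cdot> wh \<I> t X = ident C (X \<otimes>\<^sub>o (X \<otimes>\<^sub>o X))" "wh X ti \<I> \<cdot> wh X t \<I> = ident C (X \<otimes>\<^sub>o (X \<otimes>\<^sub>o X))"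
    by (simp_all add: wh_cmp[symmetric] t_ti del: wh_simps(5))
  note i = this
  have "wh X t \<I> \<cdot> wh \<I> cup X = (wh \<I> ti X \<cdot> wh \<I> t X) \<cdot> (wh X t \<I> \<cdot> wh \<I> cup X)" by (simp add: i)
  also have "\<dots> = g \<odot> (wh \<I> ti X \<cdot> wh X cup \<I>)" by (simp add: cmp_assoc slide cmp_sc)
  finally show "wh X t \<I> \<cdot> wh \<I> cup X = g \<odot> (wh \<I> ti X \<cdot> wh X cup \<I>)" .
  have "wh \<I> t X \<cdot> wh X cup \<I> = (wh X ti \<I> \<cdot> wh X t \<I>) \<cdot> (wh \<I> t X \<cdot> wh X cup \<I>)" by (simp add: i)
  also have "\<dots> = g \<odot> (wh X ti \<I> \<cdot> wh \<I> cup X)" by (simp add: cmp_assoc slide cmp_sc)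
  finally show "wh \<I> t X \<cdot> wh X cup \<I> = g \<odot> (wh X ti \<I> \<cdot> wh \<I> cup X)" .
qed

lemma whiskered:
  "wh (A \<otimes>\<^sub>o X) cap B \<cdot> wh A cup (X \<otimes>\<^sub>o B) = ident C (A \<otimes>\<^sub>o (X \<otimes>\<^sub>o B))"
  "wh A cap (X \<otimes>\<^sub>o B) \<cdot> wh (A \<otimes>\<^sub>o X) cup B = ident C (A \<otimes>\<^sub>o (X \<otimes>\<^sub>o B))"
  "wh A t B \<cdot> wh A cup B = inverse r \<odot> wh A cup B"
  "wh A ti B \<cdot> wh A cup B = r \<odot> wh A cup B"
  "wh A cap B \<cdot> wh A t B = inverse r \<odot> wh A cap B"
  "wh A cap B \<cdot> wh A ti B = r \<odot> wh A cap B"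
  "wh A cap B \<cdot> wh A cup B = x \<odot> ident C (A \<otimes>\<^sub>o B)"
  "wh (A \<otimes>\<^sub>o X) t B \<cdot> wh A cup (X \<otimes>\<^sub>o B) = g \<odot> (wh A ti (X \<otimes>\<^sub>o B) \<cdot> wh (A \<otimes>\<^sub>o X) cup B)"
  "wh A t (X \<otimes>\<^sub>o B) \<cdot> wh (A \<otimes>\<^sub>o X) cup B = g \<odot> (wh (A \<otimes>\<^sub>o X) ti B \<cdot> wh A cup (X \<otimes>\<^sub>o B))"
  "wh A t (X \<otimes>\<^sub>o B) \<cdot> (wh (A \<otimes>\<^sub>o X) t B \<cdot> wh A t (X \<otimes>\<^sub>o B))
    = wh (A \<otimes>\<^sub>o X) t B \<cdot> (wh A t (X \<otimes>\<^sub>o B) \<cdot> wh (A \<otimes>\<^sub>o X) t B)"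
  "wh A t B \<cdot> wh A ti B = ident C (A \<otimes>\<^sub>o (X \<otimes>\<^sub>o (X \<otimes>\<^sub>o B)))"
  "wh A ti B \<cdot> wh A t B = ident C (A \<otimes>\<^sub>o (X \<otimes>\<^sub>o (X \<otimes>\<^sub>o B)))"
  using arg_cong[OF zigzag(1), of "\<lambda>f. wh A f B"] arg_cong[OF zigzag(2), of "\<lambda>f. wh A f B"]
    arg_cong[OF t_cup, of "\<lambda>f. wh A f B"] arg_cong[OF ti_cup, of "\<lambda>f. wh A f B"]
    arg_cong[OF cap_t, of "\<lambda>f. wh A f B"] arg_cong[OF cap_ti, of "\<lambda>f. wh A f B"]
    arg_cong[OF cap_cup, of "\<lambda>f. wh A f B"]
    arg_cong[OF slide_ti(1), of "\<lambda>f. wh A f B"] arg_cong[OF slide_ti(2), of "\<lambda>f. wh A f B"]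
    arg_cong[OF braid_rel, of "\<lambda>f. wh A f B"]
    arg_cong[OF t_ti(1), of "\<lambda>f. wh A f B"] arg_cong[OF t_ti(2), of "\<lambda>f. wh A f B"]
  by (simp_all add: wh_cmp wh_sc del: wh_simps(5))

lemma t_square: "wh A t B \<cdot> wh A t B = ident C (A \<otimes>\<^sub>o (X \<otimes>\<^sub>o (X \<otimes>\<^sub>o B))) \<boxplus> (q - inverse q) \<odot> wh A t B
    \<boxplus> (\<kappa> * inverse r) \<odot> (wh A cup B \<cdot> wh A cap B)"
proof -
  have "t \<cdot> t = (ti \<boxplus> (q - inverse q) \<odot> ident C (X \<otimes>\<^sub>o X) \<boxplus> \<kappa> \<odot> (cup \<cdot> cap)) \<cdot> t"
    by (subst kauffman[symmetric]) simp
  also have "\<dots> = ident C (X \<otimes>\<^sub>o X) \<boxplus> (q - inverse q) \<odot> t \<boxplus> (\<kappa> * inverse r) \<odot> (cup \<cdot> cap)"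
    by (simp add: cmp_pl cmp_sc cmp_assoc t_ti cap_t)
  finally have "wh A (t \<cdot> t) B = wh A (ident C (X \<otimes>\<^sub>o X) \<boxplus> (q - inverse q) \<odot> t \<boxplus> (\<kappa> * inverse r) \<odot> (cup \<cdot> cap)) B"
    by simp
  then show ?thesis by (simp add: wh_cmp wh_pl wh_sc)
qed

text \<open>\<open>j\<close> and \<open>p\<close> exhibit \<open>A\<close> as a direct summand of \<open>A' \<otimes> X\<close>. Bending the last strand turns them
  into \<open>cu : A' \<rightarrow> A \<otimes> X\<close> and \<open>ca : A \<otimes> X \<rightarrow> A'\<close>.\<close>

definition step where
  "step A' A j p \<longleftrightarrow> arr j \<and> dm j = A \<and> cd j = A' \<otimes>\<^sub>o X \<and> arr p \<and> dm p = A' \<otimes>\<^sub>o X \<and> cd p = A \<and>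
     p \<cdot> j = ident C A"

definition cu where "cu A' p = wh \<I> p X \<cdot> wh A' cup \<I>"
definition ca where "ca A' j = wh A' cap \<I> \<cdot> wh \<I> j X"
text \<open>This is the crossing of the last two strands of
  \<open>A' \<otimes> X \<otimes> X\<close>, compressed to the summand \<open>A \<otimes> X\<close>.
  The map \<open>pt\<close> that follows is the partial trace over the last strand.\<close>

definition bm where "bm A' j p = wh \<I> p X \<cdot> (wh A' t \<I> \<cdot> wh \<I> j X)"
definition pt where "pt A f = wh A cap \<I> \<cdot> (wh \<I> f X \<cdot> wh A cup \<I>)"

lemma stepD: assumes "step A' A j p"
  shows "arr j" "dm j = A" "cd j = A' \<otimes>\<^sub>o X" "arr p" "dm p = A' \<otimes>\<^sub>o X" "cd p = A" "p \<cdot> j = ident C A"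
  using assms by (simp_all add: step_def)

lemma step_arr: assumes "step A' A j p"
  shows "arr (cu A' p)" "dm (cu A' p) = A'" "cd (cu A' p) = A \<otimes>\<^sub>o X"
    "arr (ca A' j)" "dm (ca A' j) = A \<otimes>\<^sub>o X" "cd (ca A' j) = A'"
    "arr (bm A' j p)" "dm (bm A' j p) = A \<otimes>\<^sub>o X" "cd (bm A' j p) = A \<otimes>\<^sub>o X"
  using stepD[OF assms] by (simp_all add: cu_def ca_def bm_def)

lemma cup_past:
  assumes "arr h" "dm h = P" "cd h = Q"
  shows "wh \<I> h (X \<otimes>\<^sub>o X) \<cdot> wh P cup \<I> = wh Q cup \<I> \<cdot> h" "wh Q cap \<I> \<cdot> wh \<I> h (X \<otimes>\<^sub>o X) = h \<cdot> wh P cap \<I>"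
    "wh \<I> h (X \<otimes>\<^sub>o X) \<cdot> wh P t \<I> = wh Q t \<I> \<cdot> wh \<I> h (X \<otimes>\<^sub>o X)"
    "wh \<I> h (X \<otimes>\<^sub>o X) \<cdot> wh P ti \<I> = wh Q ti \<I> \<cdot> wh \<I> h (X \<otimes>\<^sub>o X)"
  using wh_swap[of h cup \<I> \<I> \<I>] wh_swap[of h cap \<I> \<I> \<I>] wh_swap[of h t \<I> \<I> \<I>] wh_swap[of h ti \<I> \<I> \<I>] assms
  by simp_all

section \<open>Bent strands and partial traces\<close>

context
  fixes A' A j p assumes st: "step A' A j p"
begin

lemma wh_ca_cup: "wh \<I> (ca A' j) X \<cdot> wh A cup \<I> = j"
  using stepD[OF st] cup_past(1)[of j A "A' \<otimes>\<^sub>o X"] reassoc[OF whiskered(2)[of A' \<I>], of j]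
  by (simp add: ca_def wh_cmp cmp_assoc)

lemma cap_wh_cu: "wh A cap \<I> \<cdot> wh \<I> (cu A' p) X = p"
proof -
  have "wh A cap \<I> \<cdot> wh \<I> (cu A' p) X = (wh A cap \<I> \<cdot> wh \<I> p (X \<otimes>\<^sub>o X)) \<cdot> wh A' cup X"
    using stepD[OF st] by (simp add: cu_def wh_cmp cmp_assoc)
  also have "\<dots> = p"
    using stepD[OF st] cup_past(2)[of p "A' \<otimes>\<^sub>o X" A] whiskered(1)[of A' \<I>] by (simp add: cmp_assoc)
  finally show ?thesis .
qed

text \<open>Next to the cup the crossing can be rotated: the slide relation turns it into an inverse
  crossing of the two new strands, at the cost of \<open>g\<close>.\<close>

lemma wh_bm_cup:
  "wh \<I> (bm A' j p) X \<cdot> wh A cup \<I> = g \<odot> (wh A ti \<I> \<cdot> (wh \<I> (cu A' p) X \<cdot> j))"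
proof -
  have "wh \<I> (bm A' j p) X \<cdot> wh A cup \<I> = wh \<I> p (X \<otimes>\<^sub>o X) \<cdot> ((wh A' t X \<cdot> wh (A' \<otimes>\<^sub>o X) cup \<I>) \<cdot> j)"
    using stepD[OF st] cup_past(1)[of j A "A' \<otimes>\<^sub>o X"] by (simp add: bm_def wh_cmp cmp_assoc)
  also have "\<dots> = g \<odot> ((wh \<I> p (X \<otimes>\<^sub>o X) \<cdot> wh (A' \<otimes>\<^sub>o X) ti \<I>) \<cdot> (wh A' cup X \<cdot> j))"
    using stepD[OF st] whiskered(9)[of A' \<I>] by (simp add: cmp_assoc cmp_sc)
  also have "\<dots> = g \<odot> (wh A ti \<I> \<cdot> (wh \<I> (cu A' p) X \<cdot> j))"
    using stepD[OF st] cup_past(4)[of p "A' \<otimes>\<^sub>o X" A] by (simp add: cmp_assoc cu_def wh_cmp)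
  finally show ?thesis .
qed

text \<open>The converse rotation: a crossing of the two new strands is carried back through the
  bend and becomes an inverse crossing inside \<open>A' \<otimes> X \<otimes> X\<close>.\<close>

lemma t_bent:
  "wh A t \<I> \<cdot> (wh \<I> (cu A' p) X \<cdot> j)
    = g \<odot> (wh \<I> (wh \<I> p X \<cdot> (wh A' ti \<I> \<cdot> wh \<I> j X)) X \<cdot> wh A cup \<I>)"
proof -
  have "wh A t \<I> \<cdot> (wh \<I> (cu A' p) X \<cdot> j) = (wh A t \<I> \<cdot> wh \<I> p (X \<otimes>\<^sub>o X)) \<cdot> (wh A' cup X \<cdot> j)"
    using stepD[OF st] by (simp add: cu_def wh_cmp cmp_assoc)
  also have "\<dots> = wh \<I> p (X \<otimes>\<^sub>o X) \<cdot> ((wh (A' \<otimes>\<^sub>o X) t \<I> \<cdot> wh A' cup X) \<cdot> j)"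
    using stepD[OF st] cup_past(3)[of p "A' \<otimes>\<^sub>o X" A, symmetric] by (simp add: cmp_assoc)
  also have "\<dots> = g \<odot> (wh \<I> p (X \<otimes>\<^sub>o X) \<cdot> (wh A' ti X \<cdot> (wh (A' \<otimes>\<^sub>o X) cup \<I> \<cdot> j)))"
    using stepD[OF st] whiskered(8)[of A' \<I>] by (simp add: cmp_assoc cmp_sc)
  also have "\<dots> = g \<odot> (wh \<I> (wh \<I> p X \<cdot> (wh A' ti \<I> \<cdot> wh \<I> j X)) X \<cdot> wh A cup \<I>)"
    using stepD[OF st] cup_past(1)[of j A "A' \<otimes>\<^sub>o X"] by (simp add: wh_cmp cmp_assoc)
  finally show ?thesis .
qed

text \<open>After the rotation of \<open>wh_bm_cup\<close> the closed diagram contains an inverse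
  crossing against a cap, a curl worth \<open>r\<close>. What remains is a straightened
  strand.\<close>

lemma pt_bm: "pt A (bm A' j p) = (g * r) \<odot> ident C A"
proof -
  have "pt A (bm A' j p) = g \<odot> ((wh A cap \<I> \<cdot> wh A ti \<I>) \<cdot> (wh \<I> (cu A' p) X \<cdot> j))"
    unfolding pt_def wh_bm_cup using stepD[OF st] step_arr[OF st] by (simp add: cmp_assoc cmp_sc)
  also have "\<dots> = (g * r) \<odot> ((wh A cap \<I> \<cdot> wh \<I> (cu A' p) X) \<cdot> j)"
    using stepD[OF st] step_arr[OF st] whiskered(6)[of A \<I>] by (simp add: cmp_assoc cmp_sc)
  finally show ?thesis unfolding cap_wh_cu using stepD[OF st] by simp
qed

lemma pt_ident: "pt A (ident C (A \<otimes>\<^sub>o X)) = x \<odot> ident C A"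
  unfolding pt_def using whiskered(7)[of A \<I>] by simp

lemma pt_cu_ca: "pt A (cu A' p \<cdot> ca A' j) = ident C A"
proof -
  have "pt A (cu A' p \<cdot> ca A' j) = (wh A cap \<I> \<cdot> wh \<I> (cu A' p) X) \<cdot> (wh \<I> (ca A' j) X \<cdot> wh A cup \<I>)"
    unfolding pt_def using stepD[OF st] step_arr[OF st] by (simp add: wh_cmp cmp_assoc)
  then show ?thesis unfolding cap_wh_cu wh_ca_cup using stepD[OF st] by simp
qed

text \<open>This makes the scalar of \<open>ca \<cdot> cu\<close> a ratio of dimensions: it is the
  partial trace of the idempotent \<open>j \<cdot> p\<close> that cuts \<open>A\<close> out of
  \<open>A' \<otimes> X\<close>.\<close>

lemma pt_summand: "pt A' (j \<cdot> p) = ca A' j \<cdot> cu A' p"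
  unfolding pt_def ca_def cu_def using stepD[OF st] by (simp add: wh_cmp cmp_assoc)

lemma cu_nz: assumes "ident C A \<noteq> zero_mor C A A" shows "cu A' p \<noteq> zero_mor C A' (A \<otimes>\<^sub>o X)"
proof
  assume "cu A' p = zero_mor C A' (A \<otimes>\<^sub>o X)"
  then have "p = zero_mor C (A' \<otimes>\<^sub>o X) A" using cap_wh_cu by simp
  then show False using stepD[OF st] assms by simp
qed

lemma ca_nz: assumes "ident C A \<noteq> zero_mor C A A" shows "ca A' j \<noteq> zero_mor C (A \<otimes>\<^sub>o X) A'"
proof
  assume "ca A' j = zero_mor C (A \<otimes>\<^sub>o X) A'"
  then have "j = zero_mor C A (A' \<otimes>\<^sub>o X)" using wh_ca_cup by simp
  then show False using stepD[OF st] assms by simp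
qed

end

end

context linear_cat
begin

lemma ident_scalar_eq:
  assumes "ident C A \<noteq> zero_mor C A A" "\<And>\<phi>. lf A A \<phi> \<Longrightarrow> a * \<phi> (ident C A) = b * \<phi> (ident C A)"
  shows "a = b"
proof -
  have "a \<odot> ident C A = b \<odot> ident C A" by (rule mor_eqI) (use assms(2) in auto)
  then show ?thesis using sc_cancel[of "ident C A"] assms(1) by simp
qed

end

section \<open>The algebra acting on \<open>A \<otimes> X\<close> and its spectral data\<close>

context skein
begin

abbreviation "z \<equiv> q - inverse q"

lemma lf_pt: "lf A A \<phi> \<Longrightarrow> lf (A \<otimes>\<^sub>o X) (A \<otimes>\<^sub>o X) (\<lambda>f. \<phi> (pt A f))"
proof -
  assume l: "lf A A \<phi>"
  have "lf (A \<otimes>\<^sub>o (X \<otimes>\<^sub>o X)) A (\<lambda>h. \<phi> (h \<cdot> wh A cup \<I>))" if "lf A A \<phi>" for \<phi>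
    using lf_precomp[OF that, of "wh A cup \<I>"] by simp
  have 1: "lf A (A \<otimes>\<^sub>o (X \<otimes>\<^sub>o X)) (\<lambda>h. \<phi> (wh A cap \<I> \<cdot> h))"
    using lf_postcomp[OF l, of "wh A cap \<I>"] by simp
  have "lf (A \<otimes>\<^sub>o (X \<otimes>\<^sub>o X)) (A \<otimes>\<^sub>o (X \<otimes>\<^sub>o X)) (\<lambda>h. \<phi> (wh A cap \<I> \<cdot> (h \<cdot> wh A cup \<I>)))"
    using lf_precomp[OF 1, of "wh A cup \<I>"] by simp
  then show ?thesis using lf_wh[of \<I> "A \<otimes>\<^sub>o X" X "A \<otimes>\<^sub>o X" "\<lambda>h. \<phi> (wh A cap \<I> \<cdot> (h \<cdot> wh A cup \<I>))"]
    by (simp add: pt_def)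
qed

text \<open>The summands \<open>M i\<close> together with \<open>A'\<close> make up \<open>A \<otimes> X\<close>; the strand map \<open>bm\<close> acts on
  them by \<open>a i\<close> and \<open>b\<close>.\<close>

definition node where
  "node A' A j p I M inc pro a b \<delta> \<longleftrightarrow> step A' A j p \<and> finite I \<and> \<delta> \<noteq> 0 \<and>
     ca A' j \<cdot> cu A' p = \<delta> \<odot> ident C A' \<and>
     bm A' j p \<cdot> cu A' p = b \<odot> cu A' p \<and>
     (\<forall>i\<in>I. step A (M i) (inc i) (pro i) \<and> ca A' j \<cdot> inc i = zero_mor C (M i) A' \<and>
        pro i \<cdot> cu A' p = zero_mor C A' (M i) \<and> bm A' j p \<cdot> inc i = a i \<odot> inc i \<and>
        (\<forall>k\<in>I. i \<noteq> k \<longrightarrow> pro i \<cdot> inc k = zero_mor C (M k) (M i))) \<and>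
     (\<forall>\<phi>. lf (A \<otimes>\<^sub>o X) (A \<otimes>\<^sub>o X) \<phi> \<longrightarrow> \<phi> (ident C (A \<otimes>\<^sub>o X)) =
         inverse \<delta> * \<phi> (cu A' p \<cdot> ca A' j) + (\<Sum>i\<in>I. \<phi> (inc i \<cdot> pro i)))"

lemma nodeD:
  assumes "node A' A j p I M inc pro a b \<delta>"
  shows "step A' A j p" "finite I" "\<delta> \<noteq> 0" "ca A' j \<cdot> cu A' p = \<delta> \<odot> ident C A'"
    "bm A' j p \<cdot> cu A' p = b \<odot> cu A' p"
    "i \<in> I \<Longrightarrow> step A (M i) (inc i) (pro i)"
    "i \<in> I \<Longrightarrow> ca A' j \<cdot> inc i = zero_mor C (M i) A'"
    "i \<in> I \<Longrightarrow> pro i \<cdot> cu A' p = zero_mor C A' (M i)"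
    "i \<in> I \<Longrightarrow> bm A' j p \<cdot> inc i = a i \<odot> inc i"
    "i \<in> I \<Longrightarrow> k \<in> I \<Longrightarrow> i \<noteq> k \<Longrightarrow> pro i \<cdot> inc k = zero_mor C (M k) (M i)"
    "lf (A \<otimes>\<^sub>o X) (A \<otimes>\<^sub>o X) \<phi> \<Longrightarrow> \<phi> (ident C (A \<otimes>\<^sub>o X)) =
         inverse \<delta> * \<phi> (cu A' p \<cdot> ca A' j) + (\<Sum>i\<in>I. \<phi> (inc i \<cdot> pro i))"
  using assms unfolding node_def by blast+

context
  fixes A' A j p I M inc pro a b \<delta> assumes nd: "node A' A j p I M inc pro a b \<delta>"
begin

lemma node_bm:
  assumes l: "lf (A \<otimes>\<^sub>o X) (A \<otimes>\<^sub>o X) \<phi>"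
  shows "\<phi> (bm A' j p) = b * inverse \<delta> * \<phi> (cu A' p \<cdot> ca A' j) + (\<Sum>i\<in>I. a i * \<phi> (inc i \<cdot> pro i))"
proof -
  note N = nodeD[OF nd] and S = stepD[OF nodeD(1)[OF nd]] step_arr[OF nodeD(1)[OF nd]]
  have l': "lf (A \<otimes>\<^sub>o X) (A \<otimes>\<^sub>o X) (\<lambda>h. \<phi> (bm A' j p \<cdot> h))"
    using lf_postcomp[OF l, of "bm A' j p"] S by simp
  have "\<phi> (bm A' j p \<cdot> (inc i \<cdot> pro i)) = a i * \<phi> (inc i \<cdot> pro i)" if "i \<in> I" for i
    using stepD[OF N(6)[OF that]] S N(9)[OF that] l by (simp add: cmp_assoc[symmetric] cmp_sc)
  moreover have "\<phi> (bm A' j p \<cdot> (cu A' p \<cdot> ca A' j)) = b * \<phi> (cu A' p \<cdot> ca A' j)"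
    using S N(5) l by (simp add: cmp_assoc[symmetric] cmp_sc)
  ultimately show ?thesis using N(11)[OF l'] S by simp
qed

text \<open>Partial traces of the decompositions of the identity and of \<open>bm\<close>. The
  summand \<open>A'\<close> enters through the idempotent
  \<open>inverse \<delta> \<odot> (cu \<cdot> ca)\<close>, whose trace is the reciprocal ratio
  \<open>inverse \<delta>\<close>.\<close>

lemma node_trace:
  assumes nz: "ident C A \<noteq> zero_mor C A A"
    and d: "\<And>i. i \<in> I \<Longrightarrow> ca A (inc i) \<cdot> cu A (pro i) = d i \<odot> ident C A"
  shows "x = inverse \<delta> + (\<Sum>i\<in>I. d i)" "g * r = b * inverse \<delta> + (\<Sum>i\<in>I. a i * d i)"
proof -
  note N = nodeD[OF nd]
  have e: "\<phi> (pt A (inc i \<cdot> pro i)) = d i * \<phi> (ident C A)" if "i \<in> I" "lf A A \<phi>" for i \<phi>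
    using pt_summand[OF N(6)[OF that(1)]] d that by simp
  show "x = inverse \<delta> + (\<Sum>i\<in>I. d i)"
  proof (rule ident_scalar_eq[OF nz])
    fix \<phi> assume l: "lf A A \<phi>"
    show "x * \<phi> (ident C A) = (inverse \<delta> + sum d I) * \<phi> (ident C A)"
      using N(11)[OF lf_pt[OF l]] e l
      by (simp add: pt_ident[OF N(1)] pt_cu_ca[OF N(1)] distrib_right sum_distrib_right)
  qed
  show "g * r = b * inverse \<delta> + (\<Sum>i\<in>I. a i * d i)"
  proof (rule ident_scalar_eq[OF nz])
    fix \<phi> assume l: "lf A A \<phi>"
    show "g * r * \<phi> (ident C A) = (b * inverse \<delta> + (\<Sum>i\<in>I. a i * d i)) * \<phi> (ident C A)"
      using node_bm[OF lf_pt[OF l]] e l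
      by (simp add: pt_bm[OF N(1)] pt_cu_ca[OF N(1)] distrib_right sum_distrib_right mult.assoc)
  qed
qed

text \<open>The identity, \<open>bm\<close> and the cup-cap are simultaneously diagonal, so a
  combination vanishing on every summand except \<open>k\<close> is a multiple of the idempotent
  onto \<open>k\<close>. The factor \<open>\<nu>\<close> stays in place because it will be a
  q-integer that is not yet known to be invertible.\<close>

lemma node_expand:
  assumes k: "k \<in> I" and "\<alpha> + \<beta> * a k = \<nu>" and "\<And>i. i \<in> I \<Longrightarrow> i \<noteq> k \<Longrightarrow> \<alpha> + \<beta> * a i = 0"
    and "\<alpha> + \<beta> * b + \<gamma> * \<delta> = 0"
  shows "\<nu> \<odot> (inc k \<cdot> pro k) = \<alpha> \<odot> ident C (A \<otimes>\<^sub>o X) \<boxplus> \<beta> \<odot> bm A' j p \<boxplus> \<gamma> \<odot> (cu A' p \<cdot> ca A' j)" (is "_ = ?R")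
proof (rule mor_eqI)
  note N = nodeD[OF nd] and S = stepD[OF nodeD(1)[OF nd]] step_arr[OF nodeD(1)[OF nd]]
  note K = stepD[OF N(6)[OF k]]
  fix \<phi> assume "lf (dm ?R) (cd ?R) \<phi>"
  then have l: "lf (A \<otimes>\<^sub>o X) (A \<otimes>\<^sub>o X) \<phi>" using S by simp
  define w where "w = \<phi> (cu A' p \<cdot> ca A' j)"
  have "\<alpha> * (\<Sum>i\<in>I. \<phi> (inc i \<cdot> pro i)) + \<beta> * (\<Sum>i\<in>I. a i * \<phi> (inc i \<cdot> pro i)) 
      = (\<Sum>i\<in>I. (\<alpha> + \<beta> * a i) * \<phi> (inc i \<cdot> pro i))"
    by (simp add: sum_distrib_left sum.distrib distrib_right mult.assoc)
  also have "\<dots> = (\<Sum>i\<in>I. if i = k then \<nu> * \<phi> (inc k \<cdot> pro k) else 0)"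
    by (rule sum.cong) (use assms in auto)
  also have "\<dots> = \<nu> * \<phi> (inc k \<cdot> pro k)" using k N(2) by simp
  finally have 1: "\<alpha> * (\<Sum>i\<in>I. \<phi> (inc i \<cdot> pro i)) + \<beta> * (\<Sum>i\<in>I. a i * \<phi> (inc i \<cdot> pro i)) 
      = \<nu> * \<phi> (inc k \<cdot> pro k)" .
  have "\<phi> ?R = \<alpha> * \<phi> (ident C (A \<otimes>\<^sub>o X)) + \<beta> * \<phi> (bm A' j p) + \<gamma> * w"
    using l S by (simp add: w_def)
  also have "\<dots> = (\<alpha> + \<beta> * b + \<gamma> * \<delta>) * inverse \<delta> * w + \<nu> * \<phi> (inc k \<cdot> pro k)"
    unfolding N(11)[OF l] node_bm[OF l] 1[symmetric] w_def[symmetric] using N(3)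
    by (simp add: algebra_simps)
  also have "\<dots> = \<phi> (\<nu> \<odot> (inc k \<cdot> pro k))" using assms(4) l K by simp
  finally show "\<phi> (\<nu> \<odot> (inc k \<cdot> pro k)) = \<phi> ?R" by simp
qed (use stepD[OF nodeD(6)[OF nd k]] stepD[OF nodeD(1)[OF nd]] step_arr[OF nodeD(1)[OF nd]] in auto)

text \<open>If \<open>bm\<close> is a scalar \<open>\<theta>\<close> away from \<open>A'\<close>, bending it exhibits the braiding on the span of
  \<open>w0\<close> and \<open>w3\<close>, and its quadratic relation pins down the parameters.\<close>

lemma node_rigid:
  assumes a: "\<And>i. i \<in> I \<Longrightarrow> a i = \<theta>" and k: "k \<in> I"
    and nz: "ident C A \<noteq> zero_mor C A A" "ident C (M k) \<noteq> zero_mor C (M k) (M k)"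
    and \<kappa>: "\<kappa> = - (g * z)" and \<theta>: "\<theta> * (\<theta> - z) = 1"
  shows "\<exists>y. y * (y + z) = 1 \<and> g * x * (\<theta> - z) + (y + z) = inverse r"
proof -
  note N = nodeD[OF nd] and S = stepD[OF nodeD(1)[OF nd]] step_arr[OF nodeD(1)[OF nd]]
  note st = nodeD(1)[OF nd]
  note K = stepD[OF N(6)[OF k]] and KA = step_arr[OF N(6)[OF k]]
  \<comment> \<open>Chosen so that \<open>\<theta>\<close> plus \<open>\<xi>\<close> times the
    cup-cap takes the value \<open>b\<close> on \<open>A'\<close>, where the cup-cap acts by
    \<open>\<delta>\<close>.\<close>
  define \<xi> where "\<xi> = (b - \<theta>) * inverse \<delta>"
  define y where "y = g * \<xi>"
  define w0 where "w0 = wh A cup \<I>"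
  define w3 where "w3 = wh \<I> (cu A' p) X \<cdot> j"
  define T where "T = wh A t \<I>"
  have W: "arr w0" "dm w0 = A" "cd w0 = A \<otimes>\<^sub>o (X \<otimes>\<^sub>o X)" "arr w3" "dm w3 = A" "cd w3 = A \<otimes>\<^sub>o (X \<otimes>\<^sub>o X)"
    "arr T" "dm T = A \<otimes>\<^sub>o (X \<otimes>\<^sub>o X)" "cd T = A \<otimes>\<^sub>o (X \<otimes>\<^sub>o X)"
    using S by (simp_all add: w0_def w3_def T_def)
  have bm: "bm A' j p = \<theta> \<odot> ident C (A \<otimes>\<^sub>o X) \<boxplus> \<xi> \<odot> (cu A' p \<cdot> ca A' j)" (is "_ = ?R")
  proof (rule mor_eqI)
    fix \<phi> assume "lf (dm ?R) (cd ?R) \<phi>"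
    then have l: "lf (A \<otimes>\<^sub>o X) (A \<otimes>\<^sub>o X) \<phi>" using S by simp
    have "(\<Sum>i\<in>I. a i * \<phi> (inc i \<cdot> pro i)) = \<theta> * (\<Sum>i\<in>I. \<phi> (inc i \<cdot> pro i))"
      unfolding sum_distrib_left by (rule sum.cong) (use a in auto)
    then show "\<phi> (bm A' j p) = \<phi> ?R"
      unfolding node_bm[OF l] using l S N(11)[OF l] by (simp add: \<xi>_def algebra_simps)
  qed (use S in auto)
  have "wh \<I> (bm A' j p) X \<cdot> w0 = \<theta> \<odot> w0 \<boxplus> \<xi> \<odot> w3"
    unfolding bm w0_def w3_def using S wh_ca_cup[OF st]
    by (simp add: wh_pl wh_sc wh_cmp cmp_pl cmp_sc cmp_assoc)
  then have E: "g \<odot> (wh A ti \<I> \<cdot> w3) = \<theta> \<odot> w0 \<boxplus> \<xi> \<odot> w3"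
    unfolding w0_def w3_def wh_bm_cup[OF st] .
  have E': "wh A ti \<I> \<cdot> w3 = (g * \<theta>) \<odot> w0 \<boxplus> y \<odot> w3"
  proof -
    have "wh A ti \<I> \<cdot> w3 = g \<odot> (g \<odot> (wh A ti \<I> \<cdot> w3))" using W g2 by simp
    also have "\<dots> = (g * \<theta>) \<odot> w0 \<boxplus> y \<odot> w3" 
      unfolding E by (rule mor_eqI) (use W in \<open>auto simp: y_def algebra_simps\<close>)
    finally show ?thesis .
  qed
  have capw: "wh A cap \<I> \<cdot> w3 = ident C A" "wh A cap \<I> \<cdot> w0 = x \<odot> ident C A"
    unfolding w3_def w0_def using S cap_wh_cu[OF st] whiskered(7)[of A \<I>] by (simp_all add: cmp_assoc[symmetric])
  have "wh A t \<I> = wh A ti \<I> \<boxplus> z \<odot> ident C (A \<otimes>\<^sub>o (X \<otimes>\<^sub>o X)) \<boxplus> \<kappa> \<odot> (wh A cup \<I> \<cdot> wh A cap \<I>)"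
    by (subst kauffman) (simp add: wh_pl wh_sc wh_cmp)
  then have "T \<cdot> w3 = (wh A ti \<I> \<cdot> w3) \<boxplus> z \<odot> w3 \<boxplus> \<kappa> \<odot> w0"
    unfolding T_def using W capw by (simp add: cmp_pl cmp_sc cmp_assoc w0_def)
  then have T3: "T \<cdot> w3 = (g * (\<theta> - z)) \<odot> w0 \<boxplus> (y + z) \<odot> w3"
    unfolding E' \<kappa> using W by (intro mor_eqI) (auto simp: algebra_simps)
  have T0: "T \<cdot> w0 = inverse r \<odot> w0" unfolding T_def w0_def using whiskered(3)[of A \<I>] .
  have "w3 = T \<cdot> (wh A ti \<I> \<cdot> w3)"
    using W whiskered(11)[of A \<I>] by (simp add: T_def cmp_assoc[symmetric])
  then have F: "w3 = (g * \<theta> * inverse r + y * (g * (\<theta> - z))) \<odot> w0 \<boxplus> (y * (y + z)) \<odot> w3"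
  proof -
    have "T \<cdot> (wh A ti \<I> \<cdot> w3) = (g * \<theta> * inverse r + y * (g * (\<theta> - z))) \<odot> w0 \<boxplus> (y * (y + z)) \<odot> w3" (is "_ = ?R")
      unfolding E' by (rule mor_eqI) (use W T0 T3 in \<open>auto simp: cmp_pl cmp_sc algebra_simps\<close>)
    with \<open>w3 = T \<cdot> (wh A ti \<I> \<cdot> w3)\<close> show ?thesis by (rule trans)
  qed
  \<comment> \<open>Projecting to \<open>M k\<close> kills \<open>w3\<close> but sends
    \<open>w0\<close> to the nonzero \<open>cu\<close>, so the coefficient of \<open>w0\<close> in
    \<open>F\<close> has to vanish.\<close>
  define \<psi> where "\<psi> = wh \<I> (pro k) X"
  have P: "arr \<psi>" "dm \<psi> = A \<otimes>\<^sub>o (X \<otimes>\<^sub>o X)" "cd \<psi> = M k \<otimes>\<^sub>o X" using K by (simp_all add: \<psi>_def)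
  have p3: "\<psi> \<cdot> w3 = zero_mor C A (M k \<otimes>\<^sub>o X)"
  proof -
    have "\<psi> \<cdot> w3 = wh \<I> (pro k \<cdot> cu A' p) X \<cdot> j" 
      unfolding \<psi>_def w3_def using K S by (simp add: wh_cmp cmp_assoc)
    then show ?thesis using N(8)[OF k] S by simp
  qed
  have p0: "\<psi> \<cdot> w0 = cu A (pro k)" by (simp add: \<psi>_def w0_def cu_def)
  have "\<psi> \<cdot> w3 = (g * \<theta> * inverse r + y * (g * (\<theta> - z))) \<odot> cu A (pro k) \<boxplus> (y * (y + z)) \<odot> (\<psi> \<cdot> w3)"
    by (subst F) (use W P p0 in \<open>simp add: cmp_pl cmp_sc\<close>)
  then have "(g * \<theta> * inverse r + y * (g * (\<theta> - z))) \<odot> cu A (pro k) = zero_mor C A (M k \<otimes>\<^sub>o X)"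
    unfolding p3 using KA by simp
  then have c0: "g * \<theta> * inverse r + y * (g * (\<theta> - z)) = 0"
    using sc_eq_zero[of "cu A (pro k)"] KA cu_nz[OF N(6)[OF k] nz(2)] by simp
  have "ident C A = (y * (y + z)) \<odot> ident C A"
  proof -
    have "wh A cap \<I> \<cdot> w3 = wh A cap \<I> \<cdot> (0 \<odot> w0 \<boxplus> (y * (y + z)) \<odot> w3)" by (subst F) (simp add: c0)
    then show ?thesis using W capw by (simp add: cmp_pl cmp_sc sc_zero)
  qed
  then have 1: "y * (y + z) = 1" using sc_cancel[of "ident C A" "y * (y + z)" 1] nz(1) by simp
  have "wh A cap \<I> \<cdot> (T \<cdot> w3) = inverse r \<odot> ident C A"
    using W capw whiskered(5)[of A \<I>] by (simp add: T_def cmp_assoc[symmetric] cmp_sc)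
  moreover have "wh A cap \<I> \<cdot> (T \<cdot> w3) = (g * x * (\<theta> - z) + (y + z)) \<odot> ident C A"
    unfolding T3 using W capw by (intro mor_eqI) (auto simp: cmp_pl cmp_sc algebra_simps)
  ultimately have "g * x * (\<theta> - z) + (y + z) = inverse r" using sc_cancel[of "ident C A"] nz(1) by simp
  then show ?thesis using 1 by blast
qed

end

section \<open>Transfer of eigenvalues from one step to the next\<close>

lemma step_wh: "step A' A j p \<Longrightarrow> wh \<I> p B \<cdot> wh \<I> j B = ident C (A \<otimes>\<^sub>o B)"
  using stepD[of A' A j p] wh_cmp[of j p \<I> B] by simp

text \<open>Insert the expansion of the idempotent. The identity term gives a curl, hence
  \<open>inverse r\<close>. In the \<open>\<beta>\<close> term the rotated \<open>bm\<close>
  produces an inverse crossing that cancels the crossing, leaving \<open>p \<cdot> cu\<close>, which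
  is zero. The cup-cap term is rotated by \<open>t_bent\<close> into an inverse crossing on two
  consecutive projections, where it acts by \<open>inverse \<theta>\<close>.\<close>

lemma bm_cu_next:
  assumes s': "step A'' A' j' p'" and s: "step A' A j p"
    and ex: "\<nu> \<odot> (j \<cdot> p) = \<alpha> \<odot> ident C (A' \<otimes>\<^sub>o X) \<boxplus> \<beta> \<odot> bm A'' j' p' \<boxplus> \<gamma> \<odot> (cu A'' p' \<cdot> ca A'' j')"
    and z: "p \<cdot> cu A'' p' = zero_mor C A'' A"
    and anti: "(p \<cdot> wh \<I> p' X) \<cdot> wh A'' t \<I> = \<theta> \<odot> (p \<cdot> wh \<I> p' X)" and \<theta>: "\<theta> \<noteq> 0"
  shows "\<nu> \<odot> (bm A' j p \<cdot> cu A' p) = (\<alpha> * inverse r + \<gamma> * g * inverse \<theta>) \<odot> cu A' p"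
proof -
  note S = stepD[OF s] step_arr[OF s] and S' = stepD[OF s'] step_arr[OF s']
  define w where "w = wh \<I> p X \<cdot> wh A' t \<I>"
  have W: "arr w" "dm w = A' \<otimes>\<^sub>o (X \<otimes>\<^sub>o X)" "cd w = A \<otimes>\<^sub>o X" using S by (simp_all add: w_def)
  have "\<nu> \<odot> (bm A' j p \<cdot> cu A' p) = w \<cdot> (wh \<I> (\<nu> \<odot> (j \<cdot> p)) X \<cdot> wh A' cup \<I>)"
    unfolding bm_def cu_def w_def using S by (simp add: wh_sc wh_cmp cmp_sc cmp_assoc)
  also have "\<dots> = \<alpha> \<odot> (w \<cdot> wh A' cup \<I>) \<boxplus> \<beta> \<odot> (w \<cdot> (wh \<I> (bm A'' j' p') X \<cdot> wh A' cup \<I>))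
      \<boxplus> \<gamma> \<odot> (w \<cdot> (wh \<I> (cu A'' p') X \<cdot> (wh \<I> (ca A'' j') X \<cdot> wh A' cup \<I>)))"
    unfolding ex using S S' W by (simp add: wh_pl wh_sc wh_cmp cmp_pl cmp_sc cmp_assoc)
  also have "w \<cdot> wh A' cup \<I> = inverse r \<odot> cu A' p"
    unfolding w_def cu_def using S whiskered(3)[of A' \<I>] by (simp add: cmp_assoc cmp_sc)
  also have "w \<cdot> (wh \<I> (bm A'' j' p') X \<cdot> wh A' cup \<I>) = zero_mor C A' (A \<otimes>\<^sub>o X)"
  proof -
    have "w \<cdot> (wh \<I> (bm A'' j' p') X \<cdot> wh A' cup \<I>)
        = g \<odot> (wh \<I> p X \<cdot> ((wh A' t \<I> \<cdot> wh A' ti \<I>) \<cdot> (wh \<I> (cu A'' p') X \<cdot> j')))"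
      unfolding wh_bm_cup[OF s'] w_def using S S' by (simp add: cmp_assoc cmp_sc)
    also have "\<dots> = g \<odot> (wh \<I> (p \<cdot> cu A'' p') X \<cdot> j')"
      using S S' whiskered(11)[of A' \<I>] by (simp add: cmp_assoc wh_cmp)
    finally show ?thesis using z S' by simp
  qed
  also have "w \<cdot> (wh \<I> (cu A'' p') X \<cdot> (wh \<I> (ca A'' j') X \<cdot> wh A' cup \<I>)) = (g * inverse \<theta>) \<odot> cu A' p"
  proof -
    have ti: "(p \<cdot> wh \<I> p' X) \<cdot> wh A'' ti \<I> = inverse \<theta> \<odot> (p \<cdot> wh \<I> p' X)"
    proof -
      have "p \<cdot> wh \<I> p' X = ((p \<cdot> wh \<I> p' X) \<cdot> wh A'' t \<I>) \<cdot> wh A'' ti \<I>"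
        using S S' whiskered(11)[of A'' \<I>] by (simp add: cmp_assoc)
      also have "\<dots> = \<theta> \<odot> ((p \<cdot> wh \<I> p' X) \<cdot> wh A'' ti \<I>)" unfolding anti using S S' by (simp add: cmp_sc)
      finally have "inverse \<theta> \<odot> (p \<cdot> wh \<I> p' X) = inverse \<theta> \<odot> (\<theta> \<odot> ((p \<cdot> wh \<I> p' X) \<cdot> wh A'' ti \<I>))" by simp
      then show ?thesis using \<theta> S S' by simp
    qed
    have "w \<cdot> (wh \<I> (cu A'' p') X \<cdot> (wh \<I> (ca A'' j') X \<cdot> wh A' cup \<I>))
        = wh \<I> p X \<cdot> (wh A' t \<I> \<cdot> (wh \<I> (cu A'' p') X \<cdot> j'))"
      unfolding wh_ca_cup[OF s'] w_def using S S' by (simp add: cmp_assoc)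
    also have "\<dots> = g \<odot> (wh \<I> (((p \<cdot> wh \<I> p' X) \<cdot> wh A'' ti \<I>) \<cdot> wh \<I> j' X) X \<cdot> wh A' cup \<I>)"
      unfolding t_bent[OF s'] using S S' by (simp add: wh_cmp cmp_assoc cmp_sc)
    also have "\<dots> = (g * inverse \<theta>) \<odot> (wh \<I> p X \<cdot> wh A' cup \<I>)"
      unfolding ti using S S' reassoc[OF step_wh[OF s', of "X \<otimes>\<^sub>o X"], of "wh A' cup \<I>"]
      by (simp add: wh_cmp cmp_assoc cmp_sc wh_sc)
    finally show ?thesis using S S' by (simp add: cu_def)
  qed
  finally show ?thesis using S by (intro mor_eqI) (auto simp: algebra_simps)
qed

text \<open>Let \<open>U\<close> be the inclusion of \<open>Z\<close> into
  \<open>A' \<otimes> X \<otimes> X\<close>. There are no nonzero maps from \<open>Z\<close> to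
  \<open>A'\<close> or to \<open>A'' \<otimes> X\<close>, so all cup-cap terms drop:
  \<open>T\<close> satisfies a quadratic equation on \<open>U\<close>, and
  \<open>(\<nu> * a) \<odot> U\<close> is a combination of \<open>T \<cdot> U\<close> and
  \<open>B \<cdot> (T \<cdot> U)\<close>. The latter is an eigenvector of \<open>T\<close>.
  Eliminating it leaves a scalar equation multiplying
  \<open>T \<cdot> U \<boxplus> (- \<theta>) \<odot> U\<close>, and if that vector is zero then
  \<open>a = \<theta>\<close>.\<close>

lemma bm_summand_next:
  assumes s': "step A'' A' j' p'" and s: "step A' A j p" and sz: "step A Z i pr"
    and ex: "\<nu> \<odot> (j \<cdot> p) = \<alpha> \<odot> ident C (A' \<otimes>\<^sub>o X) \<boxplus> \<beta> \<odot> bm A'' j' p' \<boxplus> \<gamma> \<odot> (cu A'' p' \<cdot> ca A'' j')"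
    and anti: "wh A'' t \<I> \<cdot> (wh \<I> j' X \<cdot> j) = \<theta> \<odot> (wh \<I> j' X \<cdot> j)" and \<theta>: "\<theta> * (\<theta> - z) = 1"
    and a: "bm A' j p \<cdot> i = a \<odot> i" and nz: "ident C Z \<noteq> zero_mor C Z Z"
    and z1: "\<And>f. arr f \<Longrightarrow> dm f = Z \<Longrightarrow> cd f = A'' \<otimes>\<^sub>o X \<Longrightarrow> f = zero_mor C Z (A'' \<otimes>\<^sub>o X)"
    and z2: "\<And>f. arr f \<Longrightarrow> dm f = Z \<Longrightarrow> cd f = A' \<Longrightarrow> f = zero_mor C Z A'"
  shows "\<nu> * a = \<alpha> * (z - \<theta>) \<or> a = \<theta>"
proof -
  note S = stepD[OF s] step_arr[OF s] and S' = stepD[OF s'] step_arr[OF s'] and SZ = stepD[OF sz] step_arr[OF sz]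
  define U where "U = wh \<I> j X \<cdot> i"
  define T where "T = wh A' t \<I>"
  define B where "B = wh \<I> (bm A'' j' p') X"
  have W: "arr U" "dm U = Z" "cd U = A' \<otimes>\<^sub>o (X \<otimes>\<^sub>o X)" "arr T" "dm T = A' \<otimes>\<^sub>o (X \<otimes>\<^sub>o X)" "cd T = A' \<otimes>\<^sub>o (X \<otimes>\<^sub>o X)"
      "arr B" "dm B = A' \<otimes>\<^sub>o (X \<otimes>\<^sub>o X)" "cd B = A' \<otimes>\<^sub>o (X \<otimes>\<^sub>o X)"
    using S S' SZ by (simp_all add: U_def T_def B_def)
  have capU: "wh A' cap \<I> \<cdot> U = zero_mor C Z A'" by (rule z2) (use W in auto)
  have caTU: "wh \<I> (ca A'' j') X \<cdot> (T \<cdot> U) = zero_mor C Z (A'' \<otimes>\<^sub>o X)" by (rule z1) (use W S' in auto)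
  have TT: "T \<cdot> (T \<cdot> U) = U \<boxplus> z \<odot> (T \<cdot> U)"
  proof -
    have "T \<cdot> (T \<cdot> U) = (T \<cdot> T) \<cdot> U" using W by (simp add: cmp_assoc)
    then show ?thesis unfolding T_def t_square using W capU by (simp add: cmp_pl cmp_sc cmp_assoc)
  qed
  have e1: "(\<nu> * a) \<odot> U = \<alpha> \<odot> (T \<cdot> U) \<boxplus> \<beta> \<odot> (B \<cdot> (T \<cdot> U))"
  proof -
    have "(\<nu> * a) \<odot> U = \<nu> \<odot> (wh \<I> j X \<cdot> (bm A' j p \<cdot> i))"
      unfolding a U_def using S SZ by (simp add: cmp_sc)
    also have "\<dots> = wh \<I> (\<nu> \<odot> (j \<cdot> p)) X \<cdot> (T \<cdot> U)"
      unfolding U_def T_def bm_def using S SZ by (simp add: wh_sc wh_cmp cmp_sc cmp_assoc)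
    also have "\<dots> = \<alpha> \<odot> (T \<cdot> U) \<boxplus> \<beta> \<odot> (B \<cdot> (T \<cdot> U))"
      unfolding ex B_def using W S' caTU by (simp add: wh_pl wh_sc wh_cmp cmp_pl cmp_sc cmp_assoc)
    finally show ?thesis .
  qed
  \<comment> \<open>In terms of \<open>A'' \<otimes> X \<otimes> X \<otimes> X\<close> the vector is
    \<open>t1 \<cdot> t2\<close> applied to \<open>J \<cdot> U\<close>. The braid relation moves the
    extra crossing to the right, where \<open>anti\<close> evaluates it as
    \<open>\<theta>\<close>.\<close>
  have Ty: "T \<cdot> (B \<cdot> (T \<cdot> U)) = \<theta> \<odot> (B \<cdot> (T \<cdot> U))"
  proof -
    define t1 t2 where "t1 = wh A'' t X" and "t2 = wh (A'' \<otimes>\<^sub>o X) t \<I>"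
    define P where "P = wh \<I> p' (X \<otimes>\<^sub>o X)"
    define J where "J = wh \<I> j' (X \<otimes>\<^sub>o X)"
    have Q: "arr t1" "dm t1 = A'' \<otimes>\<^sub>o (X \<otimes>\<^sub>o (X \<otimes>\<^sub>o X))" "cd t1 = A'' \<otimes>\<^sub>o (X \<otimes>\<^sub>o (X \<otimes>\<^sub>o X))"
      "arr t2" "dm t2 = A'' \<otimes>\<^sub>o (X \<otimes>\<^sub>o (X \<otimes>\<^sub>o X))" "cd t2 = A'' \<otimes>\<^sub>o (X \<otimes>\<^sub>o (X \<otimes>\<^sub>o X))"
      "arr P" "dm P = A'' \<otimes>\<^sub>o (X \<otimes>\<^sub>o (X \<otimes>\<^sub>o X))" "cd P = A' \<otimes>\<^sub>o (X \<otimes>\<^sub>o X)"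
      "arr J" "cd J = A'' \<otimes>\<^sub>o (X \<otimes>\<^sub>o (X \<otimes>\<^sub>o X))" "dm J = A' \<otimes>\<^sub>o (X \<otimes>\<^sub>o X)"
      using S' by (simp_all add: t1_def t2_def P_def J_def)
    have B: "B = P \<cdot> (t1 \<cdot> J)" unfolding B_def bm_def P_def t1_def J_def using S' by (simp add: wh_cmp)
    have JT: "J \<cdot> T = t2 \<cdot> J" unfolding J_def T_def t2_def using S' cup_past(3)[of j' A' "A'' \<otimes>\<^sub>o X"] by simp
    have PT: "P \<cdot> t2 = T \<cdot> P" unfolding P_def T_def t2_def using S' cup_past(3)[of p' "A'' \<otimes>\<^sub>o X" A'] by simp
    have t1J: "t1 \<cdot> (J \<cdot> U) = \<theta> \<odot> (J \<cdot> U)"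
      using arg_cong[OF anti, of "\<lambda>f. wh \<I> f X \<cdot> i"] S S' SZ unfolding t1_def J_def U_def
      by (simp add: wh_cmp wh_sc cmp_sc cmp_assoc)
    have br: "t1 \<cdot> (t2 \<cdot> t1) = t2 \<cdot> (t1 \<cdot> t2)" unfolding t1_def t2_def using whiskered(10)[of A'' \<I>] by simp
    have y: "B \<cdot> (T \<cdot> U) = P \<cdot> (t1 \<cdot> (t2 \<cdot> (J \<cdot> U)))"
      unfolding B using Q W reassoc[OF JT] by (simp add: cmp_assoc)
    have "T \<cdot> (B \<cdot> (T \<cdot> U)) = (T \<cdot> P) \<cdot> (t1 \<cdot> (t2 \<cdot> (J \<cdot> U)))" unfolding y using Q W by (simp add: cmp_assoc)
    also have "\<dots> = P \<cdot> ((t2 \<cdot> (t1 \<cdot> t2)) \<cdot> (J \<cdot> U))" unfolding PT[symmetric] using Q W by (simp add: cmp_assoc)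
    also have "\<dots> = P \<cdot> (t1 \<cdot> (t2 \<cdot> (t1 \<cdot> (J \<cdot> U))))" unfolding br[symmetric] using Q W by (simp add: cmp_assoc)
    also have "\<dots> = \<theta> \<odot> (B \<cdot> (T \<cdot> U))" unfolding y t1J using Q W by (simp add: cmp_sc)
    finally show ?thesis .
  qed
  have e2: "(\<nu> * a) \<odot> (T \<cdot> U) = \<alpha> \<odot> (U \<boxplus> z \<odot> (T \<cdot> U)) \<boxplus> (\<beta> * \<theta>) \<odot> (B \<cdot> (T \<cdot> U))"
    using arg_cong[OF e1, of "\<lambda>f. T \<cdot> f"] W TT Ty by (simp add: cmp_sc cmp_pl)
  show ?thesis
  proof (cases "T \<cdot> U = \<theta> \<odot> U")
    case True
    have "a \<odot> i = wh \<I> p X \<cdot> (T \<cdot> U)" unfolding a[symmetric] bm_def T_def U_def using S SZ by (simp add: cmp_assoc)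
    also have "\<dots> = \<theta> \<odot> i" unfolding True using W S SZ reassoc[OF step_wh[OF s, of X], of i] by (simp add: cmp_sc U_def)
    finally have "pr \<cdot> (a \<odot> i) = pr \<cdot> (\<theta> \<odot> i)" by simp
    then have "a \<odot> ident C Z = \<theta> \<odot> ident C Z" using SZ by (simp add: cmp_sc)
    then show ?thesis using sc_cancel[of "ident C Z"] nz by simp
  next
    case False
    have "(\<nu> * a) \<odot> (T \<cdot> U \<boxplus> (- \<theta>) \<odot> U) = (\<alpha> * (z - \<theta>)) \<odot> (T \<cdot> U \<boxplus> (- \<theta>) \<odot> U)" (is "_ = ?R")
    proof (rule mor_eqI)
      fix \<phi> assume "lf (dm ?R) (cd ?R) \<phi>"
      then have l: "lf Z (A' \<otimes>\<^sub>o (X \<otimes>\<^sub>o X)) \<phi>" using W by simp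
      define u v w where "u = \<phi> U" and "v = \<phi> (T \<cdot> U)" and "w = \<phi> (B \<cdot> (T \<cdot> U))"
      have 1: "\<nu> * a * u = \<alpha> * v + \<beta> * w" using arg_cong[OF e1, of \<phi>] l W by (simp add: u_def v_def w_def)
      have 2: "\<nu> * a * v = \<alpha> * (u + z * v) + \<beta> * \<theta> * w"
        using arg_cong[OF e2, of \<phi>] l W by (simp add: u_def v_def w_def)
      have "\<nu> * a * (v - \<theta> * u) = \<nu> * a * v - \<theta> * (\<nu> * a * u)" by (simp add: algebra_simps)
      also have "\<dots> = \<alpha> * (u + z * v - \<theta> * v)" unfolding 1 2 by (simp add: algebra_simps)
      also have "u + z * v - \<theta> * v = (\<theta> * (\<theta> - z)) * u + z * v - \<theta> * v" using \<theta> by simp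
      also have "\<alpha> * \<dots> = \<alpha> * (z - \<theta>) * (v - \<theta> * u)" by (simp add: algebra_simps)
      finally show "\<phi> ((\<nu> * a) \<odot> (T \<cdot> U \<boxplus> (- \<theta>) \<odot> U)) = \<phi> ?R"
        using l W by (simp add: u_def v_def)
    qed (use W in auto)
    moreover have "T \<cdot> U \<boxplus> (- \<theta>) \<odot> U \<noteq> zero_mor C Z (A' \<otimes>\<^sub>o (X \<otimes>\<^sub>o X))"
    proof
      assume 0: "T \<cdot> U \<boxplus> (- \<theta>) \<odot> U = zero_mor C Z (A' \<otimes>\<^sub>o (X \<otimes>\<^sub>o X))"
      have "T \<cdot> U = \<theta> \<odot> U"
      proof (rule mor_eqI)
        fix \<phi> assume "lf (dm (\<theta> \<odot> U)) (cd (\<theta> \<odot> U)) \<phi>"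
        then show "\<phi> (T \<cdot> U) = \<phi> (\<theta> \<odot> U)" using arg_cong[OF 0, of \<phi>] W by (simp add: algebra_simps)
      qed (use W in auto)
      then show False using False by simp
    qed
    ultimately have "\<nu> * a = \<alpha> * (z - \<theta>)" using sc_cancel[of "T \<cdot> U \<boxplus> (- \<theta>) \<odot> U"] W by simp
    then show ?thesis by blast
  qed
qed

text \<open>\<open>K\<close>, the path through all three steps, is a common eigenvector of two
  neighbouring crossings with values \<open>\<theta>\<close> and \<open>s\<close>. On it the braid
  relation reads \<open>\<theta> * s * \<theta> = s * \<theta> * s\<close>, and neither value is
  zero because \<open>t\<close> is invertible.\<close>

lemma anti_next:
  assumes s0: "step A0 A1 j0 p0" and s1: "step A1 A2 j1 p1" and s2: "step A2 A3 j2 p2"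
    and anti: "wh A0 t \<I> \<cdot> (wh \<I> j0 X \<cdot> j1) = \<theta> \<odot> (wh \<I> j0 X \<cdot> j1)" and \<theta>: "\<theta> \<noteq> 0"
    and s: "wh A1 t \<I> \<cdot> (wh \<I> j1 X \<cdot> j2) = s \<odot> (wh \<I> j1 X \<cdot> j2)" 
    and nz: "ident C A3 \<noteq> zero_mor C A3 A3"
  shows "s = \<theta>"
proof -
  note S0 = stepD[OF s0] and S1 = stepD[OF s1] and S2 = stepD[OF s2]
  define t1 t2 where "t1 = wh A0 t X" and "t2 = wh (A0 \<otimes>\<^sub>o X) t \<I>"
  define J where "J = wh \<I> j1 X \<cdot> j2"
  define J0 where "J0 = wh \<I> j0 (X \<otimes>\<^sub>o X)"
  define K where "K = J0 \<cdot> J"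
  have Q: "arr t1" "dm t1 = A0 \<otimes>\<^sub>o (X \<otimes>\<^sub>o (X \<otimes>\<^sub>o X))" "cd t1 = A0 \<otimes>\<^sub>o (X \<otimes>\<^sub>o (X \<otimes>\<^sub>o X))"
      "arr t2" "dm t2 = A0 \<otimes>\<^sub>o (X \<otimes>\<^sub>o (X \<otimes>\<^sub>o X))" "cd t2 = A0 \<otimes>\<^sub>o (X \<otimes>\<^sub>o (X \<otimes>\<^sub>o X))"
      "arr J" "dm J = A3" "cd J = A1 \<otimes>\<^sub>o (X \<otimes>\<^sub>o X)"
      "arr J0" "cd J0 = A0 \<otimes>\<^sub>o (X \<otimes>\<^sub>o (X \<otimes>\<^sub>o X))" "dm J0 = A1 \<otimes>\<^sub>o (X \<otimes>\<^sub>o X)"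
      "arr K" "dm K = A3" "cd K = A0 \<otimes>\<^sub>o (X \<otimes>\<^sub>o (X \<otimes>\<^sub>o X))"
    using S0 S1 S2 by (simp_all add: t1_def t2_def J_def J0_def K_def)
  have PJ: "p2 \<cdot> (wh \<I> p1 X \<cdot> J) = ident C A3"
    using S1 S2 reassoc[OF step_wh[OF s1, of X], of j2] by (simp add: J_def)
  have PK: "p2 \<cdot> (wh \<I> p1 X \<cdot> (wh \<I> p0 (X \<otimes>\<^sub>o X) \<cdot> K)) = ident C A3"
    using S0 Q PJ reassoc[OF step_wh[OF s0, of "X \<otimes>\<^sub>o X"], of J] by (simp add: K_def J0_def)
  have Knz: "K \<noteq> zero_mor C A3 (A0 \<otimes>\<^sub>o (X \<otimes>\<^sub>o (X \<otimes>\<^sub>o X)))"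
    using PK nz S0 S1 S2 by auto
  have t1K: "t1 \<cdot> K = \<theta> \<odot> K"
    using arg_cong[OF anti, of "\<lambda>f. wh \<I> f X \<cdot> j2"] S0 S1 S2 unfolding t1_def J_def J0_def K_def
      by (simp add: wh_cmp wh_sc cmp_sc cmp_assoc)
  have t2K: "t2 \<cdot> K = s \<odot> K"
  proof -
    have "t2 \<cdot> K = J0 \<cdot> (wh A1 t \<I> \<cdot> J)" unfolding K_def t2_def J0_def 
      using Q S0 reassoc[OF cup_past(3)[of j0 A1 "A0 \<otimes>\<^sub>o X", symmetric], of J] by (simp add: cmp_assoc)
    then show ?thesis unfolding K_def using s Q by (simp add: J_def[symmetric] cmp_sc)
  qed
  have br: "t1 \<cdot> (t2 \<cdot> t1) = t2 \<cdot> (t1 \<cdot> t2)" unfolding t1_def t2_def using whiskered(10)[of A0 \<I>] by simp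
  have "t1 \<cdot> (t2 \<cdot> (t1 \<cdot> K)) = t2 \<cdot> (t1 \<cdot> (t2 \<cdot> K))"
    using arg_cong[OF br, of "\<lambda>f. f \<cdot> K"] Q by (simp add: cmp_assoc)
  then have "(\<theta> * s * \<theta>) \<odot> K = (s * \<theta> * s) \<odot> K" using Q t1K t2K by (simp add: cmp_sc mult.assoc mult.commute)
  then have e: "\<theta> * s * \<theta> = s * \<theta> * s" using sc_cancel[of K] Q Knz by simp
  have "s \<noteq> 0"
  proof
    assume "s = 0"
    then have "wh A1 ti \<I> \<cdot> (wh A1 t \<I> \<cdot> J) = zero_mor C A3 (A1 \<otimes>\<^sub>o (X \<otimes>\<^sub>o X))"
      using s Q by (simp add: J_def[symmetric] sc_zero)
    then have "J = zero_mor C A3 (A1 \<otimes>\<^sub>o (X \<otimes>\<^sub>o X))"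
      using reassoc[OF whiskered(12)[of A1 \<I>], of J] Q by simp
    then show False using PJ nz S1 S2 by simp
  qed
  then show ?thesis using e \<theta> by simp
qed

end

section \<open>The scalar recursion\<close>

text \<open>The q-integer (q^n - q^(-n)) / (q - q^(-1)). The recursion also gives it a value at q^2
  = 1, namely n up to sign.\<close>

primrec qn :: "complex \<Rightarrow> nat \<Rightarrow> complex" where
  "qn q 0 = 0"
| "qn q (Suc n) = q ^ n + inverse q * qn q n"

lemma qn_closed: "q \<noteq> 0 \<Longrightarrow> (q - inverse q) * qn q n = q ^ n - inverse q ^ n"
proof (induction n)
  case (Suc n)
  have "(q - inverse q) * qn q (Suc n) = q * q ^ n - inverse q * q ^ n + inverse q * ((q - inverse q) * qn q n)"
    by (simp add: algebra_simps)
  also have "\<dots> = q * q ^ n - inverse q * inverse q ^ n"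
    unfolding Suc.IH[OF Suc.prems] by (simp add: right_diff_distrib)
  finally show ?case by simp
qed simp

lemma qn_unit: "q * q = 1 \<Longrightarrow> qn q (Suc n) = of_nat (Suc n) * q ^ n"
proof (induction n)
  case (Suc n)
  have "inverse q = q" using Suc.prems by (metis inverse_unique)
  then have "qn q (Suc (Suc n)) = q ^ Suc n + q * qn q (Suc n)" by (simp only: qn.simps)
  then show ?case using Suc by (simp add: algebra_simps)
qed simp

text \<open>The inverses \<open>s\<close>, \<open>p'\<close>, \<open>\<rho>\<close> of
  \<open>q\<close>, \<open>p\<close>, \<open>r\<close> are separate variables with defining
  relations, so both claims are polynomial identities modulo these relations. In the application
  \<open>p\<close> is q^(i+1), \<open>\<nu>\<close> is a q-integer and \<open>e\<close> is the value
  of \<open>Ec\<close> at 0.\<close>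

lemma key_identities:
  fixes q s r \<rho> p p' e \<nu> X :: complex
  assumes "q * s = 1" "p * p' = 1" "r * \<rho> = 1" "(q - s) * e = r + q" "(q - s) * \<nu> = p * s - p' * q"
    and X: "X = e * (1 - \<rho> * s)"
  defines "F \<equiv> s * ((X - 1) * (p' * q) - \<nu> * \<rho>)"
  shows "(e + p * \<nu>) * (p * \<rho> - p * q) + (p * s + s * \<nu>) * (p * p) = - (p * p * q * F)"
    and "p * X * (e + p * \<nu>) - (p * s + s * \<nu>) * (r * (e + p * \<nu>)) - (p * s + s * \<nu>) * (p * p * s)
      = (e + p * (p + \<nu>)) * F"
proof -
  have X1: "X * q = e * q - e * \<rho>" unfolding X using assms(1) by Groebner_Basis.algebra
  have X2: "X * r = e * r - e * s" unfolding X using assms(3) by Groebner_Basis.algebra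
  have X3: "r - \<rho> = (q - s) * (X - 1)"
  proof -
    have "(q - s) * (X - 1) = ((q - s) * e) * (1 - \<rho> * s) - (q - s)" unfolding X by (simp add: algebra_simps)
    also have "\<dots> = r - \<rho>" unfolding assms(4) using assms(1,3) by Groebner_Basis.algebra
    finally show ?thesis by simp
  qed
  have pF: "p * F = (X - 1) - p * s * \<nu> * \<rho>" unfolding F_def using assms(1,2) by Groebner_Basis.algebra
  have F1: "F = (X - 1) * p' - s * \<nu> * \<rho>" unfolding F_def using assms(1) by Groebner_Basis.algebra
  have pn: "p * ((q - s) * \<nu>) = p * p * s - q" unfolding assms(5) using assms(2) by Groebner_Basis.algebra
  have "(e + p * \<nu>) * (p * \<rho> - p * q) + (p * s + s * \<nu>) * (p * p) + p * p * q * F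
     = p * (e * \<rho> - e * q + X * q) - p * (p * ((q - s) * \<nu>) - p * p * s + q)
        + p * q * (p * F - (X - 1)) + p * p * \<nu> * \<rho>" by Groebner_Basis.algebra
  also have "\<dots> = 0" unfolding X1 pn pF using assms(1) by Groebner_Basis.algebra
  finally show "(e + p * \<nu>) * (p * \<rho> - p * q) + (p * s + s * \<nu>) * (p * p) = - (p * p * q * F)"
    by (simp only: eq_neg_iff_add_eq_0)
  have s1: "1 - s * s = s * (q - s)" using assms(1) by Groebner_Basis.algebra
  have zn: "s * ((q - s) * \<nu>) = p * s * s - p'" unfolding assms(5) using assms(1) by Groebner_Basis.algebra
  have c1: "s * \<nu> * (r - \<rho>) = (X - 1) * (p * s * s - p')"
    unfolding X3 zn[symmetric] by Groebner_Basis.algebra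
  have c2: "p * p * X * \<nu> * (1 - s * s) = p * p * X * (p * s * s) - p * X"
    using zn s1 assms(2) by Groebner_Basis.algebra
  have c3: "X * e * (1 - s * s) = X * s * (r + q)" unfolding s1 assms(4)[symmetric] by Groebner_Basis.algebra
  have "p * X * (e + p * \<nu>) - (p * s + s * \<nu>) * (r * (e + p * \<nu>)) - (p * s + s * \<nu>) * (p * p * s)
      - (e + p * (p + \<nu>)) * F
    = - (s * \<nu> * (r - \<rho>)) * (p * p + e + p * \<nu>) + p * X * e + p * p * X * \<nu> - p * s * r * e 
      - p * p * p * s * s - p * p * s * s * \<nu> - (X - 1) * (p * (p * p')) - (X - 1) * e * p' - (X - 1) * \<nu> * (p * p')"
    unfolding F1 by Groebner_Basis.algebra
  also have "\<dots> = p * (X * e * (1 - s * s)) + p * (e * s * s) - p * s * r * e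
      + p * p * X * \<nu> * (1 - s * s) - X * (p * p * p * s * s)"
    unfolding c1 using assms(2) by Groebner_Basis.algebra
  also have "\<dots> = p * s * (X * r + e * s - r * e)" unfolding c2 c3 using assms(1) by Groebner_Basis.algebra
  also have "\<dots> = 0" unfolding X2 by Groebner_Basis.algebra
  finally show "p * X * (e + p * \<nu>) - (p * s + s * \<nu>) * (r * (e + p * \<nu>)) - (p * s + s * \<nu>) * (p * p * s)
      = (e + p * (p + \<nu>)) * F" by simp
qed

text \<open>Here \<open>d i\<close> stands for the ratio of the dimensions of \<open>[1\<^sup>i\<^sup>+\<^sup>1]\<close> and \<open>[1\<^sup>i]\<close>, and \<open>k i\<close> for the normalised
  coefficient of the cup-cap in the idempotent projecting onto \<open>[1\<^sup>i]\<close>; \<open>qn q i\<close> is the \<open>q\<close>-integer.\<close>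

definition scalar_chain where
  "scalar_chain q r X d k n \<longleftrightarrow> d 0 = X \<and> k (Suc 0) = 0 \<and> (\<forall>i<n. 
     k (Suc (Suc i)) * d i = q ^ i * inverse r - q ^ Suc i - q * k (Suc i) \<and>
     qn q (Suc (Suc i)) * d (Suc i) = q ^ Suc i * X - qn q (Suc i) * r + k (Suc (Suc i)))"

text \<open>Up to the factor \<open>q - 1/q\<close>, \<open>Ec q r X i\<close> is \<open>r + q\<^sup>2\<^sup>i\<^sup>+\<^sup>1\<close>; this form also makes sense for \<open>q\<^sup>2 = 1\<close>.\<close>

definition Ec where "Ec q r X i = X / (1 - inverse r * inverse q) + q ^ Suc i * qn q i"
text \<open>When \<open>X\<close> is the loop value, (q - 1/q) times this is (r q^(-i) - q^i / r) /
  q. Away from q^2 = 1 its zeros are therefore r^2 = q^(2i).\<close>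

definition Fc where "Fc q r X i = inverse q * ((X - 1) * inverse q ^ i - qn q i * inverse r)"

section \<open>Closed form of the chain\<close>

lemma Ec_closed:
  assumes "q \<noteq> 0" "r \<noteq> 0" "r * q \<noteq> 1" and zX: "(q - inverse q) * X = q - inverse q + r - inverse r"
  shows "(q - inverse q) * (X / (1 - inverse r * inverse q)) = r + q"
    and "(q - inverse q) * Ec q r X i = r + q ^ Suc (2 * i)"
proof -
  have n: "1 - inverse r * inverse q \<noteq> 0" using assms by (simp add: field_simps)
  have "(r + q) * (1 - inverse r * inverse q) = q - inverse q + r - inverse r"
    using assms by (simp add: field_simps)
  then show 1: "(q - inverse q) * (X / (1 - inverse r * inverse q)) = r + q"
    using n zX by (simp add: field_simps)
  have "q ^ Suc i * inverse q ^ i = q" using assms(1) by (simp add: power_inverse)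
  moreover have "q ^ Suc i * q ^ i = q ^ Suc (2 * i)" by (simp add: mult_2 power_add)
  ultimately have "q ^ Suc i * ((q - inverse q) * qn q i) = q ^ Suc (2 * i) - q"
    unfolding qn_closed[OF assms(1)] by (simp only: right_diff_distrib)
  then show "(q - inverse q) * Ec q r X i = r + q ^ Suc (2 * i)"
    using 1 unfolding Ec_def by (simp only: distrib_left mult.left_commute) simp
qed

text \<open>These are the induction step of the closed form: the first identity yields the next
  \<open>k\<close>, the second the next \<open>d\<close>, both multiplied by \<open>Ec\<close> to
  avoid division.\<close>

lemma Ec_identities:
  assumes "q \<noteq> 0" "r \<noteq> 0" "r * q \<noteq> 1" and zX: "(q - inverse q) * X = q - inverse q + r - inverse r"
  shows "Ec q r X i * (q ^ Suc i * inverse r - q ^ Suc (Suc i)) + qn q (Suc i) * q ^ Suc (Suc (2 * i))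
      = - (q ^ Suc (Suc (Suc (2 * i))) * Fc q r X i)"
    and "q ^ Suc i * X * Ec q r X i - qn q (Suc i) * (r * Ec q r X i) - qn q (Suc i) * q ^ Suc (2 * i)
      = Ec q r X (Suc i) * Fc q r X i"
proof -
  define e p p' where "e = X / (1 - inverse r * inverse q)" and "p = q ^ Suc i" and "p' = inverse q ^ Suc i"
  have n: "1 - inverse r * inverse q \<noteq> 0" using assms by (simp add: field_simps)
  have "p * p' = 1" unfolding p_def p'_def power_mult_distrib[symmetric] using assms(1) by simp
  then have 1: "q * inverse q = 1" "p * p' = 1" "r * inverse r = 1" "(q - inverse q) * e = r + q"
    "X = e * (1 - inverse r * inverse q)"
    using assms n Ec_closed(1)[OF assms] by (simp_all add: e_def)
  have qi: "q ^ i = p * inverse q" "inverse q ^ i = p' * q" using assms(1) by (simp_all add: p_def p'_def)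
  have 2: "(q - inverse q) * qn q i = p * inverse q - p' * q" using qn_closed[OF assms(1), of i] qi by simp
  note I = key_identities[OF 1(1-4) 2 1(5)]
  have E: "Ec q r X i = e + p * qn q i" "Ec q r X (Suc i) = e + p * (p + qn q i)"
    "Fc q r X i = inverse q * ((X - 1) * (p' * q) - qn q i * inverse r)" 
    "qn q (Suc i) = p * inverse q + inverse q * qn q i"
  proof -
    show 1: "qn q (Suc i) = p * inverse q + inverse q * qn q i" by (simp only: qn.simps qi)
    show "Ec q r X i = e + p * qn q i" by (simp only: Ec_def e_def p_def)
    show "Fc q r X i = inverse q * ((X - 1) * (p' * q) - qn q i * inverse r)" by (simp only: Fc_def qi)
    have "q ^ Suc (Suc i) * qn q (Suc i) = p * (p + qn q i)"
    proof -
      have "q * p * (p * s + s * \<nu>) = p * (p + \<nu>)" if "q * s = 1" for s \<nu>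
        using that by Groebner_Basis.algebra
      then show ?thesis unfolding 1 using assms(1) by (simp add: p_def)
    qed
    then show "Ec q r X (Suc i) = e + p * (p + qn q i)" by (simp only: Ec_def e_def)
  qed
  have pw: "q ^ Suc (Suc i) = p * q" "q ^ Suc (Suc (2 * i)) = p * p" "q ^ Suc (Suc (Suc (2 * i))) = p * p * q"
    "q ^ Suc (2 * i) = p * p * inverse q"
    using assms(1) by (simp_all add: p_def mult_2 power_add)
  show "Ec q r X i * (q ^ Suc i * inverse r - q ^ Suc (Suc i)) + qn q (Suc i) * q ^ Suc (Suc (2 * i))
      = - (q ^ Suc (Suc (Suc (2 * i))) * Fc q r X i)"
    unfolding pw p_def[symmetric] E by (rule I(1))
  show "q ^ Suc i * X * Ec q r X i - qn q (Suc i) * (r * Ec q r X i) - qn q (Suc i) * q ^ Suc (2 * i)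
      = Ec q r X (Suc i) * Fc q r X i"
    unfolding pw p_def[symmetric] E by (rule I(2))
qed

text \<open>Nonvanishing of \<open>Ec\<close> has to be carried through the induction:
  \<open>Ec (i+1)\<close> and \<open>Fc i\<close> are nonzero because their product is
  \<open>qn (i+2) * d (i+1) * Ec i\<close>, and cancelling \<open>Fc i\<close> then gives the next
  \<open>k\<close>. The assumption \<open>r * q \<noteq> 1\<close> keeps the denominator inside
  \<open>Ec\<close> away from zero.\<close>

lemma chain_closed:
  assumes q: "q \<noteq> 0" "r \<noteq> 0" "r * q \<noteq> 1" and zX: "(q - inverse q) * X = q - inverse q + r - inverse r"
    and X: "X \<noteq> 0" and ch: "scalar_chain q r X d k n"
    and d: "\<And>j. j < n \<Longrightarrow> d j \<noteq> 0" and qn0: "\<And>j. j < n \<Longrightarrow> qn q (Suc j) \<noteq> 0"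
    and "i < n"
  shows "Ec q r X i \<noteq> 0 \<and> k (Suc (Suc i)) * Ec q r X i = - (qn q (Suc i) * q ^ Suc (2 * i)) \<and>
    qn q (Suc (Suc i)) * d (Suc i) * Ec q r X i = Ec q r X (Suc i) * Fc q r X i"
  using \<open>i < n\<close>
proof (induction i)
  have D: "qn q (Suc (Suc i)) * d (Suc i) * Ec q r X i = Ec q r X (Suc i) * Fc q r X i"
    if "i < n" "k (Suc (Suc i)) * Ec q r X i = - (qn q (Suc i) * q ^ Suc (2 * i))" for i
  proof -
    have "qn q (Suc (Suc i)) * d (Suc i) = q ^ Suc i * X - qn q (Suc i) * r + k (Suc (Suc i))"
      using ch that(1) unfolding scalar_chain_def by blast
    then have "qn q (Suc (Suc i)) * d (Suc i) * Ec q r X i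
      = q ^ Suc i * X * Ec q r X i - qn q (Suc i) * (r * Ec q r X i) + k (Suc (Suc i)) * Ec q r X i"
      by (simp only:) (simp add: algebra_simps)
    then show ?thesis unfolding that(2) using Ec_identities(2)[OF q zX, of i] by (simp only: add_uminus_conv_diff)
  qed
  {
    case 0
    have n: "1 - inverse r * inverse q \<noteq> 0" using q by (simp add: field_simps)
    have E: "Ec q r X 0 = X / (1 - inverse r * inverse q)" by (simp add: Ec_def)
    have "k (Suc (Suc 0)) * X = inverse r - q" using ch 0 unfolding scalar_chain_def by (metis mult_1 mult_zero_right diff_zero power_0 power_Suc0_right power_Suc_0 One_nat_def power_one_right)
    then have "k (Suc (Suc 0)) * Ec q r X 0 = (inverse r - q) / (1 - inverse r * inverse q)"
      unfolding E by (simp add: field_simps)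
    also have "\<dots> = - q" using n q by (simp add: field_simps)
    finally have "k (Suc (Suc 0)) * Ec q r X 0 = - (qn q (Suc 0) * q ^ Suc (2 * 0))" by simp
    then show ?case using D[OF 0] X n by (simp add: E)
  next
    case (Suc i)
    then have i: "i < n" and IH: "Ec q r X i \<noteq> 0"
      "k (Suc (Suc i)) * Ec q r X i = - (qn q (Suc i) * q ^ Suc (2 * i))"
      "qn q (Suc (Suc i)) * d (Suc i) * Ec q r X i = Ec q r X (Suc i) * Fc q r X i" by auto
    have nz: "d (Suc i) \<noteq> 0" "qn q (Suc (Suc i)) \<noteq> 0" using d[OF Suc.prems] qn0[OF Suc.prems] .
    then have E: "Ec q r X (Suc i) \<noteq> 0" "Fc q r X i \<noteq> 0" using IH by auto
    have k: "k (Suc (Suc (Suc i))) * d (Suc i) = q ^ Suc i * inverse r - q ^ Suc (Suc i) - q * k (Suc (Suc i))"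
      using ch Suc.prems unfolding scalar_chain_def by blast
    have "k (Suc (Suc (Suc i))) * (Ec q r X (Suc i) * Fc q r X i)
       = qn q (Suc (Suc i)) * ((k (Suc (Suc (Suc i))) * d (Suc i)) * Ec q r X i)"
      unfolding IH(3)[symmetric] by (simp only: mult_ac)
    also have "(k (Suc (Suc (Suc i))) * d (Suc i)) * Ec q r X i
       = Ec q r X i * (q ^ Suc i * inverse r - q ^ Suc (Suc i)) - q * (k (Suc (Suc i)) * Ec q r X i)"
      unfolding k by (simp only: algebra_simps)
    also have "\<dots> = Ec q r X i * (q ^ Suc i * inverse r - q ^ Suc (Suc i)) + qn q (Suc i) * q ^ Suc (Suc (2 * i))"
      unfolding IH(2) by (simp only: power_Suc mult_ac mult_minus_right diff_minus_eq_add)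
    also have "\<dots> = - (q ^ Suc (Suc (Suc (2 * i))) * Fc q r X i)" by (rule Ec_identities(1)[OF q zX])
    finally have "(k (Suc (Suc (Suc i))) * Ec q r X (Suc i)) * Fc q r X i
       = - (qn q (Suc (Suc i)) * q ^ Suc (2 * Suc i)) * Fc q r X i"
      by (simp only: mult_ac mult_minus_right mult_minus_left) (simp add: mult_ac)
    then have "k (Suc (Suc (Suc i))) * Ec q r X (Suc i) = - (qn q (Suc (Suc i)) * q ^ Suc (2 * Suc i))"
      using E(2) mult_right_cancel by blast
    then show ?case using D[OF Suc.prems] E(1) by blast
  }
qed

text \<open>With \<open>inverse r = q\<close> the inhomogeneous part of the recursion for
  \<open>k\<close> cancels.\<close>

lemma chain_degenerate:
  assumes "r * q = 1" "q * q = 1" "scalar_chain q r X d k n" "\<And>j. j < n \<Longrightarrow> d j \<noteq> 0" "i \<le> n"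
  shows "k (Suc i) = 0"
  using assms(5)
proof (induction i)
  case 0
  then show ?case using assms(3) by (simp add: scalar_chain_def)
next
  case (Suc i)
  then have "k (Suc (Suc i)) * d i = q ^ i * inverse r - q ^ Suc i - q * k (Suc i)"
    using assms(3) by (simp add: scalar_chain_def)
  moreover have "inverse r = q" using assms(1) by (metis inverse_unique)
  ultimately have "k (Suc (Suc i)) * d i = 0" using Suc by simp
  then show ?case using assms(4)[of i] Suc by simp
qed

text \<open>If \<open>inverse r = q\<close>, the relation for \<open>X\<close> collapses to
  \<open>(q - inverse q) * X = 0\<close>.\<close>

lemma degenerate_unit:
  assumes "(q::complex) \<noteq> 0" "r * q = 1" and zX: "(q - inverse q) * X = q - inverse q + r - inverse r" and "X \<noteq> 0"
  shows "q * q = 1" "r = q"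
proof -
  have "inverse r = q" "inverse q = r" using assms(2) by (metis inverse_unique mult.commute)+
  then have "(q - inverse q) * X = 0" using zX by simp
  then have "q = inverse q" using assms(4) by simp
  then show "q * q = 1" "r = q" using assms(1) \<open>inverse q = r\<close> right_inverse[of q] by simp_all
qed

text \<open>The closed form turns \<open>d (m+2) = 0\<close> into the vanishing of
  \<open>Ec (m+2) * Fc (m+1)\<close>. A zero of \<open>Fc\<close> would entail
  \<open>X * d (m+1) = 1\<close>, which \<open>top\<close> forbids, so \<open>Ec (m+2)\<close>
  vanishes, and that is the claimed value of \<open>r\<close>. The length of the longest column is
  m+2.\<close>

lemma symplectic_scalar:
  assumes q: "q \<noteq> 0" "r \<noteq> 0" and zX: "(q - inverse q) * X = q - inverse q + r - inverse r"
    and X: "X \<noteq> 0" and ch: "scalar_chain q r X d k (Suc (Suc m))"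
    and d: "\<And>j. j < Suc (Suc m) \<Longrightarrow> d j \<noteq> 0" and qn0: "\<And>j. j < Suc (Suc m) \<Longrightarrow> qn q (Suc j) \<noteq> 0"
    and top: "d (Suc (Suc m)) = 0" "X * d (Suc m) \<noteq> 1"
  shows "r = - (q ^ (2 * Suc (Suc m) + 1))"
proof (cases "r * q = 1")
  case True
  \<comment> \<open>Now q^2 = 1, \<open>r = q\<close> and every \<open>k\<close> vanishes. The
    vanishing of the last \<open>d\<close> forces \<open>X\<close> to be m+2, hence
    \<open>X * d (m+1) = 1\<close>, contrary to \<open>top\<close>.\<close>
  note U = degenerate_unit[OF q(1) True zX X]
  have k0: "k (Suc (Suc (Suc m))) = 0" "k (Suc (Suc m)) = 0"
    using chain_degenerate[OF True U(1) ch d] by auto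
  have c: "qn q (Suc (Suc i)) * d (Suc i) = q ^ Suc i * X - qn q (Suc i) * r + k (Suc (Suc i))"
    if "i < Suc (Suc m)" for i using ch that unfolding scalar_chain_def by blast
  have 1: "q ^ Suc (Suc m) * X = qn q (Suc (Suc m)) * r" "qn q (Suc (Suc m)) * d (Suc m) = q ^ Suc m * X - qn q (Suc m) * r"
    using c[of "Suc m"] c[of m] k0 top(1) by (simp_all del: qn.simps power_Suc)
  have "q ^ Suc (Suc m) * X = q ^ Suc (Suc m) * of_nat (Suc (Suc m))"
    using 1(1) U(2) qn_unit[OF U(1), of "Suc m"] by (simp add: mult_ac)
  then have X: "X = of_nat (Suc (Suc m))" using q by simp
  have "q ^ Suc m * (of_nat (Suc (Suc m)) * d (Suc m)) = q ^ Suc m * (X - of_nat (Suc m))"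
    using 1(2) U(2) qn_unit[OF U(1), of "Suc m"] qn_unit[OF U(1), of m] by (simp add: mult_ac right_diff_distrib)
  then have "X * d (Suc m) = 1" using q X by simp
  then show ?thesis using top by simp
next
  case False
  have C: "Ec q r X i \<noteq> 0 \<and> k (Suc (Suc i)) * Ec q r X i = - (qn q (Suc i) * q ^ Suc (2 * i)) \<and>
    qn q (Suc (Suc i)) * d (Suc i) * Ec q r X i = Ec q r X (Suc i) * Fc q r X i" if "i < Suc (Suc m)" for i
    by (rule chain_closed[OF q False zX X ch _ _ that]) (use d qn0 in auto)
  let ?E = "Ec q r X" and ?F = "Fc q r X"
  have "?E (Suc (Suc m)) * ?F (Suc m) = 0" using C[of "Suc m"] top(1) by simp
  moreover have "?F (Suc m) \<noteq> 0"
  proof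
    assume F0: "?F (Suc m) = 0"
    define e p p' s \<nu> \<rho> where "e = X / (1 - inverse r * inverse q)" and "p = q ^ Suc (Suc m)" and "p' = inverse q ^ Suc (Suc m)"
      and "s = inverse q" and "\<nu> = qn q (Suc m)" and "\<rho> = inverse r"
    have n: "1 - inverse r * inverse q \<noteq> 0" using q False by (simp add: field_simps)
    have qs: "q * s = 1" using q by (simp add: s_def)
    have "y = s * (s * y) * (q * q)" for y using qs by Groebner_Basis.algebra
    then have "s ^ m = s * (s * s ^ m) * (q * q)" .
    then have pw: "q ^ Suc m = p * s" "inverse q ^ m = p' * (q * q)" "inverse q ^ Suc m = p' * q"
      using q unfolding p_def p'_def s_def by simp_all
    have "p * p' = 1" unfolding p_def p'_def power_mult_distrib[symmetric] using q by simp
    moreover have "(q - s) * \<nu> = p * s - p' * q"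
      using qn_closed[OF q(1), of "Suc m"] unfolding pw s_def \<nu>_def .
    ultimately have h: "q * s = 1" "p * p' = 1" "r * \<rho> = 1" "(q - s) * e = r + q" "X = e * (1 - \<rho> * s)"
      "(q - s) * \<nu> = p * s - p' * q"
      using q n Ec_closed(1)[OF q False zX] by (simp_all add: e_def s_def \<rho>_def)
    have "q * (q * y) * s * s = y" for y using qs by Groebner_Basis.algebra
    then have "p * s * s = q ^ m" unfolding p_def power_Suc .
    then have "\<nu> = p * s * s + s * qn q m" unfolding \<nu>_def by (simp add: s_def)
    then have qm: "qn q m = q * \<nu> - p * s" using h(1) by Groebner_Basis.algebra
    have f0: "(X - 1) * (p' * q) = \<nu> * \<rho>" using F0 q unfolding Fc_def pw(3) by (simp add: \<nu>_def \<rho>_def)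
    have E: "?E m = e + p * s * (q * \<nu> - p * s)" "?E (Suc m) = e + p * \<nu>" 
       "?F m = s * ((X - 1) * (p' * (q * q)) - (q * \<nu> - p * s) * \<rho>)" "qn q (Suc (Suc m)) = p * s + s * \<nu>"
      unfolding Ec_def Fc_def pw qm by (simp_all add: e_def[symmetric] p_def[symmetric] \<nu>_def s_def \<rho>_def q)
        (simp_all add: p_def q)
    have A: "?F m = p * s * s * \<rho>" unfolding E using f0 h(1) by Groebner_Basis.algebra
    have "(p * s + s * \<nu>) * (e + p * s * (q * \<nu> - p * s)) = X * ((e + p * \<nu>) * (p * s * s * \<rho>))"
      using h f0 by Groebner_Basis.algebra
    then have "qn q (Suc (Suc m)) * ?E m = X * (?E (Suc m) * ?F m)" by (simp only: E(1,2,4) A)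
    also have "\<dots> = X * (qn q (Suc (Suc m)) * d (Suc m) * ?E m)" using C[of m] by simp
    finally have "X * d (Suc m) = 1" using C[of m] qn0[of "Suc m"] by (simp add: mult_ac)
    then show False using top by simp
  qed
  ultimately have "?E (Suc (Suc m)) = 0" by simp
  then have "r + q ^ Suc (2 * Suc (Suc m)) = 0" using Ec_closed(2)[OF q False zX, of "Suc (Suc m)"] by simp
  then show ?thesis by (simp add: eq_neg_iff_add_eq_0)
qed

text \<open>With the closed forms inserted, the two end conditions \<open>top\<close> become the
  equations \<open>e1\<close> and \<open>e2\<close> in \<open>r\<close> and \<open>P\<close> =
  q^(m+2). For q^2 \<noteq> 1 the first one factors; one factor is r^2 = q^(2m+2), and the other is
  ruled out by \<open>e2\<close> together with the nonvanishing assumptions. The negative root with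
  m even is excluded because an \<open>Ec\<close> in the middle of the chain would vanish.\<close>

lemma orthogonal_scalar:
  assumes q: "q \<noteq> 0" "r \<noteq> 0" and zX: "(q - inverse q) * X = q - inverse q + r - inverse r"
    and X: "X \<noteq> 0" and q2: "q * q \<noteq> -1" and ch: "scalar_chain q r X d k (Suc m)"
    and d: "\<And>j. j < Suc m \<Longrightarrow> d j \<noteq> 0" and qn0: "\<And>j. j < Suc m \<Longrightarrow> qn q (Suc j) \<noteq> 0"
    and top: "X * d (Suc m) = 1" "qn q (Suc (Suc m)) * r = (q ^ Suc m * inverse r - q * k (Suc (Suc m))) * X"
    and S: "X * (inverse q * X + r) \<noteq> inverse q + inverse r"
  shows "r = q ^ Suc m \<or> odd (Suc (Suc m)) \<and> r = - (q ^ Suc m)"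
proof -
  \<comment> \<open>At q^2 = 1 the power q^(m+1) is \<open>q\<close> for even m and 1 for odd m, so
    for odd m both signs of \<open>r\<close> are admissible and only even m needs an
    argument.\<close>
  have unit: ?thesis if "q * q = 1" "r * r = 1" "even m \<longrightarrow> r = q"
  proof (cases "even m")
    case True
    then obtain l where "m = 2 * l" by (rule evenE)
    then have "q ^ Suc m = q * (q * q) ^ l" by (simp add: power_mult power2_eq_square)
    then show ?thesis using that True by simp
  next
    case False
    then obtain l where "Suc m = 2 * l" using evenE[of "Suc m"] by auto
    then have "q ^ Suc m = (q * q) ^ l" by (simp add: power_mult power2_eq_square del: power_Suc)
    moreover have "r = 1 \<or> r = -1" using that(2) by (simp add: square_eq_1_iff)
    ultimately show ?thesis using that False by auto
  qed
  show ?thesis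
  proof (cases "r * q = 1")
    case True
    show ?thesis using unit degenerate_unit[OF q(1) True zX X] by auto
  next
    case False
    have C: "Ec q r X i \<noteq> 0 \<and> k (Suc (Suc i)) * Ec q r X i = - (qn q (Suc i) * q ^ Suc (2 * i)) \<and>
    qn q (Suc (Suc i)) * d (Suc i) * Ec q r X i = Ec q r X (Suc i) * Fc q r X i" if "i < Suc m" for i
    by (rule chain_closed[OF q False zX X ch _ _ that]) (use d qn0 in auto)
    define P s \<rho> E0 E1 F where "P = q ^ Suc (Suc m)" and "s = inverse q" and "\<rho> = inverse r"
      and "E0 = Ec q r X m" and "E1 = Ec q r X (Suc m)" and "F = Fc q r X m"
    have qs: "q * s = 1" "r * \<rho> = 1" using q by (simp_all add: s_def \<rho>_def)
    have Cm: "E0 \<noteq> 0" "k (Suc (Suc m)) * E0 = - (qn q (Suc m) * q ^ Suc (2 * m))"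
      "qn q (Suc (Suc m)) * d (Suc m) * E0 = E1 * F"
      using C[OF lessI] unfolding E0_def E1_def F_def by blast+
    have "X * (E1 * F) = qn q (Suc (Suc m)) * (X * d (Suc m)) * E0" unfolding Cm(3)[symmetric] by (simp only: mult_ac)
    then have e2: "qn q (Suc (Suc m)) * E0 = X * (E1 * F)" unfolding top by simp
    have pw: "q ^ Suc (Suc (2 * m)) = q * q ^ Suc (2 * m)" "q ^ Suc (Suc (Suc (2 * m))) = P * P * s"
      using q by (simp_all add: P_def s_def mult_2 power_add)
    have "X * (r * (E1 * F)) = (qn q (Suc (Suc m)) * r) * E0" unfolding mult.left_commute[of X r] e2[symmetric] by simp
    also have "\<dots> = X * (E0 * (q ^ Suc m * \<rho>) - q * (k (Suc (Suc m)) * E0))"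
      unfolding top \<rho>_def by (simp only: algebra_simps)
    also have "E0 * (q ^ Suc m * \<rho>) - q * (k (Suc (Suc m)) * E0) = P * E0 - P * P * s * F"
      using Ec_identities(1)[OF q False zX, of m] unfolding Cm(2) pw P_def[symmetric] E0_def[symmetric] F_def[symmetric] \<rho>_def[symmetric]
      by (simp only: algebra_simps) (simp add: algebra_simps add_eq_0_iff)
    finally have e1: "r * (E1 * F) = P * E0 - P * P * s * F" using X by simp
    show ?thesis
    proof (cases "q * q = 1")
      case True
      have s: "s = q" using True by (metis inverse_unique s_def)
      then have "r = \<rho>" using zX by (simp add: s_def \<rho>_def)
      then have rr: "r * r = 1" using qs by simp
      have rq: "r = - q" using rr True False by (metis mult_minus_left square_eq_iff)
      have sq: "q ^ (2 * j) = 1" for j using True by (simp add: power_mult power2_eq_square)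
      have qi: "q ^ Suc i * qn q i = of_nat i" for i
      proof (cases i)
        case (Suc j)
        have "q ^ Suc (Suc j) * q ^ j = q ^ (2 * Suc j)" by (simp add: mult_2 power_add)
        then have "q ^ Suc (Suc j) * q ^ j = 1" unfolding sq .
        then show ?thesis unfolding Suc qn_unit[OF True] mult.left_commute[of "q ^ Suc (Suc j)"] by (simp only: mult_1_right)
      qed simp
      define e where "e = X / (1 - inverse r * inverse q)"
      have "1 - inverse r * inverse q = 2" using True rq s by (simp add: s_def)
      then have Xe: "X = 2 * e" unfolding e_def by (simp only:) simp
      have Ei: "Ec q r X i = e + of_nat i" for i unfolding Ec_def qi e_def by simp
      \<comment> \<open>Here \<open>r = - q\<close>, and for even m equation \<open>e1\<close> gives
        \<open>X\<close> the value -m. As \<open>X = 2 * e\<close>, the factor \<open>Ec\<close> at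
        m/2 would be zero, which the chain does not allow.\<close>
      have False if ev: "even m"
      proof -
        obtain l where l: "m = 2 * l" using ev by (rule evenE)
        have P1: "P = 1" using sq[of "Suc l"] by (simp add: P_def l)
        have qm: "q ^ m = 1" "inverse q ^ m = 1" using sq[of l] by (simp_all add: l power_inverse)
        have "q * (q * qn q m) = q * of_nat m" using qi[of m] qm by simp
        then have "qn q m = q * of_nat m" using True by (simp add: mult.assoc[symmetric])
        then have qr: "qn q m * inverse r = - of_nat m" using True rq s by (simp add: s_def)
        have F: "F = q * (X - 1 + of_nat m)"
          unfolding F_def Fc_def qm qr s_def[symmetric] s by simp
        have EE: "E0 = e + of_nat m" "E1 = e + of_nat (Suc m)" unfolding E0_def E1_def by (rule Ei)+
        have "- q * ((e + of_nat m + 1) * (q * (X - 1 + of_nat m))) = (e + of_nat m) - q * (q * (X - 1 + of_nat m))"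
          using e1 unfolding P1 F EE rq s by (simp add: algebra_simps)
        then have "(e + of_nat m) * (X + of_nat m) = 0" using True by Groebner_Basis.algebra
        then have "X = - of_nat m" using Cm(1) unfolding E0_def Ei by (simp add: add_eq_0_iff2)
        then have "e + of_nat l = 0" using Xe by (simp add: l)
        then show False using C[of l] unfolding Ei by (simp add: l)
      qed
      then show ?thesis using unit[OF True rr] by blast
    next
      case z: False
      define G where "G = (q - s) * F"
      have z0: "q - s \<noteq> 0" using z qs by auto
      have "P * (inverse q ^ m) = q * q" "P * q ^ m * (q * q) = P * P"
        using q by (simp_all add: P_def power_inverse)
      note Pm = this
      have "G = s * (((q - s) * X - (q - s)) * inverse q ^ m - ((q - s) * qn q m) * \<rho>)"
        unfolding G_def F_def Fc_def s_def \<rho>_def by (simp add: algebra_simps)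
      also have "\<dots> = s * (r * inverse q ^ m - q ^ m * \<rho>)"
        unfolding s_def zX qn_closed[OF q(1)] \<rho>_def by (simp add: algebra_simps)
      finally have Ge: "G = s * (r * inverse q ^ m - q ^ m * \<rho>)" .
      have "G * P * r = s * (r * r * (P * inverse q ^ m) - P * q ^ m * (r * \<rho>))" unfolding Ge by (simp only: algebra_simps)
      then have G: "G * P * r = s * (r * r * (q * q) - P * P * (s * s))"
      proof -
        have "P * P * (s * s) = P * y" if "P * y * (q * q) = P * P" for y
          using that qs(1) by Groebner_Basis.algebra
        note y = this[OF Pm(2)]
        show ?thesis unfolding y using \<open>G * P * r = _\<close> unfolding qs Pm(1) by (simp only: mult_1_right)
      qed
      have q2m: "q ^ Suc (2 * m) = P * P * s * s * s" "q ^ Suc (2 * Suc m) = P * P * s"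
      proof -
        have "q * (y * y) = (q * (q * y)) * (q * (q * y)) * s * s * s" 
          "q * (q * y * (q * y)) = (q * (q * y)) * (q * (q * y)) * s" for y
          using qs(1) by Groebner_Basis.algebra+
        then show "q ^ Suc (2 * m) = P * P * s * s * s" "q ^ Suc (2 * Suc m) = P * P * s"
          unfolding P_def mult_2 power_add power_Suc .
      qed
      have E0: "(q - s) * E0 = r + P * P * s * s * s" and E1: "(q - s) * E1 = r + P * P * s"
        using Ec_closed(2)[OF q False zX, of m] Ec_closed(2)[OF q False zX, of "Suc m"]
        unfolding E0_def E1_def s_def[symmetric] q2m .
      have h1: "r * (r + P * P * s) * G = (q - s) * P * (r + P * P * s * s * s) - (q - s) * (P * P * s * G)"
      proof -
        have "r * (r + P * P * s) * G = (q - s) * ((q - s) * (r * (E1 * F)))" unfolding E1[symmetric] G_def by (simp only: mult_ac)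
        also have "\<dots> = (q - s) * P * ((q - s) * E0) - (q - s) * (P * P * s * G)"
          unfolding e1 G_def by (simp only: algebra_simps)
        finally show ?thesis unfolding E0 .
      qed
      have nz: "P \<noteq> 0" "s \<noteq> 0" using q by (simp_all add: P_def s_def)
      have fac: "(r * r - P * P * s * s) * (q * r * r + P * P * r + P * P * (q * q - 1) * s * s * s) = 0"
      proof -
        have "r * (r + P * P * s) * (G * P * r) = (q - s) * P * (r + P * P * s * s * s) * (P * r) - (q - s) * (P * P * s * (G * P * r))"
          using h1 by Groebner_Basis.algebra
        then show ?thesis unfolding G using qs(1) by Groebner_Basis.algebra
      qed
      have "r * r = P * P * s * s"
      proof (rule ccontr)
        assume ne: "r * r \<noteq> P * P * s * s"
        then have W: "q * r * r + P * P * r + P * P * (q * q - 1) * s * s * s = 0" using fac by simp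
        define w D where "w = P * P" and "D = q * q * q * r + q * q - 1"
        have W': "q * q * q * q * r * r + w * D = 0" using W qs(1) unfolding w_def D_def by Groebner_Basis.algebra
        have W2: "q * q * q * r * (q * r + w) = - (w * (q * q - 1))" using W qs(1) unfolding w_def by Groebner_Basis.algebra
        have "(q - s) * qn q (Suc (Suc m)) * P = P * P - 1"
        proof -
          have "inverse q ^ Suc (Suc m) * P = 1" unfolding P_def power_mult_distrib[symmetric] using q by simp
          then show ?thesis unfolding s_def qn_closed[OF q(1)] P_def[symmetric] by (simp only: left_diff_distrib)
        qed
        then have qN: "P * ((q - s) * qn q (Suc (Suc m))) = w - 1" by (simp add: w_def mult_ac)
        have "(P * ((q - s) * qn q (Suc (Suc m)))) * ((q - s) * E0) * (q - s) * r * r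
           = ((q - s) * X) * ((q - s) * E1) * (G * P * r) * r"
          using arg_cong[OF e2, of "\<lambda>f. f * ((q - s) * (q - s) * (q - s) * P * r * r)"] unfolding G_def by (simp only: mult_ac)
        then have Q: "(w - 1) * (r + w * s * s * s) * (q - s) * r * r 
           = (q - s + r - \<rho>) * (r + w * s) * (s * (r * r * (q * q) - w * (s * s))) * r"
          unfolding qN E0 E1 G unfolding s_def zX \<rho>_def w_def .
        have Q': "q * (w - 1) * (r * q * q * q + w) * (q * q - 1) * r * r 
          = ((q * q - 1) * r + q * r * r - q) * (r * q + w) * (r * r * q * q * q * q - w)"
          using Q qs by Groebner_Basis.algebra
        have "(q * q - 1) * (q * q * q * q * r * r * r * (w - 1) * (r * q * q * q + w))
          = (q * q - 1) * (- (q * q * r - r + q * r * r - q) * w * (r * r * q * q * q * q - w))"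
          using Q' W2 by Groebner_Basis.algebra
        then have H: "q * q * q * q * r * r * r * (w - 1) * (r * q * q * q + w)
          = - (q * q * r - r + q * r * r - q) * w * (r * r * q * q * q * q - w)" using z by simp
        \<comment> \<open>\<open>W'\<close> is linear in \<open>w\<close> with coefficient
          \<open>D\<close>. Multiplying \<open>H\<close> by the square of \<open>D\<close> therefore
          eliminates \<open>w\<close> and leaves a polynomial in \<open>q\<close> and
          \<open>r\<close> that factors.\<close>
        have d1: "(w - 1) * D = - (q * q * q * q * r * r + D)" using W' by Groebner_Basis.algebra
        have d2: "(r * q * q * q + w) * D = r * q * q * q * (q * q - 1) * (r * q + 1)"
          using W' unfolding D_def by Groebner_Basis.algebra
        have d3: "(r * r * q * q * q * q - w) * D = q * q * q * q * q * q * r * r * (q * r + 1)"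
          using W' unfolding D_def by Groebner_Basis.algebra
        have d4: "w * D = - (q * q * q * q * r * r)" using W' by Groebner_Basis.algebra
        have "q * q * q * q * r * r * r * ((w - 1) * D) * ((r * q * q * q + w) * D)
          = - (q * q * r - r + q * r * r - q) * (w * D) * ((r * r * q * q * q * q - w) * D)"
          using H by Groebner_Basis.algebra
        then have "q * q * q * q * q * q * q * r * r * r * r * ((q * r + 1) * ((q * q * q * r - 1) * (q * q * q * r + 2 * q * q - 1))) = 0"
          unfolding d1 d2 d3 d4 unfolding D_def by Groebner_Basis.algebra
        then have "q * r + 1 = 0 \<or> q * q * q * r - 1 = 0 \<or> q * q * q * r + 2 * q * q - 1 = 0"
          using q unfolding mult_eq_0_iff by blast
        \<comment> \<open>The first factor makes a q-integer of the chain vanish, the second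
          contradicts \<open>S\<close>, and the third leads back to the value of r^2 that was
          assumed not to hold.\<close>
        then consider "q * r + 1 = 0" | "q * q * q * r - 1 = 0" | "q * q * q * r + 2 * q * q - 1 = 0" by blast
        then show False
        proof cases
          case 1
          have "w = q * q" using W' 1 unfolding D_def by Groebner_Basis.algebra
          then have "(P * s) * (P * s) = 1" unfolding w_def using qs(1) by Groebner_Basis.algebra
          moreover have "P * s = q ^ Suc m" using q by (simp add: P_def s_def)
          ultimately have "q ^ Suc m * q ^ Suc m = 1" by simp
          then have "inverse q ^ Suc m = q ^ Suc m" by (metis inverse_unique power_inverse)
          then have "(q - inverse q) * qn q (Suc m) = 0" unfolding qn_closed[OF q(1)] by simp
          then show False using z0 qn0[of m] by (simp add: s_def)
        next
          case 2
          have "(q - s) * (X * (s * X + r) - (s + \<rho>)) * (q - s) = 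
             ((q - s) * X) * (s * ((q - s) * X) + r * (q - s)) - (s + \<rho>) * (q - s) * (q - s)" by (simp only: algebra_simps)
          also have "\<dots> = 0" unfolding s_def zX unfolding s_def[symmetric] \<rho>_def[symmetric]
            using 2 qs by Groebner_Basis.algebra
          finally show False using S z0 by (simp add: s_def \<rho>_def)
        next
          case 3
          have "w = q * q * r * r"
          proof -
            have "D = - (q * q)" using 3 unfolding D_def by Groebner_Basis.algebra
            then have "q * q * (w - q * q * r * r) = 0" using W' by Groebner_Basis.algebra
            then show ?thesis using q by simp
          qed
          then have "r * r = P * P * s * s" unfolding w_def using qs(1) by Groebner_Basis.algebra
          then show False using ne by simp
        qed
      qed
      then have "r * r = (P * s) * (P * s)" by (simp only: mult_ac)
      moreover have Ps: "P * s = q ^ Suc m" using q by (simp add: P_def s_def)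
      ultimately have "r = q ^ Suc m \<or> r = - (q ^ Suc m)" unfolding square_eq_iff Ps by simp
      \<comment> \<open>For m = 2l this sign gives r + q^(2l+1) = 0, that is, \<open>Ec\<close>
        vanishes at l.\<close>
      moreover have False if rP: "r = - (q ^ Suc m)" and ev: "even m"
      proof -
        obtain l where l: "m = 2 * l" using ev by (rule evenE)
        have "(q - s) * Ec q r X l = 0" using Ec_closed(2)[OF q False zX, of l] rP unfolding l s_def by simp
        then show False using z0 C[of l] by (simp add: l)
      qed
      ultimately show ?thesis by auto
    qed
  qed
qed

section \<open>Consistency of the Kauffman relation with cups and caps\<close>

context skein
begin

lemma kauffman_cup: assumes "ident C \<I> \<noteq> zero_mor C \<I> \<I>" "x \<noteq> 0" shows "inverse r = r + z + \<kappa> * x"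
proof -
  have "inverse r \<odot> cup = t \<cdot> cup" by (rule t_cup[symmetric])
  also have "\<dots> = (r + z + \<kappa> * x) \<odot> cup"
    by (subst kauffman, rule mor_eqI) (auto simp: cmp_pl cmp_sc cmp_assoc ti_cup cap_cup algebra_simps)
  finally have "cap \<cdot> (inverse r \<odot> cup) = cap \<cdot> ((r + z + \<kappa> * x) \<odot> cup)" by simp
  then have "(inverse r * x) \<odot> ident C \<I> = ((r + z + \<kappa> * x) * x) \<odot> ident C \<I>" by (simp add: cmp_sc cap_cup)
  from sc_cancel[OF _ _ this] have "inverse r * x = (r + z + \<kappa> * x) * x" using assms(1) arr_simps(1-3)[of \<I>] by metis
  then show ?thesis using assms(2) by simp
qed

text \<open>Two evaluations of the crossing next to a cup force the coefficient of the Kauffman relation.\<close>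

lemma kappa_eq:
  assumes st: "step X S j p" and p: "p \<cdot> cup = zero_mor C \<I> S" and nz: "ident C S \<noteq> zero_mor C S S"
  shows "\<kappa> = - (g * z)"
proof -
  note S = stepD[OF st] step_arr[OF st]
  define v1 v2 where "v1 = wh \<I> cup X" and "v2 = wh X cup \<I>"
  have v: "arr v1" "dm v1 = X" "cd v1 = X \<otimes>\<^sub>o (X \<otimes>\<^sub>o X)" "arr v2" "dm v2 = X" "cd v2 = X \<otimes>\<^sub>o (X \<otimes>\<^sub>o X)"
    by (simp_all add: v1_def v2_def)
  have k1: "wh \<I> t X = wh \<I> ti X \<boxplus> z \<odot> ident C (X \<otimes>\<^sub>o (X \<otimes>\<^sub>o X)) \<boxplus> \<kappa> \<odot> (wh \<I> cup X \<cdot> wh \<I> cap X)"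
    by (subst kauffman) (simp add: wh_pl wh_sc wh_cmp)
  have k2: "wh X ti \<I> = wh X t \<I> \<boxplus> (- z) \<odot> ident C (X \<otimes>\<^sub>o (X \<otimes>\<^sub>o X)) \<boxplus> (- \<kappa>) \<odot> (wh X cup \<I> \<cdot> wh X cap \<I>)"
    by (subst ti_eq) (simp add: wh_pl wh_sc wh_cmp)
  have "wh \<I> t X \<cdot> v2 = wh \<I> ti X \<cdot> v2 \<boxplus> z \<odot> v2 \<boxplus> \<kappa> \<odot> v1"
    unfolding k1 using v zigzag by (simp add: cmp_pl cmp_sc cmp_assoc) (simp add: v1_def v2_def zigzag)
  moreover have "wh \<I> t X \<cdot> v2 = g \<odot> (wh X ti \<I> \<cdot> v1)" unfolding v1_def v2_def by (rule slide_ti(2))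
  moreover have "wh X ti \<I> \<cdot> v1 = wh X t \<I> \<cdot> v1 \<boxplus> (- z) \<odot> v1 \<boxplus> (- \<kappa>) \<odot> v2"
    unfolding k2 using v zigzag by (simp add: cmp_pl cmp_sc cmp_assoc) (simp add: v1_def v2_def zigzag)
  moreover have "wh X t \<I> \<cdot> v1 = g \<odot> (wh \<I> ti X \<cdot> v2)" unfolding v1_def v2_def by (rule slide_ti(1))
  ultimately have e: "wh \<I> ti X \<cdot> v2 \<boxplus> z \<odot> v2 \<boxplus> \<kappa> \<odot> v1
     = g \<odot> (g \<odot> (wh \<I> ti X \<cdot> v2) \<boxplus> (- z) \<odot> v1 \<boxplus> (- \<kappa>) \<odot> v2)" by simp
  have e': "(z + g * \<kappa>) \<odot> v2 \<boxplus> (\<kappa> + g * z) \<odot> v1 = zero_mor C X (X \<otimes>\<^sub>o (X \<otimes>\<^sub>o X))"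
  proof (rule mor_eqI)
    fix \<phi> assume "lf (dm (zero_mor C X (X \<otimes>\<^sub>o (X \<otimes>\<^sub>o X)))) (cd (zero_mor C X (X \<otimes>\<^sub>o (X \<otimes>\<^sub>o X)))) \<phi>"
    then have l: "lf X (X \<otimes>\<^sub>o (X \<otimes>\<^sub>o X)) \<phi>" by simp
    have "\<phi> (wh \<I> ti X \<cdot> v2) + z * \<phi> v2 + \<kappa> * \<phi> v1 = g * (g * \<phi> (wh \<I> ti X \<cdot> v2) + (- z) * \<phi> v1 + (- \<kappa>) * \<phi> v2)"
      using arg_cong[OF e, of \<phi>] l v by simp
    also have "\<dots> = (g * g) * \<phi> (wh \<I> ti X \<cdot> v2) - g * z * \<phi> v1 - g * \<kappa> * \<phi> v2" by (simp add: algebra_simps)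
    finally show "\<phi> ((z + g * \<kappa>) \<odot> v2 \<boxplus> (\<kappa> + g * z) \<odot> v1) = \<phi> (zero_mor C X (X \<otimes>\<^sub>o (X \<otimes>\<^sub>o X)))"
      using l v g2 by (simp add: algebra_simps)
  qed (use v in auto)
  have p1: "wh \<I> p X \<cdot> v1 = zero_mor C X (S \<otimes>\<^sub>o X)" "wh \<I> p X \<cdot> v2 = cu X p"
    using arg_cong[OF p, of "\<lambda>f. wh \<I> f X"] S by (simp_all add: v1_def v2_def cu_def wh_cmp)
  have "(z + g * \<kappa>) \<odot> cu X p = zero_mor C X (S \<otimes>\<^sub>o X)"
    using arg_cong[OF e', of "\<lambda>f. wh \<I> p X \<cdot> f"] S v p1 by (simp add: cmp_pl cmp_sc)
  then have "z + g * \<kappa> = 0" using sc_eq_zero[of "cu X p" "z + g * \<kappa>"] S cu_nz[OF st nz] by simp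
  then have "g * (z + g * \<kappa>) = 0" by simp
  then have "g * z + (g * g) * \<kappa> = 0" by (simp add: algebra_simps)
  then show ?thesis unfolding g2 by (simp add: add_eq_0_iff)
qed

end

section \<open>Categories with vector fusion rules\<close>

text \<open>The empty diagram is represented by the unit object itself and the inclusion at
  \<open>{}\<close> is an identity, so at the first box \<open>bm\<close>, \<open>cu\<close> and
  \<open>ca\<close> are literally \<open>t\<close>, \<open>cup\<close> and \<open>cap\<close>. All
  decompositions of the \<open>W \<nu> \<otimes> X\<close> are fixed once, which makes eigenvalues
  functions of diagrams.\<close>

locale fusion_skein = rigid_semisimple_braided_cat C + skein C X t ti cup cap r q g x \<kappa>
  for C :: "('o, 'm) tensor_cat" (structure) and X t ti cup cap r q g x \<kappa> +
  fixes L :: "diagram set" and W :: "diagram \<Rightarrow> 'o" and inc pro :: "diagram \<Rightarrow> diagram \<Rightarrow> 'm"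
  assumes young_L: "\<nu> \<in> L \<Longrightarrow> young \<nu>"
    and W_simple: "\<nu> \<in> L \<Longrightarrow> simple_ob C (W \<nu>)"
    and W_inj: "\<nu> \<in> L \<Longrightarrow> \<mu> \<in> L \<Longrightarrow> isomorphic C (W \<nu>) (W \<mu>) \<Longrightarrow> \<nu> = \<mu>"
    and W_empty: "W {} = \<I>" and W_box: "W (column_diagram 1) = X"
    and L_small: "{} \<in> L" "column_diagram 1 \<in> L" "row_diagram 2 \<in> L" "column_diagram 2 \<in> L"
    and fusion: "\<nu> \<in> L \<Longrightarrow> dsum (W \<nu> \<otimes>\<^sub>o X) {\<mu> \<in> L. differ_by_box \<nu> \<mu>} W (inc \<nu>) (pro \<nu>)"
    and base: "inc {} (column_diagram 1) = ident C X" "pro {} (column_diagram 1) = ident C X"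
    and t_row: "t \<cdot> inc (column_diagram 1) (row_diagram 2) = q \<odot> inc (column_diagram 1) (row_diagram 2)"
    and t_col: "t \<cdot> inc (column_diagram 1) (column_diagram 2) = (- inverse q) \<odot> inc (column_diagram 1) (column_diagram 2)"
    and q_sep: "q \<noteq> - inverse q" and x_nz: "x \<noteq> 0"
begin

abbreviation "nb \<nu> \<equiv> {\<mu> \<in> L. differ_by_box \<nu> \<mu>}"

lemma differ_sym: "differ_by_box \<nu> \<mu> \<longleftrightarrow> differ_by_box \<mu> \<nu>"
  unfolding differ_by_box_def by blast

lemma ident_nz: "\<nu> \<in> L \<Longrightarrow> ident C (W \<nu>) \<noteq> zero_mor C (W \<nu>) (W \<nu>)"
  using simple_nz[OF W_simple] .

lemma incD:
  assumes "\<nu> \<in> L" "\<mu> \<in> L" "differ_by_box \<nu> \<mu>"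
  shows "arr (inc \<nu> \<mu>)" "dm (inc \<nu> \<mu>) = W \<mu>" "cd (inc \<nu> \<mu>) = W \<nu> \<otimes>\<^sub>o X"
    "arr (pro \<nu> \<mu>)" "dm (pro \<nu> \<mu>) = W \<nu> \<otimes>\<^sub>o X" "cd (pro \<nu> \<mu>) = W \<mu>"
    "pro \<nu> \<mu> \<cdot> inc \<nu> \<mu> = ident C (W \<mu>)" "step (W \<nu>) (W \<mu>) (inc \<nu> \<mu>) (pro \<nu> \<mu>)"
  using dsumD(2-8)[OF fusion[OF assms(1)], of \<mu>] assms by (auto simp: step_def)

lemma hom_zero: "\<lbrakk>\<nu> \<in> L; \<mu> \<in> L; \<nu> \<noteq> \<mu>; arr f; dm f = W \<nu>; cd f = W \<mu>\<rbrakk> \<Longrightarrow> f = zero_mor C (W \<nu>) (W \<mu>)"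
  using schur_zero[OF W_simple W_simple] W_inj by blast

lemma hom_in:
  assumes "\<nu> \<in> L" "\<mu> \<in> L" "arr f" "dm f = W \<mu>" "cd f = W \<nu> \<otimes>\<^sub>o X"
  shows "differ_by_box \<nu> \<mu> \<Longrightarrow> \<exists>a. f = a \<odot> inc \<nu> \<mu>" "\<not> differ_by_box \<nu> \<mu> \<Longrightarrow> f = zero_mor C (W \<mu>) (W \<nu> \<otimes>\<^sub>o X)"
proof -
  have f: "f = (if \<mu> \<in> nb \<nu> then inc \<nu> \<mu> \<cdot> (pro \<nu> \<mu> \<cdot> f) else zero_mor C (dm f) (W \<nu> \<otimes>\<^sub>o X))"
  proof (rule dsum_in_eq[OF fusion[OF assms(1)] assms(3,5)])
    fix i assume "i \<in> nb \<nu>" "i \<noteq> \<mu>"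
    then show "pro \<nu> i \<cdot> f = zero_mor C (dm f) (W i)"
      using hom_zero[of \<mu> i "pro \<nu> i \<cdot> f"] incD[OF assms(1), of i] assms by auto
  qed
  show "f = zero_mor C (W \<mu>) (W \<nu> \<otimes>\<^sub>o X)" if "\<not> differ_by_box \<nu> \<mu>" using f that assms by simp
  show "\<exists>a. f = a \<odot> inc \<nu> \<mu>" if d: "differ_by_box \<nu> \<mu>"
  proof -
    note I = incD[OF assms(1,2) d]
    obtain a where "pro \<nu> \<mu> \<cdot> f = a \<odot> ident C (W \<mu>)"
      using simple_scalar[OF W_simple[OF assms(2)], of "pro \<nu> \<mu> \<cdot> f"] I assms by auto
    then have "f = a \<odot> inc \<nu> \<mu>" using f d assms(2) I by (simp add: cmp_sc)
    then show ?thesis by blast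
  qed
qed

lemma hom_out:
  assumes "\<nu> \<in> L" "\<mu> \<in> L" "arr f" "dm f = W \<nu> \<otimes>\<^sub>o X" "cd f = W \<mu>"
  shows "differ_by_box \<nu> \<mu> \<Longrightarrow> \<exists>a. f = a \<odot> pro \<nu> \<mu>" "\<not> differ_by_box \<nu> \<mu> \<Longrightarrow> f = zero_mor C (W \<nu> \<otimes>\<^sub>o X) (W \<mu>)"
proof -
  have f: "f = (if \<mu> \<in> nb \<nu> then (f \<cdot> inc \<nu> \<mu>) \<cdot> pro \<nu> \<mu> else zero_mor C (W \<nu> \<otimes>\<^sub>o X) (cd f))"
  proof (rule dsum_out_eq[OF fusion[OF assms(1)] assms(3,4)])
    fix i assume "i \<in> nb \<nu>" "i \<noteq> \<mu>"
    then show "f \<cdot> inc \<nu> i = zero_mor C (W i) (cd f)"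
      using hom_zero[of i \<mu> "f \<cdot> inc \<nu> i"] incD[OF assms(1), of i] assms by auto
  qed
  show "f = zero_mor C (W \<nu> \<otimes>\<^sub>o X) (W \<mu>)" if "\<not> differ_by_box \<nu> \<mu>" using f that assms by simp
  show "\<exists>a. f = a \<odot> pro \<nu> \<mu>" if d: "differ_by_box \<nu> \<mu>"
  proof -
    note I = incD[OF assms(1,2) d]
    obtain a where "f \<cdot> inc \<nu> \<mu> = a \<odot> ident C (W \<mu>)"
      using simple_scalar[OF W_simple[OF assms(2)], of "f \<cdot> inc \<nu> \<mu>"] I assms by auto
    then have "f = a \<odot> pro \<nu> \<mu>" using f d assms(2) I by (simp add: cmp_sc)
    then show ?thesis by blast
  qed
qed

lemma dsum_wh:
  assumes "\<nu> \<in> L" and l: "lf (W \<nu> \<otimes>\<^sub>o (X \<otimes>\<^sub>o X)) (W \<nu> \<otimes>\<^sub>o (X \<otimes>\<^sub>o X)) \<phi>"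
  shows "\<phi> (ident C (W \<nu> \<otimes>\<^sub>o (X \<otimes>\<^sub>o X))) = (\<Sum>i\<in>nb \<nu>. \<phi> (wh \<I> (inc \<nu> i) X \<cdot> wh \<I> (pro \<nu> i) X))"
proof -
  have l': "lf (W \<nu> \<otimes>\<^sub>o X) (W \<nu> \<otimes>\<^sub>o X) (\<lambda>h. \<phi> (wh \<I> h X))"
    using lf_wh[of \<I> "W \<nu> \<otimes>\<^sub>o X" X "W \<nu> \<otimes>\<^sub>o X" \<phi>] l by simp
  have "\<phi> (wh \<I> (ident C (W \<nu> \<otimes>\<^sub>o X)) X) = (\<Sum>i\<in>nb \<nu>. \<phi> (wh \<I> (inc \<nu> i \<cdot> pro \<nu> i) X))"
    using dsumD(10)[OF fusion[OF assms(1)] l'] .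
  also have "\<dots> = (\<Sum>i\<in>nb \<nu>. \<phi> (wh \<I> (inc \<nu> i) X \<cdot> wh \<I> (pro \<nu> i) X))"
    by (rule sum.cong) (use incD[OF assms(1)] in \<open>auto simp: wh_cmp\<close>)
  finally show ?thesis by simp
qed

text \<open>Resolve the identity through the neighbours of \<open>\<nu>\<close>. If only one of them
  is adjacent to \<open>\<rho>\<close>, all other terms vanish by Schur's lemma and the Hom space is
  one-dimensional.\<close>

lemma two_step_in:
  assumes L: "\<nu> \<in> L" "\<mu> \<in> L" "\<rho> \<in> L" and d: "differ_by_box \<nu> \<mu>" "differ_by_box \<mu> \<rho>"
    and uniq: "\<And>i. i \<in> L \<Longrightarrow> differ_by_box \<nu> i \<Longrightarrow> differ_by_box i \<rho> \<Longrightarrow> i = \<mu>"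
    and f: "arr f" "dm f = W \<rho>" "cd f = W \<nu> \<otimes>\<^sub>o (X \<otimes>\<^sub>o X)"
  shows "\<exists>a. f = a \<odot> (wh \<I> (inc \<nu> \<mu>) X \<cdot> inc \<mu> \<rho>)"
proof -
  note I1 = incD[OF L(1,2) d(1)] and I2 = incD[OF L(2,3) d(2)]
  obtain a where a: "wh \<I> (pro \<nu> \<mu>) X \<cdot> f = a \<odot> inc \<mu> \<rho>"
    using hom_in(1)[OF L(2,3), of "wh \<I> (pro \<nu> \<mu>) X \<cdot> f"] d I1 f by auto
  have "f = a \<odot> (wh \<I> (inc \<nu> \<mu>) X \<cdot> inc \<mu> \<rho>)"
  proof (rule mor_eqI)
    fix \<phi> assume "lf (dm (a \<odot> (wh \<I> (inc \<nu> \<mu>) X \<cdot> inc \<mu> \<rho>))) (cd (a \<odot> (wh \<I> (inc \<nu> \<mu>) X \<cdot> inc \<mu> \<rho>))) \<phi>"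
    then have l: "lf (W \<rho>) (W \<nu> \<otimes>\<^sub>o (X \<otimes>\<^sub>o X)) \<phi>" using I1 I2 by simp
    have "\<phi> f = (\<Sum>i\<in>nb \<nu>. \<phi> ((wh \<I> (inc \<nu> i) X \<cdot> wh \<I> (pro \<nu> i) X) \<cdot> f))"
      using dsum_wh[OF L(1), of "\<lambda>h. \<phi> (h \<cdot> f)"] lf_precomp[OF l f(1)] f by simp
    also have "\<dots> = (\<Sum>i\<in>nb \<nu>. if i = \<mu> then \<phi> (wh \<I> (inc \<nu> \<mu>) X \<cdot> (a \<odot> inc \<mu> \<rho>)) else 0)"
    proof (rule sum.cong)
      fix i assume i: "i \<in> nb \<nu>"
      then have I: "arr (inc \<nu> i)" "dm (inc \<nu> i) = W i" "cd (inc \<nu> i) = W \<nu> \<otimes>\<^sub>o X"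
        "arr (pro \<nu> i)" "dm (pro \<nu> i) = W \<nu> \<otimes>\<^sub>o X" "cd (pro \<nu> i) = W i" using incD[OF L(1)] by auto
      show "\<phi> ((wh \<I> (inc \<nu> i) X \<cdot> wh \<I> (pro \<nu> i) X) \<cdot> f)
         = (if i = \<mu> then \<phi> (wh \<I> (inc \<nu> \<mu>) X \<cdot> (a \<odot> inc \<mu> \<rho>)) else 0)"
      proof (cases "i = \<mu>")
        case True
        then show ?thesis using I f a by (simp add: cmp_assoc)
      next
        case False
        then have "wh \<I> (pro \<nu> i) X \<cdot> f = zero_mor C (W \<rho>) (W i \<otimes>\<^sub>o X)"
          using hom_in(2)[of i \<rho> "wh \<I> (pro \<nu> i) X \<cdot> f"] uniq[of i] i L I f by auto
        then show ?thesis using False I f l by (simp add: cmp_assoc)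
      qed
    qed simp
    also have "\<dots> = \<phi> (a \<odot> (wh \<I> (inc \<nu> \<mu>) X \<cdot> inc \<mu> \<rho>))"
      using dsumD(1)[OF fusion[OF L(1)]] L d I1 I2 by (simp add: cmp_sc)
    finally show "\<phi> f = \<phi> (a \<odot> (wh \<I> (inc \<nu> \<mu>) X \<cdot> inc \<mu> \<rho>))" .
  qed (use I1 I2 f in auto)
  then show ?thesis by blast
qed

lemma two_step_out:
  assumes L: "\<nu> \<in> L" "\<mu> \<in> L" "\<rho> \<in> L" and d: "differ_by_box \<nu> \<mu>" "differ_by_box \<mu> \<rho>"
    and uniq: "\<And>i. i \<in> L \<Longrightarrow> differ_by_box \<nu> i \<Longrightarrow> differ_by_box i \<rho> \<Longrightarrow> i = \<mu>"
    and f: "arr f" "dm f = W \<nu> \<otimes>\<^sub>o (X \<otimes>\<^sub>o X)" "cd f = W \<rho>"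
  shows "\<exists>a. f = a \<odot> (pro \<mu> \<rho> \<cdot> wh \<I> (pro \<nu> \<mu>) X)"
proof -
  note I1 = incD[OF L(1,2) d(1)] and I2 = incD[OF L(2,3) d(2)]
  obtain a where a: "f \<cdot> wh \<I> (inc \<nu> \<mu>) X = a \<odot> pro \<mu> \<rho>"
    using hom_out(1)[OF L(2,3), of "f \<cdot> wh \<I> (inc \<nu> \<mu>) X"] d I1 f by auto
  have "f = a \<odot> (pro \<mu> \<rho> \<cdot> wh \<I> (pro \<nu> \<mu>) X)"
  proof (rule mor_eqI)
    fix \<phi> assume "lf (dm (a \<odot> (pro \<mu> \<rho> \<cdot> wh \<I> (pro \<nu> \<mu>) X))) (cd (a \<odot> (pro \<mu> \<rho> \<cdot> wh \<I> (pro \<nu> \<mu>) X))) \<phi>"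
    then have l: "lf (W \<nu> \<otimes>\<^sub>o (X \<otimes>\<^sub>o X)) (W \<rho>) \<phi>" using I1 I2 by simp
    have "\<phi> f = (\<Sum>i\<in>nb \<nu>. \<phi> (f \<cdot> (wh \<I> (inc \<nu> i) X \<cdot> wh \<I> (pro \<nu> i) X)))"
      using dsum_wh[OF L(1), of "\<lambda>h. \<phi> (f \<cdot> h)"] lf_postcomp[OF l f(1)] f by simp
    also have "\<dots> = (\<Sum>i\<in>nb \<nu>. if i = \<mu> then \<phi> ((a \<odot> pro \<mu> \<rho>) \<cdot> wh \<I> (pro \<nu> \<mu>) X) else 0)"
    proof (rule sum.cong)
      fix i assume i: "i \<in> nb \<nu>"
      then have I: "arr (inc \<nu> i)" "dm (inc \<nu> i) = W i" "cd (inc \<nu> i) = W \<nu> \<otimes>\<^sub>o X"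
        "arr (pro \<nu> i)" "dm (pro \<nu> i) = W \<nu> \<otimes>\<^sub>o X" "cd (pro \<nu> i) = W i" using incD[OF L(1)] by auto
      have e: "f \<cdot> (wh \<I> (inc \<nu> i) X \<cdot> wh \<I> (pro \<nu> i) X) = (f \<cdot> wh \<I> (inc \<nu> i) X) \<cdot> wh \<I> (pro \<nu> i) X"
        using I f by (simp add: cmp_assoc)
      show "\<phi> (f \<cdot> (wh \<I> (inc \<nu> i) X \<cdot> wh \<I> (pro \<nu> i) X))
         = (if i = \<mu> then \<phi> ((a \<odot> pro \<mu> \<rho>) \<cdot> wh \<I> (pro \<nu> \<mu>) X) else 0)"
      proof (cases "i = \<mu>")
        case True
        then show ?thesis unfolding e using a by simp
      next
        case False
        then have "f \<cdot> wh \<I> (inc \<nu> i) X = zero_mor C (W i \<otimes>\<^sub>o X) (W \<rho>)"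
          using hom_out(2)[of i \<rho> "f \<cdot> wh \<I> (inc \<nu> i) X"] uniq[of i] i L I f by auto
        then show ?thesis unfolding e using False I f l by simp
      qed
    qed simp
    also have "\<dots> = \<phi> (a \<odot> (pro \<mu> \<rho> \<cdot> wh \<I> (pro \<nu> \<mu>) X))"
      using dsumD(1)[OF fusion[OF L(1)]] L d I1 I2 by (simp add: cmp_sc)
    finally show "\<phi> f = \<phi> (a \<odot> (pro \<mu> \<rho> \<cdot> wh \<I> (pro \<nu> \<mu>) X))" .
  qed (use I1 I2 f in auto)
  then show ?thesis by blast
qed

text \<open>\<open>dl \<nu> \<mu>\<close> is the ratio of the dimensions of \<open>W \<mu>\<close> and \<open>W \<nu>\<close>; \<open>bb\<close> and \<open>aa\<close> are the eigenvalues of the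
  crossing \<open>bm\<close> on the summands of \<open>W \<mu> \<otimes> X\<close> isomorphic to \<open>W \<nu>\<close> and to \<open>W i\<close>.\<close>

definition dl where "dl \<nu> \<mu> = (SOME a. ca (W \<nu>) (inc \<nu> \<mu>) \<cdot> cu (W \<nu>) (pro \<nu> \<mu>) = a \<odot> ident C (W \<nu>))"
definition bb where "bb \<nu> \<mu> = (SOME a. bm (W \<nu>) (inc \<nu> \<mu>) (pro \<nu> \<mu>) \<cdot> cu (W \<nu>) (pro \<nu> \<mu>) = a \<odot> cu (W \<nu>) (pro \<nu> \<mu>))"
definition aa where "aa \<nu> \<mu> i = (SOME a. bm (W \<nu>) (inc \<nu> \<mu>) (pro \<nu> \<mu>) \<cdot> inc \<mu> i = a \<odot> inc \<mu> i)"

text \<open>Freeness from multiplicities does the work. \<open>cu\<close> and \<open>ca\<close> are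
  multiples of \<open>inc \<mu> \<nu>\<close> and \<open>pro \<mu> \<nu>\<close>, nonzero because
  bending can be undone, whence \<open>dl\<close> is nonzero; and \<open>bm\<close> maps each
  summand to itself by a scalar.\<close>

lemma node_at:
  assumes L: "\<nu> \<in> L" "\<mu> \<in> L" and d: "differ_by_box \<nu> \<mu>"
  shows "node (W \<nu>) (W \<mu>) (inc \<nu> \<mu>) (pro \<nu> \<mu>) (nb \<mu> - {\<nu>}) W (inc \<mu>) (pro \<mu>) (aa \<nu> \<mu>) (bb \<nu> \<mu>) (dl \<nu> \<mu>)"
proof -
  note I = incD[OF L d] and d' = d[unfolded differ_sym[of \<nu> \<mu>]]
  note st = I(8)
  note S = stepD[OF st] step_arr[OF st] and I' = incD[OF L(2,1) d']
  let ?j = "inc \<nu> \<mu>" and ?p = "pro \<nu> \<mu>"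
  let ?cu = "cu (W \<nu>) ?p" and ?ca = "ca (W \<nu>) ?j" and ?B = "bm (W \<nu>) ?j ?p"
  obtain c1 where c1: "?cu = c1 \<odot> inc \<mu> \<nu>" using hom_in(1)[OF L(2,1), of ?cu] S d' by auto
  obtain c2 where c2: "?ca = c2 \<odot> pro \<mu> \<nu>" using hom_out(1)[OF L(2,1), of ?ca] S d' by auto
  have c1n: "c1 \<noteq> 0"
  proof
    assume "c1 = 0"
    then have "?cu = zero_mor C (W \<nu>) (W \<mu> \<otimes>\<^sub>o X)" using c1 I' sc_zero by simp
    then show False using cu_nz[OF st] ident_nz[OF L(2)] by simp
  qed
  have c2n: "c2 \<noteq> 0"
  proof
    assume "c2 = 0"
    then have "?ca = zero_mor C (W \<mu> \<otimes>\<^sub>o X) (W \<nu>)" using c2 I' sc_zero by simp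
    then show False using ca_nz[OF st] ident_nz[OF L(2)] by simp
  qed
  have dl: "?ca \<cdot> ?cu = dl \<nu> \<mu> \<odot> ident C (W \<nu>)"
    unfolding dl_def by (rule someI[of _ "c2 * c1"]) (use c1 c2 I' in \<open>simp add: cmp_sc mult.commute\<close>)
  have "?ca \<cdot> ?cu = (c2 * c1) \<odot> ident C (W \<nu>)" using c1 c2 I' by (simp add: cmp_sc mult.commute)
  then have dlv: "dl \<nu> \<mu> = c2 * c1" using dl scalar_cancel[OF W_simple[OF L(1)]] by simp
  obtain b where b: "?B \<cdot> inc \<mu> \<nu> = b \<odot> inc \<mu> \<nu>" using hom_in(1)[OF L(2,1), of "?B \<cdot> inc \<mu> \<nu>"] S I' d' by auto
  have bb: "?B \<cdot> ?cu = bb \<nu> \<mu> \<odot> ?cu"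
    unfolding bb_def by (rule someI[of _ b]) (use c1 b I' S in \<open>simp add: cmp_sc mult.commute\<close>)
  have aa: "?B \<cdot> inc \<mu> i = aa \<nu> \<mu> i \<odot> inc \<mu> i" if i: "i \<in> nb \<mu>" for i
  proof -
    have iL: "i \<in> L" "differ_by_box \<mu> i" using i by auto
    obtain a where "?B \<cdot> inc \<mu> i = a \<odot> inc \<mu> i"
      using hom_in(1)[OF L(2) iL(1), of "?B \<cdot> inc \<mu> i"] iL S incD[OF L(2) iL] by auto
    then show ?thesis unfolding aa_def by (rule someI)
  qed
  have fin: "finite (nb \<mu>)" using dsumD(1)[OF fusion[OF L(2)]] .
  have \<nu>: "\<nu> \<in> nb \<mu>" using L d' by simp
  show ?thesis unfolding node_def
  proof (intro conjI ballI allI impI)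
    fix \<phi> assume l: "lf (W \<mu> \<otimes>\<^sub>o X) (W \<mu> \<otimes>\<^sub>o X) \<phi>"
    have "\<phi> (?cu \<cdot> ?ca) = (c1 * c2) * \<phi> (inc \<mu> \<nu> \<cdot> pro \<mu> \<nu>)" unfolding c1 c2 using I' l by (simp add: cmp_sc)
    then have "inverse (dl \<nu> \<mu>) * \<phi> (?cu \<cdot> ?ca) = \<phi> (inc \<mu> \<nu> \<cdot> pro \<mu> \<nu>)" using c1n c2n by (simp add: dlv field_simps)
    then show "\<phi> (ident C (W \<mu> \<otimes>\<^sub>o X)) = inverse (dl \<nu> \<mu>) * \<phi> (?cu \<cdot> ?ca) + (\<Sum>i\<in>nb \<mu> - {\<nu>}. \<phi> (inc \<mu> i \<cdot> pro \<mu> i))"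
      using dsumD(10)[OF fusion[OF L(2)] l] sum.remove[OF fin \<nu>, of "\<lambda>i. \<phi> (inc \<mu> i \<cdot> pro \<mu> i)"] by simp
  next
    fix i assume i: "i \<in> nb \<mu> - {\<nu>}"
    then have iL: "i \<in> L" "differ_by_box \<mu> i" and ne: "\<nu> \<noteq> i" by blast+
    note Ii = incD[OF L(2) iL]
    show "?ca \<cdot> inc \<mu> i = zero_mor C (W i) (W \<nu>)"
      unfolding c2 using Ii I' dsumD(9)[OF fusion[OF L(2)], of i \<nu>] i \<nu> by (simp add: cmp_sc)
    show "pro \<mu> i \<cdot> ?cu = zero_mor C (W \<nu>) (W i)"
      unfolding c1 using Ii I' dsumD(9)[OF fusion[OF L(2)] \<nu>, of i] i ne by (simp add: cmp_sc)
    show "step (W \<mu>) (W i) (inc \<mu> i) (pro \<mu> i)" by (rule Ii)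
    show "?B \<cdot> inc \<mu> i = aa \<nu> \<mu> i \<odot> inc \<mu> i" using aa i by blast
    fix k assume "k \<in> nb \<mu> - {\<nu>}" "i \<noteq> k"
    then show "pro \<mu> i \<cdot> inc \<mu> k = zero_mor C (W k) (W i)" 
      using dsumD(9)[OF fusion[OF L(2)], of k i] i by auto
  qed (use st fin dl bb c1n c2n dlv in auto)
qed

lemma dl_nz: "\<nu> \<in> L \<Longrightarrow> \<mu> \<in> L \<Longrightarrow> differ_by_box \<nu> \<mu> \<Longrightarrow> dl \<nu> \<mu> \<noteq> 0"
  using nodeD(3)[OF node_at] .

lemma traces:
  assumes L: "\<nu> \<in> L" "\<mu> \<in> L" and d: "differ_by_box \<nu> \<mu>"
  shows "x = inverse (dl \<nu> \<mu>) + (\<Sum>i\<in>nb \<mu> - {\<nu>}. dl \<mu> i)"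
    "g * r = bb \<nu> \<mu> * inverse (dl \<nu> \<mu>) + (\<Sum>i\<in>nb \<mu> - {\<nu>}. aa \<nu> \<mu> i * dl \<mu> i)"
proof -
  have "ca (W \<mu>) (inc \<mu> i) \<cdot> cu (W \<mu>) (pro \<mu> i) = dl \<mu> i \<odot> ident C (W \<mu>)" if "i \<in> nb \<mu> - {\<nu>}" for i
    using nodeD(4)[OF node_at[OF L(2), of i]] that by auto
  note T = node_trace[OF node_at[OF L d] ident_nz[OF L(2)] this]
  show "x = inverse (dl \<nu> \<mu>) + (\<Sum>i\<in>nb \<mu> - {\<nu>}. dl \<mu> i)"
    "g * r = bb \<nu> \<mu> * inverse (dl \<nu> \<mu>) + (\<Sum>i\<in>nb \<mu> - {\<nu>}. aa \<nu> \<mu> i * dl \<mu> i)" using T by blast+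
qed

lemma aa_from_anti:
  assumes L: "\<nu> \<in> L" "\<mu> \<in> L" "\<rho> \<in> L" and d: "differ_by_box \<nu> \<mu>" "differ_by_box \<mu> \<rho>" and ne: "\<rho> \<noteq> \<nu>"
    and anti: "wh (W \<nu>) t \<I> \<cdot> (wh \<I> (inc \<nu> \<mu>) X \<cdot> inc \<mu> \<rho>) = \<theta> \<odot> (wh \<I> (inc \<nu> \<mu>) X \<cdot> inc \<mu> \<rho>)"
  shows "aa \<nu> \<mu> \<rho> = \<theta>"
proof -
  note I1 = incD[OF L(1,2) d(1)] and I2 = incD[OF L(2,3) d(2)]
  have "aa \<nu> \<mu> \<rho> \<odot> inc \<mu> \<rho> = bm (W \<nu>) (inc \<nu> \<mu>) (pro \<nu> \<mu>) \<cdot> inc \<mu> \<rho>"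
    using nodeD(9)[OF node_at[OF L(1,2) d(1)], of \<rho>] L d ne by simp
  also have "\<dots> = wh \<I> (pro \<nu> \<mu>) X \<cdot> (wh (W \<nu>) t \<I> \<cdot> (wh \<I> (inc \<nu> \<mu>) X \<cdot> inc \<mu> \<rho>))"
    unfolding bm_def using I1 I2 by (simp add: cmp_assoc)
  also have "\<dots> = \<theta> \<odot> inc \<mu> \<rho>"
    unfolding anti using I1 I2 reassoc[OF step_wh[OF I1(8), of X], of "inc \<mu> \<rho>"] by (simp add: cmp_sc)
  finally have "pro \<mu> \<rho> \<cdot> (aa \<nu> \<mu> \<rho> \<odot> inc \<mu> \<rho>) = pro \<mu> \<rho> \<cdot> (\<theta> \<odot> inc \<mu> \<rho>)" by simp
  then show ?thesis using I2 scalar_cancel[OF W_simple[OF L(3)]] by (simp add: cmp_sc)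
qed

text \<open>Along a path with unique intermediate diagrams the braiding acts on consecutive steps by
  the same scalar, by the braid relation.\<close>

definition anti where
  "anti \<nu> \<mu> \<rho> \<theta> \<longleftrightarrow> \<nu> \<in> L \<and> \<mu> \<in> L \<and> \<rho> \<in> L \<and> differ_by_box \<nu> \<mu> \<and> differ_by_box \<mu> \<rho> \<and>
     wh (W \<nu>) t \<I> \<cdot> (wh \<I> (inc \<nu> \<mu>) X \<cdot> inc \<mu> \<rho>) = \<theta> \<odot> (wh \<I> (inc \<nu> \<mu>) X \<cdot> inc \<mu> \<rho>) \<and>
     (pro \<mu> \<rho> \<cdot> wh \<I> (pro \<nu> \<mu>) X) \<cdot> wh (W \<nu>) t \<I> = \<theta> \<odot> (pro \<mu> \<rho> \<cdot> wh \<I> (pro \<nu> \<mu>) X)"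

text \<open>Along a unique path the crossing acts by a scalar on the inclusion and by a scalar on
  the projection. Sandwiching it between the two shows that the scalars coincide.\<close>

lemma anti_exists:
  assumes L: "\<nu> \<in> L" "\<mu> \<in> L" "\<rho> \<in> L" and d: "differ_by_box \<nu> \<mu>" "differ_by_box \<mu> \<rho>"
    and uniq: "\<And>i. i \<in> L \<Longrightarrow> differ_by_box \<nu> i \<Longrightarrow> differ_by_box i \<rho> \<Longrightarrow> i = \<mu>"
  shows "\<exists>s. anti \<nu> \<mu> \<rho> s"
proof -
  note I1 = incD[OF L(1,2) d(1)] and I2 = incD[OF L(2,3) d(2)]
  let ?J = "wh \<I> (inc \<nu> \<mu>) X \<cdot> inc \<mu> \<rho>" and ?P = "pro \<mu> \<rho> \<cdot> wh \<I> (pro \<nu> \<mu>) X"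
  have a: "arr ?J" "dm ?J = W \<rho>" "cd ?J = W \<nu> \<otimes>\<^sub>o (X \<otimes>\<^sub>o X)" "arr ?P" "cd ?P = W \<rho>" "dm ?P = W \<nu> \<otimes>\<^sub>o (X \<otimes>\<^sub>o X)"
    using I1 I2 by simp_all
  obtain s where s: "wh (W \<nu>) t \<I> \<cdot> ?J = s \<odot> ?J"
    using two_step_in[OF L d uniq, of "wh (W \<nu>) t \<I> \<cdot> ?J"] a by auto
  obtain s' where s': "?P \<cdot> wh (W \<nu>) t \<I> = s' \<odot> ?P"
    using two_step_out[OF L d uniq, of "?P \<cdot> wh (W \<nu>) t \<I>"] a by auto
  have PJ: "?P \<cdot> ?J = ident C (W \<rho>)"
    using I1 I2 reassoc[OF step_wh[OF I1(8), of X], of "inc \<mu> \<rho>"] by (simp add: cmp_assoc)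
  have "(?P \<cdot> wh (W \<nu>) t \<I>) \<cdot> ?J = ?P \<cdot> (wh (W \<nu>) t \<I> \<cdot> ?J)" by (rule cmp_assoc) (use a in auto)
  then have "s' \<odot> ident C (W \<rho>) = s \<odot> ident C (W \<rho>)"
    unfolding s s' cmp_sc(1)[OF a(1,4) a(6)[unfolded a(3)[symmetric]]] cmp_sc(2)[OF a(4,1) a(6)[unfolded a(3)[symmetric]]] PJ .
  then have "s' = s" by (rule scalar_cancel[OF W_simple[OF L(3)]])
  then show ?thesis unfolding anti_def using L d s s' by blast
qed

lemma anti_step:
  assumes a: "anti \<nu> \<mu> \<rho> \<theta>" and L: "\<sigma> \<in> L" and d: "differ_by_box \<rho> \<sigma>" and \<theta>: "\<theta> \<noteq> 0"
    and uniq: "\<And>i. i \<in> L \<Longrightarrow> differ_by_box \<mu> i \<Longrightarrow> differ_by_box i \<sigma> \<Longrightarrow> i = \<rho>"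
  shows "anti \<mu> \<rho> \<sigma> \<theta>"
proof -
  have A: "\<nu> \<in> L" "\<mu> \<in> L" "\<rho> \<in> L" "differ_by_box \<nu> \<mu>" "differ_by_box \<mu> \<rho>"
    "wh (W \<nu>) t \<I> \<cdot> (wh \<I> (inc \<nu> \<mu>) X \<cdot> inc \<mu> \<rho>) = \<theta> \<odot> (wh \<I> (inc \<nu> \<mu>) X \<cdot> inc \<mu> \<rho>)"
    using a unfolding anti_def by blast+
  obtain s where s: "anti \<mu> \<rho> \<sigma> s" using anti_exists[OF A(2,3) L A(5) d uniq] by blast
  have "s = \<theta>"
    by (rule anti_next[OF incD(8)[OF A(1,2,4)] incD(8)[OF A(2,3,5)] incD(8)[OF A(3) L d] A(6) \<theta> _ ident_nz[OF L]])
      (use s in \<open>simp add: anti_def\<close>)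
  then show ?thesis using s by simp
qed

lemma bb_next:
  assumes a: "anti \<nu> \<mu> \<rho> \<theta>" and ne: "\<rho> \<noteq> \<nu>" and \<theta>: "\<theta> \<noteq> 0"
    and ex: "\<alpha> + \<beta> * aa \<nu> \<mu> \<rho> = n" "\<And>i. i \<in> nb \<mu> \<Longrightarrow> i \<noteq> \<nu> \<Longrightarrow> i \<noteq> \<rho> \<Longrightarrow> \<alpha> + \<beta> * aa \<nu> \<mu> i = 0"
      "\<alpha> + \<beta> * bb \<nu> \<mu> + \<gamma> * dl \<nu> \<mu> = 0"
  shows "n * bb \<mu> \<rho> = \<alpha> * inverse r + \<gamma> * g * inverse \<theta>"
    and "n \<odot> (inc \<mu> \<rho> \<cdot> pro \<mu> \<rho>) = \<alpha> \<odot> ident C (W \<mu> \<otimes>\<^sub>o X) \<boxplus> \<beta> \<odot> bm (W \<nu>) (inc \<nu> \<mu>) (pro \<nu> \<mu>)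
        \<boxplus> \<gamma> \<odot> (cu (W \<nu>) (pro \<nu> \<mu>) \<cdot> ca (W \<nu>) (inc \<nu> \<mu>))"
proof -
  have A: "\<nu> \<in> L" "\<mu> \<in> L" "\<rho> \<in> L" "differ_by_box \<nu> \<mu>" "differ_by_box \<mu> \<rho>" 
     "(pro \<mu> \<rho> \<cdot> wh \<I> (pro \<nu> \<mu>) X) \<cdot> wh (W \<nu>) t \<I> = \<theta> \<odot> (pro \<mu> \<rho> \<cdot> wh \<I> (pro \<nu> \<mu>) X)" using a unfolding anti_def by blast+
  note nd = node_at[OF A(1,2,4)] and nd' = node_at[OF A(2,3,5)]
  have \<rho>: "\<rho> \<in> nb \<mu> - {\<nu>}" using A ne by simp
  show E: "n \<odot> (inc \<mu> \<rho> \<cdot> pro \<mu> \<rho>) = \<alpha> \<odot> ident C (W \<mu> \<otimes>\<^sub>o X) \<boxplus> \<beta> \<odot> bm (W \<nu>) (inc \<nu> \<mu>) (pro \<nu> \<mu>)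
        \<boxplus> \<gamma> \<odot> (cu (W \<nu>) (pro \<nu> \<mu>) \<cdot> ca (W \<nu>) (inc \<nu> \<mu>))"
    by (rule node_expand[OF nd \<rho> ex(1) _ ex(3)]) (use ex(2) in auto)
  have "n \<odot> (bm (W \<mu>) (inc \<mu> \<rho>) (pro \<mu> \<rho>) \<cdot> cu (W \<mu>) (pro \<mu> \<rho>)) = (\<alpha> * inverse r + \<gamma> * g * inverse \<theta>) \<odot> cu (W \<mu>) (pro \<mu> \<rho>)"
    by (rule bm_cu_next[OF nodeD(1)[OF nd] nodeD(1)[OF nd'] E nodeD(8)[OF nd \<rho>] A(6) \<theta>])
  then have "(n * bb \<mu> \<rho>) \<odot> cu (W \<mu>) (pro \<mu> \<rho>) = (\<alpha> * inverse r + \<gamma> * g * inverse \<theta>) \<odot> cu (W \<mu>) (pro \<mu> \<rho>)"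
    unfolding nodeD(5)[OF nd'] using step_arr[OF nodeD(1)[OF nd']] by simp
  then show "n * bb \<mu> \<rho> = \<alpha> * inverse r + \<gamma> * g * inverse \<theta>"
    using sc_cancel[of "cu (W \<mu>) (pro \<mu> \<rho>)"] step_arr[OF nodeD(1)[OF nd']] cu_nz[OF nodeD(1)[OF nd'] ident_nz[OF A(3)]] by simp
qed

end

section \<open>Hooks with one box outside the first column\<close>

text \<open>For \<open>n > 0\<close> this is the diagram [2,1^(n-1)], indexed by the length of its
  first column, so that it is a neighbour of [1^n]. \<open>hook 0\<close> is not a Young
  diagram.\<close>

definition hook :: "nat \<Rightarrow> diagram" where "hook n = insert (0, 1) (column_diagram n)"

lemma diagram_simps [simp]:
  "column_diagram 0 = {}" "(i, j) \<in> column_diagram n \<longleftrightarrow> i < n \<and> j = 0"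
  "(i, j) \<in> row_diagram n \<longleftrightarrow> i = 0 \<and> j < n"
  "(i, j) \<in> hook n \<longleftrightarrow> (i = 0 \<and> j = 1) \<or> (i < n \<and> j = 0)"
  by (auto simp: column_diagram_def row_diagram_def hook_def)

lemma column_Suc: "column_diagram (Suc n) = insert (n, 0) (column_diagram n)"
  by (auto simp: column_diagram_def)

lemma row_2: "row_diagram 2 = hook 1"
  by (auto simp: row_diagram_def hook_def column_diagram_def)

lemma row_1: "row_diagram 1 = column_diagram 1"
  by (auto simp: row_diagram_def column_diagram_def)

lemma finite_diagrams [simp]: "finite (column_diagram n)" "finite (hook n)" "finite (row_diagram n)"
  by (simp_all add: column_diagram_def row_diagram_def hook_def)

lemma card_diagrams [simp]: "card (column_diagram n) = n" "card (hook n) = Suc n" "card (row_diagram n) = n"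
  by (auto simp: column_diagram_def row_diagram_def hook_def)

lemma differ_card: 
  "differ_by_box \<nu> \<mu> \<Longrightarrow> finite \<nu> \<Longrightarrow> finite \<mu> \<Longrightarrow> card \<mu> = Suc (card \<nu>) \<or> card \<nu> = Suc (card \<mu>)"
  unfolding differ_by_box_def by auto

lemma differ_larger:
  "differ_by_box \<nu> \<mu> \<Longrightarrow> finite \<nu> \<Longrightarrow> finite \<mu> \<Longrightarrow> card \<nu> < card \<mu> \<Longrightarrow> \<nu> \<subseteq> \<mu>"
  unfolding differ_by_box_def by auto

lemma differ_column: "differ_by_box (column_diagram n) (column_diagram (Suc n))"
  unfolding differ_by_box_def column_Suc by (rule disjI1, rule exI[of _ "(n, 0)"]) simp

lemma differ_hook: "differ_by_box (column_diagram n) (hook n)"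
  unfolding differ_by_box_def hook_def by (rule disjI1, rule exI[of _ "(0, 1)"]) simp

lemma differ_hooks: "differ_by_box (hook n) (hook (Suc n))"
  unfolding differ_by_box_def hook_def column_Suc by (rule disjI1, rule exI[of _ "(n, 0)"]) auto

lemma differ_rows: "differ_by_box (row_diagram n) (row_diagram (Suc n))"
  unfolding differ_by_box_def by (rule disjI1, rule exI[of _ "(0, n)"]) (auto simp: row_diagram_def)

lemma youngD: "young \<nu> \<Longrightarrow> (i, j) \<in> \<nu> \<Longrightarrow> i' \<le> i \<Longrightarrow> j' \<le> j \<Longrightarrow> (i', j') \<in> \<nu>"
  unfolding young_def by blast

lemma column_neighbours:
  assumes y: "young \<mu>" and d: "differ_by_box (column_diagram n) \<mu>"
  shows "\<mu> = column_diagram (Suc n) \<or> (\<exists>m. n = Suc m \<and> (\<mu> = column_diagram m \<or> \<mu> = hook n))"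
  using d unfolding differ_by_box_def
proof (elim disjE exE conjE)
  fix b assume b: "b \<notin> column_diagram n" and m: "\<mu> = insert b (column_diagram n)"
  obtain i j where ij: "b = (i, j)" by (cases b)
  have mem: "(i', j') \<in> \<mu>" if "i' \<le> i" "j' \<le> j" for i' j' using youngD[OF y, of i j] that by (simp add: m ij)
  show ?thesis
  proof (cases "j = 0")
    case True
    have "i = n" using mem[of n 0] b by (auto simp: m ij True not_less)
    then show ?thesis using True by (simp add: m ij column_Suc)
  next
    case False
    have j: "j = 1" using mem[of i 1] False by (auto simp: m ij)
    have i: "i = 0" using mem[of 0 1] j by (auto simp: m ij)
    have "n \<noteq> 0" using mem[of 0 0] i j by (auto simp: m ij)
    then obtain m' where "n = Suc m'" by (cases n) auto
    then show ?thesis by (simp add: m ij i j hook_def)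
  qed
next
  fix b assume b: "b \<notin> \<mu>" and m: "column_diagram n = insert b \<mu>"
  obtain i j where ij: "b = (i, j)" by (cases b)
  have "(i, j) \<in> column_diagram n" unfolding m ij by simp
  then have j: "j = 0" "i < n" by auto
  then obtain m' where n: "n = Suc m'" by (cases n) auto
  have "i = m'"
  proof (rule ccontr)
    assume ne: "i \<noteq> m'"
    have "(m', 0) \<in> insert b \<mu>" unfolding m[symmetric] n by simp
    then have "(m', 0) \<in> \<mu>" using ne ij by auto
    then show False using youngD[OF y, of m' 0 i 0] b j n ij by auto
  qed
  then have "\<mu> = column_diagram m'" using m b unfolding n column_Suc ij j 
    by (metis Diff_insert_absorb \<open>i = m'\<close> column_Suc diagram_simps(2) ij insert_absorb j(1) less_irrefl insert_ident)
  then show ?thesis using n by blast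
qed

lemma hook_1_neighbours:
  assumes y: "young \<mu>" and d: "differ_by_box (hook 1) \<mu>"
  shows "\<mu> = column_diagram 1 \<or> \<mu> = row_diagram 3 \<or> \<mu> = hook 2"
  using d unfolding differ_by_box_def
proof (elim disjE exE conjE)
  fix b assume b: "b \<notin> hook 1" and m: "\<mu> = insert b (hook 1)"
  obtain i j where ij: "b = (i, j)" by (cases b)
  have mem: "(i', j') \<in> \<mu>" if "i' \<le> i" "j' \<le> j" for i' j' using youngD[OF y, of i j] that by (simp add: m ij)
  show ?thesis
  proof (cases "i = 0")
    case True
    then have "j \<ge> 2" using b by (cases j) (auto simp: ij numeral_2_eq_2 Suc_le_eq)
    then have "j = 2" using mem[of 0 2] by (auto simp: m ij)
    then have "\<mu> = row_diagram 3" using True by (auto simp: m ij hook_def column_diagram_def row_diagram_def)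
    then show ?thesis by simp
  next
    case False
    have i: "i = 1" using mem[of 1 0] False by (auto simp: m ij)
    have "j = 0" using mem[of 1 0] i by (auto simp: m ij)
    then have "\<mu> = hook 2" using i by (auto simp: m ij hook_def column_diagram_def)
    then show ?thesis by simp
  qed
next
  fix b assume b: "b \<notin> \<mu>" and m: "hook 1 = insert b \<mu>"
  have bb: "b = (0, 1) \<or> b = (0, 0)" using m by (auto simp: hook_def column_diagram_def)
  show ?thesis
  proof (cases "b = (0, 1)")
    case True
    have "\<mu> = hook 1 - {(0, 1)}" using m b True by simp
    then have "\<mu> = column_diagram 1" by (auto simp: hook_def column_diagram_def)
    then show ?thesis by simp
  next
    case False
    then have b0: "b = (0, 0)" using bb by simp
    have "(0, 1) \<in> insert b \<mu>" unfolding m[symmetric] by simp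
    then have "(0, 1) \<in> \<mu>" using b0 by simp
    then show ?thesis using youngD[OF y, of 0 1 0 0] b b0 by simp
  qed
qed

lemma young_diagrams [simp]: "young (column_diagram n)" "young (row_diagram n)" "0 < n \<Longrightarrow> young (hook n)"
  unfolding young_def by (auto simp: not_less)

lemma column_length_simps [simp]:
  "column_length (column_diagram n) 0 = n" "column_length (column_diagram n) (Suc j) = 0"
  "column_length (hook n) 0 = n" "column_length (hook n) (Suc 0) = 1"
  "0 < n \<Longrightarrow> column_length (row_diagram n) 0 = 1" "column_length (row_diagram n) (Suc 0) = (if n \<le> 1 then 0 else 1)"
proof -
  have "{i. i = (0::nat) \<and> P} = (if P then {0} else {})" for P by auto
  note e = this
  have "{i::nat. i < n} = {..<n}" by auto
  then show "column_length (column_diagram n) 0 = n" "column_length (column_diagram n) (Suc j) = 0"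
  "column_length (hook n) 0 = n" "column_length (hook n) (Suc 0) = 1"
  "0 < n \<Longrightarrow> column_length (row_diagram n) 0 = 1" "column_length (row_diagram n) (Suc 0) = (if n \<le> 1 then 0 else 1)"
    by (simp_all add: column_length_def e)
qed

lemma row_length_simps [simp]:
  "row_length (column_diagram n) i = (if i < n then 1 else 0)"
  "row_length (hook n) 0 = (if n = 0 then 1 else 2)" "row_length (hook n) (Suc 0) = (if 1 < n then 1 else 0)"
  "row_length (row_diagram n) 0 = n" "row_length (row_diagram n) (Suc 0) = 0"
proof -
  have "{j::nat. j = 1 \<or> 0 < n \<and> j = 0} = (if n = 0 then {1} else {0, 1})" by auto
  moreover have "{j::nat. j < n} = {..<n}" by auto
  ultimately show "row_length (column_diagram n) i = (if i < n then 1 else 0)"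
  "row_length (hook n) 0 = (if n = 0 then 1 else 2)" "row_length (hook n) (Suc 0) = (if 1 < n then 1 else 0)"
  "row_length (row_diagram n) 0 = n" "row_length (row_diagram n) (Suc 0) = 0"
    by (simp_all add: row_length_def conj_commute)
qed

section \<open>Neighbours of columns, and the values after the first two boxes\<close>

context fusion_skein
begin

abbreviation "Col \<equiv> column_diagram"

lemma small_L: "Col 0 \<in> L" "Col 1 \<in> L" "Col (Suc 0) \<in> L" "Col 2 \<in> L" "hook 1 \<in> L"
  using L_small row_2 by simp_all

lemma nb_col: "nb (Col (Suc n)) - {Col n} = {\<mu> \<in> {Col (Suc (Suc n)), hook (Suc n)}. \<mu> \<in> L}"
proof
  show "nb (Col (Suc n)) - {Col n} \<subseteq> {\<mu> \<in> {Col (Suc (Suc n)), hook (Suc n)}. \<mu> \<in> L}"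
    using column_neighbours[OF young_L, of _ "Suc n"] by auto
  have "Col (Suc (Suc n)) \<noteq> Col n" "hook (Suc n) \<noteq> Col n"
    using card_diagrams(1,2) by (metis n_not_Suc_n Suc_n_not_n less_SucI less_irrefl lessI)+
  then show "{\<mu> \<in> {Col (Suc (Suc n)), hook (Suc n)}. \<mu> \<in> L} \<subseteq> nb (Col (Suc n)) - {Col n}"
    using differ_column differ_hook by auto
qed

lemma col_neq_hook: "Col n \<noteq> hook m"
  by (metis diagram_simps(2,4) zero_neq_one)

lemma sum_nb_col: "(\<Sum>\<mu>\<in>nb (Col (Suc n)) - {Col n}. f \<mu>) = 
   (if Col (Suc (Suc n)) \<in> L then f (Col (Suc (Suc n))) else 0) + (if hook (Suc n) \<in> L then f (hook (Suc n)) else (0::complex))"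
proof -
  have "{\<mu> \<in> {Col (Suc (Suc n)), hook (Suc n)}. \<mu> \<in> L}
    = (if Col (Suc (Suc n)) \<in> L then {Col (Suc (Suc n))} else {}) \<union> (if hook (Suc n) \<in> L then {hook (Suc n)} else {})"
    by auto
  then show ?thesis unfolding nb_col using col_neq_hook[of "Suc (Suc n)" "Suc n"] by (auto simp: add.commute)
qed

lemma nb_hook1: "nb (hook 1) - {Col 1} = {\<mu> \<in> {row_diagram 3, hook 2}. \<mu> \<in> L}"
proof
  show "nb (hook 1) - {Col 1} \<subseteq> {\<mu> \<in> {row_diagram 3, hook 2}. \<mu> \<in> L}"
    using hook_1_neighbours[OF young_L] by auto
  have "differ_by_box (hook 1) (row_diagram 3)" "differ_by_box (hook 1) (hook 2)"
    using differ_rows[of 2] differ_hooks[of 1] row_2 by (simp_all add: numeral_2_eq_2 numeral_3_eq_3)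
  moreover have "row_diagram 3 \<noteq> Col 1" "hook 2 \<noteq> Col 1" using card_diagrams by (metis numeral_eq_one_iff semiring_norm(86) , metis Suc_1 n_not_Suc_n card_diagrams(1,2) numeral_2_eq_2 Suc_inject One_nat_def nat.distinct(1))
  ultimately show "{\<mu> \<in> {row_diagram 3, hook 2}. \<mu> \<in> L} \<subseteq> nb (hook 1) - {Col 1}" by auto
qed

lemma row3_neq_hook2: "row_diagram 3 \<noteq> hook 2"
proof -
  have "(0, 2) \<in> row_diagram 3" "(0, 2) \<notin> hook 2" by simp_all
  then show ?thesis by metis
qed

lemma sum_nb_hook1: "(\<Sum>\<mu>\<in>nb (hook 1) - {Col 1}. f \<mu>) = 
   (if row_diagram 3 \<in> L then f (row_diagram 3) else 0) + (if hook 2 \<in> L then f (hook 2) else (0::complex))"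
proof -
  have "{\<mu> \<in> {row_diagram 3, hook 2}. \<mu> \<in> L}
    = (if row_diagram 3 \<in> L then {row_diagram 3} else {}) \<union> (if hook 2 \<in> L then {hook 2} else {})"
    by auto
  then show ?thesis unfolding nb_hook1 using row3_neq_hook2 by auto
qed

lemma uniq_empty: "i \<in> L \<Longrightarrow> differ_by_box (Col 0) i \<Longrightarrow> i = Col 1"
  using column_neighbours[OF young_L, of i 0] by auto

text \<open>Counting boxes places \<open>i\<close> between the two columns, so it cannot contain a
  box outside the first column.\<close>

lemma uniq_col: 
  assumes "i \<in> L" "differ_by_box (Col n) i" "differ_by_box i (Col (Suc (Suc n)))" shows "i = Col (Suc n)"
proof -
  have fi: "finite i" using young_L[OF assms(1)] by (simp add: young_def)
  have c: "card i = Suc n" using differ_card[OF assms(2)] differ_card[OF assms(3)] fi by auto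
  then have "i \<subseteq> Col (Suc (Suc n))" using differ_larger[OF assms(3)] fi by simp
  then have "i \<noteq> hook n" by (auto simp: hook_def)
  then show ?thesis using column_neighbours[OF young_L[OF assms(1)] assms(2)] c by auto
qed

lemma uniq_row3:
  assumes "i \<in> L" "differ_by_box (Col 1) i" "differ_by_box i (row_diagram 3)" shows "i = hook 1"
proof -
  have fi: "finite i" using young_L[OF assms(1)] by (simp add: young_def)
  have c: "card i = 2" using differ_card[OF assms(2)] differ_card[OF assms(3)] fi by auto
  then have "i \<subseteq> row_diagram 3" using differ_larger[OF assms(3)] fi by simp
  moreover have "(1, 0) \<in> Col (Suc 1)" "(1, 0) \<notin> row_diagram 3" by simp_all
  ultimately have "i \<noteq> Col (Suc 1)" by blast
  then show ?thesis using column_neighbours[OF young_L[OF assms(1)] assms(2)] c by auto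
qed

lemma differ_small: "differ_by_box {} (Col 1)" "differ_by_box (Col 1) (Col 2)" "differ_by_box (Col 1) (hook 1)"
  using differ_column[of 0] differ_column[of 1] differ_hook[of 1] by (simp_all add: numeral_2_eq_2)

lemma base_step: "bm \<I> (ident C X) (ident C X) = t" "cu \<I> (ident C X) = cup" "ca \<I> (ident C X) = cap"
  by (simp_all add: bm_def cu_def ca_def)

lemma base_values: "dl {} (Col 1) = x" "bb {} (Col 1) = inverse r" 
  "aa {} (Col 1) (hook 1) = q" "aa {} (Col 1) (Col 2) = - inverse q"
proof -
  note nd = node_at[OF small_L(1,2), simplified diagram_simps(1), OF differ_small(1), unfolded base W_empty W_box base_step]
  have "dl {} (Col 1) \<odot> ident C \<I> = x \<odot> ident C \<I>" using nodeD(4)[OF nd] unfolding base_step cap_cup by simp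
  then show "dl {} (Col 1) = x" using scalar_cancel[OF unit_simple] by simp
  have "bb {} (Col 1) \<odot> cup = inverse r \<odot> cup" using nodeD(5)[OF nd] unfolding base_step t_cup by simp
  moreover have "cup \<noteq> zero_mor C \<I> (X \<otimes>\<^sub>o X)"
    using cap_cup x_nz sc_eq_zero[of "ident C \<I>" x] simple_nz[OF unit_simple] by auto
  ultimately show "bb {} (Col 1) = inverse r" using sc_cancel[of cup] by simp
  have 1: "aa {} (Col 1) i = \<theta>" if "t \<cdot> inc (Col 1) i = \<theta> \<odot> inc (Col 1) i" "i \<in> L" "differ_by_box (Col 1) i" "i \<noteq> {}" for i \<theta>
  proof -
    have "aa {} (Col 1) i \<odot> inc (Col 1) i = \<theta> \<odot> inc (Col 1) i"
      using nodeD(9)[OF nd, of i] that unfolding base_step by simp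
    then have "pro (Col 1) i \<cdot> (aa {} (Col 1) i \<odot> inc (Col 1) i) = pro (Col 1) i \<cdot> (\<theta> \<odot> inc (Col 1) i)" by simp
    then show ?thesis using incD[OF small_L(2) that(2,3)] scalar_cancel[OF W_simple[OF that(2)]] by (simp add: cmp_sc)
  qed
  show "aa {} (Col 1) (hook 1) = q" 
    by (rule 1) (use t_row row_2 small_L differ_small in \<open>auto simp: hook_def\<close>)
  show "aa {} (Col 1) (Col 2) = - inverse q" 
    by (rule 1) (use t_col small_L differ_small in \<open>auto simp: column_diagram_def numeral_2_eq_2\<close>)
qed

lemma base_anti: "anti {} (Col 1) (Col 2) (- inverse q)" "anti {} (Col 1) (hook 1) q"
proof -
  have 1: "anti {} (Col 1) i \<theta>" if th: "t \<cdot> inc (Col 1) i = \<theta> \<odot> inc (Col 1) i" "i \<in> L" "differ_by_box (Col 1) i" for i \<theta>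
  proof -
    note I = incD[OF small_L(2) th(2,3)]
    have "\<exists>s. anti {} (Col 1) i s"
      by (rule anti_exists[OF small_L(1)[unfolded diagram_simps(1)] small_L(2) th(2) differ_small(1) th(3)])
        (rule uniq_empty[unfolded diagram_simps(1)])
    then obtain s where s: "anti {} (Col 1) i s" by blast
    then have "t \<cdot> inc (Col 1) i = s \<odot> inc (Col 1) i" 
      unfolding anti_def base W_empty using I W_box by simp
    then have "\<theta> \<odot> inc (Col 1) i = s \<odot> inc (Col 1) i" using th(1) by simp
    then have "pro (Col 1) i \<cdot> (\<theta> \<odot> inc (Col 1) i) = pro (Col 1) i \<cdot> (s \<odot> inc (Col 1) i)" by simp
    then have "\<theta> = s" using I scalar_cancel[OF W_simple[OF th(2)]] by (simp add: cmp_sc)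
    then show ?thesis using s by simp
  qed
  show "anti {} (Col 1) (Col 2) (- inverse q)" by (rule 1) (use t_col small_L differ_small in auto)
  show "anti {} (Col 1) (hook 1) q" by (rule 1) (use t_row row_2 small_L differ_small in auto)
qed

lemma kappa: "\<kappa> = - (g * z)"
proof (rule kappa_eq)
  note I = incD[OF small_L(2) small_L(5) differ_small(3), unfolded W_box]
  show "step X (W (hook 1)) (inc (Col 1) (hook 1)) (pro (Col 1) (hook 1))" by (rule I)
  show "ident C (W (hook 1)) \<noteq> zero_mor C (W (hook 1)) (W (hook 1))" by (rule ident_nz[OF small_L(5)])
  have "{} \<noteq> hook 1" by (simp add: hook_def)
  from hom_zero[OF _ small_L(5) this, of "pro (Col 1) (hook 1) \<cdot> cup"]
  show "pro (Col 1) (hook 1) \<cdot> cup = zero_mor C \<I> (W (hook 1))" using small_L(1) I W_empty by simp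
qed

text \<open>With the sign absorbed, the loop value obeys the standard relation \<open>zX\<close>,
  whichever fourth root of unity normalises the braiding.\<close>

definition "\<X> \<equiv> g * x"

lemma g_nz: "g \<noteq> 0" using g2 by auto

lemma X_nz: "\<X> \<noteq> 0" unfolding \<X>_def using g_nz x_nz by simp

lemma zX: "z * \<X> = z + r - inverse r"
  using kauffman_cup[OF simple_nz[OF unit_simple] x_nz] unfolding kappa \<X>_def by (simp add: algebra_simps)

lemma q2: "q * q \<noteq> -1"
proof
  assume "q * q = -1"
  then have "q * (- q) = 1" by simp
  then have "inverse q = - q" by (metis inverse_unique)
  then show False using q_sep by simp
qed

lemma qn2: "qn q 2 = q + inverse q" "q + inverse q \<noteq> 0"
  using q_sep by (auto simp: numeral_2_eq_2 add_eq_0_iff2)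

text \<open>The two partial traces at the first box form a linear system for the ratios of [2] and
  [1^2] to [1], with determinant \<open>q + inverse q\<close>. Solve it and multiply by
  \<open>x\<close>.\<close>

lemma dl_second:
  "(q + inverse q) * dl (Col 1) (hook 1) * x = inverse q * x * x + g * r * x - (inverse q + inverse r)"
  "(q + inverse q) * dl (Col 1) (Col 2) * x = q * x * x - g * r * x + (inverse r - q)"
proof -
  have 2: "Col (Suc (Suc 0)) = Col 2" "hook (Suc 0) = hook 1" "Col (Suc 0) = Col 1" by (simp_all add: numeral_2_eq_2)
  note T = traces[OF small_L(1)[unfolded diagram_simps(1)] small_L(2) differ_small(1)]
  note S = sum_nb_col[where n=0, unfolded 2 diagram_simps(1)]
  have 1: "x = inverse x + (dl (Col 1) (Col 2) + dl (Col 1) (hook 1))"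
     "g * r = inverse r * inverse x + (- inverse q * dl (Col 1) (Col 2) + q * dl (Col 1) (hook 1))"
    using T unfolding S base_values if_P[OF small_L(4)] if_P[OF small_L(5)] .
  define a b i where "a = dl (Col 1) (Col 2)" and "b = dl (Col 1) (hook 1)" and "i = inverse x"
  have i: "i * x = 1" using x_nz by (simp add: i_def)
  have e: "x = i + (a + b)" "g * r = inverse r * i + (- inverse q * a + q * b)" using 1 unfolding a_def b_def i_def .
  have "a = x - i - b" "b = x - i - a" using e(1) by (simp_all add: algebra_simps)
  have "q * b = g * r - inverse r * i + inverse q * (x - i - b)" using e(2) \<open>a = x - i - b\<close> by (simp add: algebra_simps)
  then have "(q + inverse q) * b = g * r - inverse r * i + inverse q * (x - i)" by (simp add: algebra_simps)
  then have "(q + inverse q) * b * x = (g * r - inverse r * i + inverse q * (x - i)) * x" by simp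
  also have "\<dots> = g * r * x - inverse r * (i * x) + inverse q * (x * x - i * x)" 
    by (simp add: algebra_simps)
  finally have "(q + inverse q) * b * x = g * r * x - inverse r * (i * x) + inverse q * (x * x - i * x)" .
  then show "(q + inverse q) * dl (Col 1) (hook 1) * x = inverse q * x * x + g * r * x - (inverse q + inverse r)"
    unfolding i b_def by (simp add: algebra_simps)
  have "inverse q * a = inverse r * i - g * r + q * (x - i - a)" using e(2) \<open>b = x - i - a\<close> by (simp add: algebra_simps)
  then have "(q + inverse q) * a = inverse r * i - g * r + q * (x - i)" by (simp add: algebra_simps)
  then have "(q + inverse q) * a * x = (inverse r * i - g * r + q * (x - i)) * x" by simp
  also have "\<dots> = inverse r * (i * x) - g * r * x + q * (x * x - i * x)" 
    by (simp add: algebra_simps)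
  finally have "(q + inverse q) * a * x = inverse r * (i * x) - g * r * x + q * (x * x - i * x)" .
  then show "(q + inverse q) * dl (Col 1) (Col 2) * x = q * x * x - g * r * x + (inverse r - q)"
    unfolding i a_def by (simp add: algebra_simps)
qed

lemma xx: "x * x = \<X> * \<X>" "g * r * x = r * \<X>"
  using g2 by (simp_all add: \<X>_def algebra_simps) 

text \<open>The dimension of [2] does not vanish. This supplies the hypothesis \<open>S\<close> of
  \<open>orthogonal_scalar\<close>; for rows, with \<open>- inverse q\<close> in place of
  \<open>q\<close>, the companion \<open>col_dim\<close> does.\<close>

lemma row_dim: "\<X> * (inverse q * \<X> + r) \<noteq> inverse q + inverse r"
proof -
  have "(q + inverse q) * dl (Col 1) (hook 1) * x \<noteq> 0"
    using qn2(2) x_nz dl_nz[OF small_L(2,5) differ_small(3)] by simp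
  then show ?thesis unfolding dl_second mult.assoc[of "inverse q"] xx by (simp add: algebra_simps)
qed

lemma col_dim: "\<X> * (q * \<X> - r) \<noteq> q - inverse r"
proof -
  have "(q + inverse q) * dl (Col 1) (Col 2) * x \<noteq> 0"
    using qn2(2) x_nz dl_nz[OF small_L(2,4) differ_small(2)] by simp
  then show ?thesis unfolding dl_second mult.assoc[of q] xx by (simp add: algebra_simps)
qed

end

section \<open>Exceptional parameters, and the recursion along the columns\<close>

context fusion_skein
begin

text \<open>The hypotheses are what \<open>node_rigid\<close> yields for a crossing that is
  \<open>- inverse q\<close> off the old summand. \<open>y\<close> is \<open>inverse q\<close> or
  \<open>- q\<close>; the second root leads to \<open>\<X> = 0\<close> or to a vanishing dimension
  of [2], and the first leaves a single pair of parameters.\<close>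

lemma column_parameters:
  assumes y: "y * (y + z) = 1" and e: "g * x * (- inverse q - z) + (y + z) = inverse r"
  shows "r = - inverse q" "\<X> = 2"
proof -
  define s \<rho> where "s = inverse q" and "\<rho> = inverse r"
  have h: "q * s = 1" "r * \<rho> = 1" "(q - s) * \<X> = q - s + r - \<rho>" "\<X> \<noteq> 0" "q \<noteq> - s"
    "\<X> * (s * \<X> + r) \<noteq> s + \<rho>"
    using q_nz r_nz zX X_nz q_sep row_dim by (simp_all add: s_def \<rho>_def)
  have e': "\<rho> = y + (q - s) - q * \<X>" using e by (simp add: s_def \<rho>_def \<X>_def algebra_simps)
  have "(y - s) * (y + q) = 0" using y h(1) unfolding s_def[symmetric] by Groebner_Basis.algebra
  then have "r = - s \<and> \<X> = 2"
  proof (cases "y = s")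
    case True
    have X: "\<X> = 1 - s * \<rho>" using e' True h(1) by Groebner_Basis.algebra
    have "(r - s) * (r + s) = 0" using h(1-3) X by Groebner_Basis.algebra
    moreover have "r \<noteq> s"
    proof
      assume "r = s"
      then have "\<X> = 0" using X h(2) by simp
      then show False using h(4) by simp
    qed
    ultimately have r: "r = - s" by (simp add: add_eq_0_iff2)
    then have "\<X> = 2" using X h(2) by Groebner_Basis.algebra
    then show ?thesis using r by simp
  next
    case False
    then have "y = - q" using \<open>(y - s) * (y + q) = 0\<close> by (simp add: add_eq_0_iff2)
    then have X: "\<X> = - (s * s + s * \<rho>)" using e' h(1) by Groebner_Basis.algebra
    have "(r + q) * (r - s * s * s) = 0" using h(1-3) X by Groebner_Basis.algebra
    then consider "r + q = 0" | "r = s * s * s" by auto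
    then have False
    proof cases
      case 1
      have "\<X> = 0" using X 1 h(1,2) by Groebner_Basis.algebra
      then show False using h(4) by simp
    next
      case 2
      have "\<X> * (s * \<X> + r) = s + \<rho>" using X 2 h(1,2) by Groebner_Basis.algebra
      then show False using h(6) by simp
    qed
    then show ?thesis ..
  qed
  then show "r = - inverse q" "\<X> = 2" by (simp_all add: s_def)
qed

lemma row_next:
  "(q + inverse q) * bb (Col 1) (hook 1) * x = inverse q * inverse r * x - g * inverse q * (inverse q + inverse r)"
proof -
  \<comment> \<open>The combination \<open>inverse q\<close> plus \<open>bm\<close> vanishes on
    [1^2] and is \<open>q + inverse q\<close> on [2]; \<open>\<gamma>\<close> is solved from its
    vanishing on the unit summand.\<close>
  define \<gamma> where "\<gamma> = - (inverse q + inverse r) / x"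
  have "(q + inverse q) * bb (Col 1) (hook 1) = inverse q * inverse r + \<gamma> * g * inverse q"
  proof (rule bb_next(1)[OF base_anti(2) _ q_nz, of "inverse q" 1])
    show "inverse q + 1 * aa {} (Col 1) (hook 1) = q + inverse q" unfolding base_values by simp
    show "inverse q + 1 * bb {} (Col 1) + \<gamma> * dl {} (Col 1) = 0"
      unfolding base_values \<gamma>_def using x_nz by simp
    fix i assume i: "i \<in> nb (Col 1)" "i \<noteq> {}" "i \<noteq> hook 1"
    then have "i = Col 2" using column_neighbours[OF young_L, of i 1] by (auto simp: numeral_2_eq_2)
    then show "inverse q + 1 * aa {} (Col 1) i = 0" by (simp only: base_values) simp
  qed (simp add: hook_def)
  then have "(q + inverse q) * bb (Col 1) (hook 1) * x = inverse q * inverse r * x + (\<gamma> * x) * g * inverse q"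
    by (simp add: distrib_right)
  moreover have "\<gamma> * x = - (inverse q + inverse r)" using x_nz by (simp add: \<gamma>_def)
  ultimately show ?thesis by (simp add: algebra_simps)
qed

lemma two_values:
  assumes "r = - inverse q" "\<X> = 2"
  shows "dl (Col 1) (hook 1) * x = 1" "bb (Col 1) (hook 1) * x = g * r" "x = 2 * g" 
    "dl (Col 1) (Col 2) = g"
proof -
  have ri: "inverse r = - q" using assms by simp
  have "g * \<X> = x" using g2 by (simp add: \<X>_def mult.assoc[symmetric])
  then show x2: "x = 2 * g" using assms by (simp add: mult.commute)
  have "(q + inverse q) * (dl (Col 1) (hook 1) * x) = inverse q * (\<X> * \<X>) + r * \<X> - (inverse q + inverse r)"
    using dl_second(1) xx by (simp add: mult.assoc)
  also have "\<dots> = (q + inverse q) * 1" unfolding ri using assms by simp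
  finally show "dl (Col 1) (hook 1) * x = 1" using qn2(2) mult_left_cancel by blast
  have "(q + inverse q) * (bb (Col 1) (hook 1) * x) = inverse q * (- q) * (2 * g) - g * inverse q * (inverse q - q)"
    using row_next unfolding ri x2 by (simp add: mult.assoc)
  also have "\<dots> = (q + inverse q) * (g * r)" unfolding assms(1) using q_nz by (simp add: algebra_simps)
  finally show "bb (Col 1) (hook 1) * x = g * r" using qn2(2) mult_left_cancel by blast
  have "(q + inverse q) * (dl (Col 1) (Col 2) * x) = q * (\<X> * \<X>) - r * \<X> + (inverse r - q)"
    using dl_second(2) xx by (simp add: mult.assoc)
  also have "\<dots> = (q + inverse q) * 2" unfolding ri using assms by simp
  finally have "dl (Col 1) (Col 2) * x = 2" using qn2(2) mult_left_cancel by blast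
  then have "dl (Col 1) (Col 2) * g = 1" unfolding x2 by simp
  then have "dl (Col 1) (Col 2) * (g * g) = g" by (simp add: mult.assoc[symmetric])
  then show "dl (Col 1) (Col 2) = g" using g2 by simp
qed

text \<open>At these parameters the first trace on [2] makes the ratios of [3] and [2,1] cancel, and
  the second then gives both the same eigenvalue, \<open>q\<close>. So \<open>node_rigid\<close>
  applies with \<open>\<theta> = q\<close>, and its two equations force
  \<open>inverse q = - q\<close>.\<close>

lemma no_hook_2:
  assumes "hook 2 \<in> L" shows "\<not> (r = - inverse q \<and> \<X> = 2)"
proof
  assume "r = - inverse q \<and> \<X> = 2"
  then have a: "r = - inverse q" "\<X> = 2" by simp_all
  note V = two_values[OF a]
  note nd = node_at[OF small_L(2,5) differ_small(3)]
  note T = traces[OF small_L(2,5) differ_small(3)]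
  have Di: "inverse (dl (Col 1) (hook 1)) = x" using V(1) by (metis inverse_unique)
  have h12: "differ_by_box (hook 1) (hook 2)" "differ_by_box (hook 1) (row_diagram 3)"
    using differ_hooks[of 1] differ_rows[of 2] row_2 by (simp_all add: numeral_2_eq_2 numeral_3_eq_3)
  have S: "(if row_diagram 3 \<in> L then dl (hook 1) (row_diagram 3) else 0) + dl (hook 1) (hook 2) = 0"
    "(if row_diagram 3 \<in> L then aa (Col 1) (hook 1) (row_diagram 3) * dl (hook 1) (row_diagram 3) else 0)
       + aa (Col 1) (hook 1) (hook 2) * dl (hook 1) (hook 2) = 0"
    using T[unfolded sum_nb_hook1 Di V(2)] assms by simp_all
  have dh: "dl (hook 1) (hook 2) \<noteq> 0" by (rule dl_nz[OF small_L(5) assms h12(1)])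
  then have r3: "row_diagram 3 \<in> L" using S(1) by (auto split: if_splits)
  have c: "card (row_diagram 3) = card (Col 1) + 2" by simp
  have r3a: "aa (Col 1) (hook 1) (row_diagram 3) = q"
  proof -
    have "anti (Col 1) (hook 1) (row_diagram 3) q"
      by (rule anti_step[OF base_anti(2) r3 h12(2) q_nz]) (rule uniq_row3)
    moreover have "row_diagram 3 \<noteq> Col 1" using c by (metis add_cancel_left_right zero_neq_numeral)
    ultimately show ?thesis using aa_from_anti unfolding anti_def by blast
  qed
  have "(aa (Col 1) (hook 1) (hook 2) - q) * dl (hook 1) (hook 2) = 0"
  proof -
    have "dl (hook 1) (row_diagram 3) = - dl (hook 1) (hook 2)" using S(1) r3 by (simp add: add_eq_0_iff2)
    then show ?thesis using S(2) r3 r3a by (simp add: algebra_simps)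
  qed
  then have ah: "aa (Col 1) (hook 1) (hook 2) = q" using dh by simp
  have "\<exists>y. y * (y + z) = 1 \<and> g * x * (q - z) + (y + z) = inverse r"
  proof (rule node_rigid[OF nd])
    show "aa (Col 1) (hook 1) i = q" if "i \<in> nb (hook 1) - {Col 1}" for i
      using that unfolding nb_hook1 using r3a ah by auto
    show "hook 2 \<in> nb (hook 1) - {Col 1}" unfolding nb_hook1 using assms by simp
  qed (use ident_nz small_L assms kappa q_nz in auto)
  then obtain y where y: "y * (y + z) = 1" "\<X> * inverse q + (y + z) = inverse r" by (auto simp: \<X>_def)
  have "(y + z - q) * (y + z + inverse q) = 0" using y(1) q_nz by (simp add: algebra_simps)
  then consider "y + z = q" | "y + z = - inverse q" by (auto simp: add_eq_0_iff2)
  then show False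
  proof cases
    case 1
    then have "2 * inverse q + q = - q" using y(2) unfolding a by simp
    then have "inverse q = - q" by Groebner_Basis.algebra
    then show False using q_sep by simp
  next
    case 2
    then have "inverse q = - q" using y(2) a by simp
    then show False using q_sep by simp
  qed
qed

text \<open>\<open>g * kk (i+2)\<close> is the cup-cap coefficient in the scaled idempotent onto
  [1^(i+2)], solved from vanishing on the summand [1^i]. The separate sign keeps \<open>g\<close>
  out of the recursion; the value at 0 is a filler.\<close>

primrec kk :: "nat \<Rightarrow> complex" where
  "kk 0 = 0"
| "kk (Suc n) = (case n of 0 \<Rightarrow> 0 | Suc i \<Rightarrow> g * ((qn q (Suc i) * bb (Col i) (Col (Suc i)) - q ^ Suc i) / dl (Col i) (Col (Suc i))))"

lemma kk_1 [simp]: "kk (Suc 0) = 0" by simp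

lemma kk_Suc: "kk (Suc (Suc i)) = g * ((qn q (Suc i) * bb (Col i) (Col (Suc i)) - q ^ Suc i) / dl (Col i) (Col (Suc i)))"
  by simp

declare kk.simps [simp del]

context
  fixes N assumes col_L: "\<And>n. Col n \<in> L \<longleftrightarrow> n \<le> N" and hook_L: "\<And>n. hook (Suc (Suc n)) \<in> L \<Longrightarrow> hook 2 \<in> L"
begin

lemma col_anti: "Suc (Suc i) \<le> N \<Longrightarrow> anti (Col i) (Col (Suc i)) (Col (Suc (Suc i))) (- inverse q)"
proof (induction i)
  case 0
  then show ?case using base_anti(1) by (simp add: numeral_2_eq_2)
next
  case (Suc i)
  show ?case
    by (rule anti_step[OF Suc.IH]) (use Suc.prems col_L differ_column q_nz uniq_col in auto)
qed

lemma col_aa: "Suc (Suc i) \<le> N \<Longrightarrow> aa (Col i) (Col (Suc i)) (Col (Suc (Suc i))) = - inverse q"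
proof -
  assume "Suc (Suc i) \<le> N"
  then have "anti (Col i) (Col (Suc i)) (Col (Suc (Suc i))) (- inverse q)" by (rule col_anti)
  moreover have "Col (Suc (Suc i)) \<noteq> Col i" by (metis card_diagrams(1) n_not_Suc_n Suc_n_not_n less_SucI less_irrefl lessI)
  ultimately show ?thesis using aa_from_anti unfolding anti_def by blast
qed

text \<open>On the next column, where \<open>bm\<close> is \<open>- inverse q\<close>, the
  coefficients q^(i+1) and \<open>- qn q (Suc i)\<close> combine to
  \<open>qn q (Suc (Suc i))\<close> by the recursion for q-integers; on the hook they cancel by
  \<open>H\<close>. \<open>H\<close> is a hypothesis because \<open>col_hook\<close> proves it
  inductively, using this expansion.\<close>

lemma col_expand:
  assumes i: "Suc (Suc i) \<le> N"
    and H: "hook (Suc i) \<in> L \<Longrightarrow> qn q (Suc i) * aa (Col i) (Col (Suc i)) (hook (Suc i)) = q ^ Suc i"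
  shows "qn q (Suc (Suc i)) * bb (Col (Suc i)) (Col (Suc (Suc i))) = q ^ Suc i * inverse r - q * kk (Suc (Suc i))" (is ?A)
    and "qn q (Suc (Suc i)) \<odot> (inc (Col (Suc i)) (Col (Suc (Suc i))) \<cdot> pro (Col (Suc i)) (Col (Suc (Suc i))))
      = q ^ Suc i \<odot> ident C (W (Col (Suc i)) \<otimes>\<^sub>o X) \<boxplus> (- qn q (Suc i)) \<odot> bm (W (Col i)) (inc (Col i) (Col (Suc i))) (pro (Col i) (Col (Suc i)))
        \<boxplus> (g * kk (Suc (Suc i))) \<odot> (cu (W (Col i)) (pro (Col i) (Col (Suc i))) \<cdot> ca (W (Col i)) (inc (Col i) (Col (Suc i))))" (is ?B)
proof -
  have L: "Col i \<in> L" "Col (Suc i) \<in> L" "Col (Suc (Suc i)) \<in> L" using i col_L by auto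
  have ne: "Col (Suc (Suc i)) \<noteq> Col i" by (metis card_diagrams(1) n_not_Suc_n Suc_n_not_n less_SucI less_irrefl lessI)
  have 1: "q ^ Suc i + - qn q (Suc i) * aa (Col i) (Col (Suc i)) (Col (Suc (Suc i))) = qn q (Suc (Suc i))"
    unfolding col_aa[OF i] by (simp add: algebra_simps)
  have 2: "q ^ Suc i + - qn q (Suc i) * aa (Col i) (Col (Suc i)) j = 0" 
    if "j \<in> nb (Col (Suc i))" "j \<noteq> Col i" "j \<noteq> Col (Suc (Suc i))" for j
  proof -
    have "j \<in> nb (Col (Suc i)) - {Col i}" using that by simp
    then have "j = hook (Suc i)" "hook (Suc i) \<in> L" unfolding nb_col using that by auto
    then show ?thesis using H by (simp del: qn.simps power_Suc)
  qed
  have d: "dl (Col i) (Col (Suc i)) \<noteq> 0" by (rule dl_nz[OF L(1,2) differ_column])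
  have gk: "g * kk (Suc (Suc i)) = (qn q (Suc i) * bb (Col i) (Col (Suc i)) - q ^ Suc i) / dl (Col i) (Col (Suc i))"
    unfolding kk_Suc mult.assoc[symmetric] g2 by simp
  have 3: "q ^ Suc i + - qn q (Suc i) * bb (Col i) (Col (Suc i)) + (g * kk (Suc (Suc i))) * dl (Col i) (Col (Suc i)) = 0"
    unfolding gk using d by (simp del: qn.simps power_Suc)
  have q0: "- inverse q \<noteq> 0" using q_nz by simp
  note R = bb_next[OF col_anti[OF i] ne q0 1 2 3]
  have "qn q (Suc (Suc i)) * bb (Col (Suc i)) (Col (Suc (Suc i))) = q ^ Suc i * inverse r + g * kk (Suc (Suc i)) * g * inverse (- inverse q)"
    by (rule R(1)) auto
  also have "g * kk (Suc (Suc i)) * g * inverse (- inverse q) = - q * ((g * g) * kk (Suc (Suc i)))" by (simp add: mult_ac)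
  finally show ?A unfolding g2 by simp
  show ?B by (rule R(2)) auto
qed

text \<open>The hook beside [1^(i+2)] is too large to occur in \<open>W [1^i] \<otimes> X\<close>,
  so \<open>bm_summand_next\<close> leaves two candidates for the eigenvalue. With
  \<open>\<theta> = - inverse q\<close> the scalar \<open>z - \<theta>\<close> is \<open>q\<close>,
  which produces the next power of \<open>q\<close>.\<close>

lemma col_hook:
  assumes "Suc i \<le> N" "hook (Suc i) \<in> L"
  shows "qn q (Suc i) * aa (Col i) (Col (Suc i)) (hook (Suc i)) = q ^ Suc i"
  using assms
proof (induction i)
  case 0
  then show ?case using base_values by simp
next
  case (Suc i)
  let ?A0 = "Col i" and ?A1 = "Col (Suc i)" and ?A2 = "Col (Suc (Suc i))" and ?Z = "hook (Suc (Suc i))"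
  have L: "?A0 \<in> L" "?A1 \<in> L" "?A2 \<in> L" using Suc.prems col_L by auto
  note ZL = Suc.prems(2)
  have i: "Suc (Suc i) \<le> N" using Suc.prems by simp
  have H: "hook (Suc i) \<in> L \<Longrightarrow> qn q (Suc i) * aa ?A0 ?A1 (hook (Suc i)) = q ^ Suc i" using Suc.IH i by simp
  note st = incD(8)[OF L(1,2) differ_column] incD(8)[OF L(2,3) differ_column] incD(8)[OF L(3) ZL differ_hook]
  have an: "wh (W ?A0) t \<I> \<cdot> (wh \<I> (inc ?A0 ?A1) X \<cdot> inc ?A1 ?A2) = (- inverse q) \<odot> (wh \<I> (inc ?A0 ?A1) X \<cdot> inc ?A1 ?A2)"
    using col_anti[OF i] unfolding anti_def by blast
  have neZ: "?Z \<noteq> Col m" for m using col_neq_hook[of m] by metis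
  note nd = node_at[OF L(2,3) differ_column]
  have Zn: "?Z \<in> nb ?A2 - {?A1}" unfolding nb_col using ZL by simp
  have az: "bm (W ?A1) (inc ?A1 ?A2) (pro ?A1 ?A2) \<cdot> inc ?A2 ?Z = aa ?A1 ?A2 ?Z \<odot> inc ?A2 ?Z"
    by (rule nodeD(9)[OF nd Zn])
  have "qn q (Suc (Suc i)) * aa ?A1 ?A2 ?Z = q ^ Suc i * (z - - inverse q) \<or> aa ?A1 ?A2 ?Z = - inverse q"
  proof (rule bm_summand_next[OF st col_expand(2)[OF i H] an _ az ident_nz[OF ZL]])
    show "- inverse q * (- inverse q - z) = 1" using q_nz by (simp add: algebra_simps)
    show "f = zero_mor C (W ?Z) (W ?A0 \<otimes>\<^sub>o X)" if "arr f" "dm f = W ?Z" "cd f = W ?A0 \<otimes>\<^sub>o X" for f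
    proof (rule hom_in(2)[OF L(1) ZL that])
      show "\<not> differ_by_box ?A0 ?Z" using differ_card[of ?A0 ?Z] by auto
    qed
    show "f = zero_mor C (W ?Z) (W ?A1)" if "arr f" "dm f = W ?Z" "cd f = W ?A1" for f
      by (rule hom_zero[OF ZL L(2) neZ that])
  qed
  \<comment> \<open>The other candidate would make \<open>bm\<close> scalar on all summands except
    the old one. Then \<open>node_rigid\<close> forces the exceptional parameters, and these are
    incompatible with the label \<open>hook 2\<close> that \<open>hook_L\<close> provides.\<close>
  moreover have "aa ?A1 ?A2 ?Z \<noteq> - inverse q"
  proof
    assume a: "aa ?A1 ?A2 ?Z = - inverse q"
    have "\<exists>y. y * (y + z) = 1 \<and> g * x * (- inverse q - z) + (y + z) = inverse r"
    proof (rule node_rigid[OF nd _ Zn ident_nz[OF L(3)] ident_nz[OF ZL] kappa])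
      fix j assume "j \<in> nb ?A2 - {?A1}"
      then have "j = Col (Suc (Suc (Suc i))) \<and> Col (Suc (Suc (Suc i))) \<in> L \<or> j = ?Z" unfolding nb_col by auto
      then show "aa ?A1 ?A2 j = - inverse q" using a col_aa[of "Suc i"] col_L by auto
    qed (use q_nz in \<open>simp add: algebra_simps\<close>)
    then obtain y where y: "y * (y + z) = 1" "g * x * (- inverse q - z) + (y + z) = inverse r" by blast
    show False using column_parameters[OF y] no_hook_2[OF hook_L[OF ZL]] by simp
  qed
  ultimately show ?case by (simp add: mult_ac)
qed

lemma col_bb: "Suc i \<le> N \<Longrightarrow> qn q (Suc i) * bb (Col i) (Col (Suc i)) = q ^ i * inverse r - q * kk (Suc i)"
proof (cases i)
  case 0
  then show ?thesis using base_values by simp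
next
  case (Suc j)
  assume "Suc i \<le> N"
  then show ?thesis unfolding Suc using col_expand(1)[of j] col_hook[of j] by simp
qed

text \<open>The ratio of [1^(n+1)] to [1^n] with the same sign normalisation as \<open>\<X>\<close>.
  The value 0 from \<open>N\<close> on encodes that [1^(N+1)] is not a label.\<close>

definition dc where "dc n = (if n < N then g * dl (Col n) (Col (Suc n)) else 0)"

lemma N1: "2 \<le> N" using small_L(4) col_L by simp

lemma dc_top: "dc N = 0"
  by (simp add: dc_def)

lemma dc_nz: "n < N \<Longrightarrow> dc n \<noteq> 0"
  unfolding dc_def using dl_nz[of "Col n" "Col (Suc n)"] differ_column col_L g_nz by simp

lemma col_traces:
  assumes "Suc i \<le> N"
  shows "x = inverse (dl (Col i) (Col (Suc i))) + g * dc (Suc i) + (if hook (Suc i) \<in> L then dl (Col (Suc i)) (hook (Suc i)) else 0)"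
    "g * r = bb (Col i) (Col (Suc i)) * inverse (dl (Col i) (Col (Suc i))) - inverse q * (g * dc (Suc i))
       + (if hook (Suc i) \<in> L then aa (Col i) (Col (Suc i)) (hook (Suc i)) * dl (Col (Suc i)) (hook (Suc i)) else 0)"
proof -
  have L: "Col i \<in> L" "Col (Suc i) \<in> L" using assms col_L by auto
  note T = traces[OF L differ_column, unfolded sum_nb_col]
  have gd: "g * dc (Suc i) = (if Col (Suc (Suc i)) \<in> L then dl (Col (Suc i)) (Col (Suc (Suc i))) else 0)"
    unfolding dc_def col_L using g2 by (simp add: mult.assoc[symmetric] Suc_le_eq)
  show "x = inverse (dl (Col i) (Col (Suc i))) + g * dc (Suc i) + (if hook (Suc i) \<in> L then dl (Col (Suc i)) (hook (Suc i)) else 0)"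
    using T(1) unfolding gd by simp
  have "(if Col (Suc (Suc i)) \<in> L then aa (Col i) (Col (Suc i)) (Col (Suc (Suc i))) * dl (Col (Suc i)) (Col (Suc (Suc i))) else 0)
    = - inverse q * (g * dc (Suc i))"
    unfolding gd using col_aa[of i] col_L by simp
  then show "g * r = bb (Col i) (Col (Suc i)) * inverse (dl (Col i) (Col (Suc i))) - inverse q * (g * dc (Suc i))
       + (if hook (Suc i) \<in> L then aa (Col i) (Col (Suc i)) (hook (Suc i)) * dl (Col (Suc i)) (hook (Suc i)) else 0)"
    using T(2) by simp
qed

text \<open>The hook ratio \<open>h\<close> occurs in both traces. As \<open>qn q (Suc i)\<close>
  times its eigenvalue is q^(i+1), taking q^(i+1) times the first trace minus
  \<open>qn q (Suc i)\<close> times the second eliminates it. If the hook is not a label, both of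
  its terms are zero anyway.\<close>

lemma col_chain: "n \<le> N \<Longrightarrow> scalar_chain q r \<X> dc kk n"
  unfolding scalar_chain_def
proof (intro conjI allI impI)
  show "dc 0 = \<X>" using N1 base_values by (simp add: dc_def \<X>_def)
  show "kk (Suc 0) = 0" by simp
  fix i assume n: "n \<le> N" "i < n"
  then have i: "Suc i \<le> N" by simp
  define D b c h where "D = dl (Col i) (Col (Suc i))" and "b = bb (Col i) (Col (Suc i))" and "c = g * dc (Suc i)"
    and "h = (if hook (Suc i) \<in> L then dl (Col (Suc i)) (hook (Suc i)) else 0)"
  have D0: "D \<noteq> 0" unfolding D_def using dl_nz[of "Col i" "Col (Suc i)"] differ_column col_L i by simp
  have di: "dc i = g * D" using i by (simp add: dc_def D_def)
  have k: "g * kk (Suc (Suc i)) = (qn q (Suc i) * b - q ^ Suc i) * inverse D"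
    unfolding kk_Suc mult.assoc[symmetric] g2 b_def D_def by (simp add: divide_inverse)
  have "kk (Suc (Suc i)) * dc i = (g * kk (Suc (Suc i))) * D" unfolding di by (simp only: mult_ac)
  also have "\<dots> = qn q (Suc i) * b - q ^ Suc i" unfolding k using D0 by simp
  finally show "kk (Suc (Suc i)) * dc i = q ^ i * inverse r - q ^ Suc i - q * kk (Suc i)"
    unfolding b_def col_bb[OF i] by simp
  have T: "x = inverse D + c + h" using col_traces(1)[OF i] unfolding D_def c_def h_def .
  have "g * r = b * inverse D - inverse q * c
       + (if hook (Suc i) \<in> L then aa (Col i) (Col (Suc i)) (hook (Suc i)) * dl (Col (Suc i)) (hook (Suc i)) else 0)"
    using col_traces(2)[OF i] unfolding D_def b_def c_def .
  then have "qn q (Suc i) * (g * r) = qn q (Suc i) * (b * inverse D - inverse q * c)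
     + (if hook (Suc i) \<in> L then (qn q (Suc i) * aa (Col i) (Col (Suc i)) (hook (Suc i))) * dl (Col (Suc i)) (hook (Suc i)) else 0)"
    by (simp add: distrib_left mult.assoc)
  also have "(if hook (Suc i) \<in> L then (qn q (Suc i) * aa (Col i) (Col (Suc i)) (hook (Suc i))) * dl (Col (Suc i)) (hook (Suc i)) else 0)
     = q ^ Suc i * h" unfolding h_def using col_hook[OF i] by simp
  finally have R: "qn q (Suc i) * (g * r) = qn q (Suc i) * (b * inverse D - inverse q * c) + q ^ Suc i * h" .
  have "q ^ Suc i * x - qn q (Suc i) * (g * r) = (q ^ Suc i + inverse q * qn q (Suc i)) * c - g * kk (Suc (Suc i))"
    unfolding R k by (subst T) (simp only: algebra_simps)
  then have "qn q (Suc (Suc i)) * c = q ^ Suc i * x - qn q (Suc i) * (g * r) + g * kk (Suc (Suc i))"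
    by (simp only: qn.simps(2)[of q "Suc i"]) simp
  then have "g * (qn q (Suc (Suc i)) * c) = g * (q ^ Suc i * x - qn q (Suc i) * (g * r) + g * kk (Suc (Suc i)))" by simp
  also have "\<dots> = q ^ Suc i * \<X> - qn q (Suc i) * ((g * g) * r) + (g * g) * kk (Suc (Suc i))"
    unfolding \<X>_def by (simp only: algebra_simps)
  finally have e: "g * (qn q (Suc (Suc i)) * (g * dc (Suc i))) = q ^ Suc i * \<X> - qn q (Suc i) * r + kk (Suc (Suc i))"
    unfolding c_def g2 mult_1_left .
  have "g * (qn q (Suc (Suc i)) * (g * dc (Suc i))) = (g * g) * (qn q (Suc (Suc i)) * dc (Suc i))"
    by (simp only: mult_ac)
  then show "qn q (Suc (Suc i)) * dc (Suc i) = q ^ Suc i * \<X> - qn q (Suc i) * r + kk (Suc (Suc i))"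
    unfolding e g2 mult_1_left by (rule sym)
qed

lemma qn_nz: "Suc i \<le> N \<Longrightarrow> hook (Suc i) \<in> L \<Longrightarrow> qn q (Suc i) \<noteq> 0"
proof -
  assume "Suc i \<le> N" "hook (Suc i) \<in> L"
  then have "qn q (Suc i) * aa (Col i) (Col (Suc i)) (hook (Suc i)) = q ^ Suc i" by (rule col_hook)
  then show ?thesis using q_nz by auto
qed

lemma X_dc: "Suc i \<le> N \<Longrightarrow> \<X> * dc i = x * dl (Col i) (Col (Suc i))"
  using g2 by (simp add: \<X>_def dc_def) 

text \<open>Beside the last column the hook is still a label although [1^(N+1)] is not. Its nonzero
  ratio shows in the first trace that \<open>\<X> * dc (N-1)\<close> cannot be 1, which selects the
  symplectic factor.\<close>

lemma symplectic_final:
  assumes h: "\<And>n. 0 < n \<Longrightarrow> n \<le> N \<Longrightarrow> hook n \<in> L"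
  shows "r = - (q ^ (2 * N + 1))"
proof -
  obtain m where m: "N = Suc (Suc m)" using N1 by (metis Suc_le_D numeral_2_eq_2 Suc_le_mono)
  have T: "x = inverse (dl (Col (Suc m)) (Col N)) + dl (Col N) (hook N)"
    using col_traces(1)[of "Suc m", unfolded m[symmetric]] h[of N] N1 dc_top by simp
  have "dl (Col N) (hook N) \<noteq> 0"
    using dl_nz[of "Col N" "hook N"] col_L h[of N] differ_hook N1 by simp
  moreover have "dl (Col N) (hook N) = 0" if "\<X> * dc (Suc m) = 1"
  proof -
    have "x * dl (Col (Suc m)) (Col N) = 1" using that X_dc[of "Suc m", unfolded m[symmetric]] by simp
    then have "inverse (dl (Col (Suc m)) (Col N)) = x" by (metis inverse_unique mult.commute)
    then show ?thesis using T by simp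
  qed
  ultimately have ne: "\<X> * dc (Suc m) \<noteq> 1" by blast
  show ?thesis unfolding m
  proof (rule symplectic_scalar[OF q_nz r_nz zX X_nz col_chain])
    show "dc (Suc (Suc m)) = 0" using dc_top unfolding m[symmetric] .
    show "\<X> * dc (Suc m) \<noteq> 1" by (rule ne)
    show "dc j \<noteq> 0" if "j < Suc (Suc m)" for j using dc_nz[of j] that unfolding m[symmetric] .
    show "qn q (Suc j) \<noteq> 0" if "j < Suc (Suc m)" for j using qn_nz[of j] h[of "Suc j"] that unfolding m[symmetric] by simp
    show "Suc (Suc m) \<le> N" unfolding m[symmetric] by simp
  qed
qed

text \<open>Neither [1^(N+1)] nor the hook beside [1^N] is a label, so [1^(N-1)] is the only summand
  after the last column. Both traces then consist of one term, and these are the two end conditions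
  of the chain.\<close>

lemma orthogonal_final:
  assumes h: "\<And>n. 0 < n \<Longrightarrow> n < N \<Longrightarrow> hook n \<in> L" and hN: "hook N \<notin> L"
  shows "r = q ^ (N - 1) \<or> (odd N \<and> r = - (q ^ (N - 1)))"
proof -
  obtain m where m: "N = Suc (Suc m)" using N1 by (metis Suc_le_D numeral_2_eq_2 Suc_le_mono)
  define D b where "D = dl (Col (Suc m)) (Col N)" and "b = bb (Col (Suc m)) (Col N)"
  have D0: "D \<noteq> 0" unfolding D_def using dl_nz[of "Col (Suc m)" "Col N"] differ_column[of "Suc m", unfolded m[symmetric]] col_L m by simp
  have T: "x = inverse D" "g * r = b * inverse D"
    using col_traces[of "Suc m", unfolded m[symmetric]] hN dc_top by (simp_all add: D_def b_def)
  have B: "qn q N * b = q ^ Suc m * inverse r - q * kk N" using col_bb[of "Suc m", unfolded m[symmetric]] by (simp add: b_def)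
  have r': "r = g * (b * x)" using T g2 by (metis mult.assoc mult_1)
  have "qn q N * r = (qn q N * b) * \<X>" unfolding \<X>_def by (subst r') (simp only: mult_ac)
  then have top: "qn q N * r = (q ^ Suc m * inverse r - q * kk N) * \<X>" unfolding B .
  have "r = q ^ Suc m \<or> odd (Suc (Suc m)) \<and> r = - (q ^ Suc m)"
  proof (rule orthogonal_scalar[OF q_nz r_nz zX X_nz q2 col_chain])
    have lt: "j < N" "Suc j \<le> N" "Suc j < N" if "j < Suc m" for j using that m by simp_all
    show "Suc m \<le> N" using m by simp
    show "dc j \<noteq> 0" if "j < Suc m" for j using dc_nz lt that by blast
    show "qn q (Suc j) \<noteq> 0" if "j < Suc m" for j using qn_nz h lt that by blast
    show "\<X> * dc (Suc m) = 1" using X_dc[of "Suc m", unfolded m[symmetric]] T(1) D0 by (simp add: D_def)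
    show "qn q (Suc (Suc m)) * r = (q ^ Suc m * inverse r - q * kk (Suc (Suc m))) * \<X>" using top unfolding m .
    show "\<X> * (inverse q * \<X> + r) \<noteq> inverse q + inverse r" by (rule row_dim)
  qed
  then show ?thesis by (simp add: m)
qed

text \<open>If \<open>X\<^bsub>[2]\<^esub> \<otimes> X\<close> is simple, then the scalar argument applies to rows instead of columns
  (replace \<open>q\<close> by \<open>- 1/q\<close>) and leaves no room for the last column diagram.\<close>

lemma degenerate_fusion:
  assumes h: "\<And>n. hook (Suc (Suc n)) \<notin> L" and r3: "row_diagram 3 \<notin> L"
  shows False
proof -
  define s \<rho> where "s = inverse q" and "\<rho> = inverse r"
  define D b where "D = dl (Col 1) (hook 1)" and "b = bb (Col 1) (hook 1)"
  have h2: "hook 2 \<notin> L" using h[of 0] by (simp add: numeral_2_eq_2)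
  have D0: "D \<noteq> 0" unfolding D_def by (rule dl_nz[OF small_L(2,5) differ_small(3)])
  have T: "x = inverse D" "g * r = b * inverse D"
    using traces[OF small_L(2,5) differ_small(3), unfolded sum_nb_hook1] h2 r3 by (simp_all add: D_def b_def)
  have gb: "g * r = b * x" using T by simp
  have "\<X> * (g * D) = (g * g) * (inverse D * D)" unfolding \<X>_def by (subst T(1)) (simp only: mult_ac)
  then have DX: "\<X> * (g * D) = 1" using D0 g2 by simp
  have qi: "inverse (- s) = - q" "- s - inverse (- s) = q - inverse q" by (simp_all add: s_def)
  have "(q + s) * (b * x) = s * \<rho> * x - g * s * (s + \<rho>)" using row_next by (simp add: s_def \<rho>_def b_def mult.assoc)
  then have "(q + s) * (g * r) = s * \<rho> * x - g * s * (s + \<rho>)" unfolding gb .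
  then have "g * ((q + s) * (g * r)) = g * (s * \<rho> * x - g * s * (s + \<rho>))" by simp
  then have "(g * g) * ((q + s) * r) = s * \<rho> * \<X> - (g * g) * (s * (s + \<rho>))" unfolding \<X>_def by (simp only: algebra_simps)
  then have e: "(q + s) * r = s * \<rho> * \<X> - s * (s + \<rho>)" unfolding g2 by simp
  have "(q + s) * (g * D) * \<X> = (q + s) * D * x" unfolding \<X>_def using g2 by (simp add: mult_ac)
  also have "\<dots> = s * (\<X> * \<X>) + r * \<X> - (s + \<rho>)" using dl_second(1) xx by (simp add: s_def \<rho>_def D_def mult.assoc)
  finally have d: "(q + s) * (g * D) * \<X> = (s * \<X> + r - (s + \<rho>) / \<X>) * \<X>" using X_nz by (simp add: algebra_simps)
  \<comment> \<open>A chain of length one along rows: \<open>g * D\<close> is the normalised ratio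
    of [2] to [1], and \<open>k'\<close> at 2 is dictated by
    \<open>k' 2 * \<X> = inverse r + inverse q\<close>.\<close>
  define d' where "d' = (\<lambda>n::nat. if n = 0 then \<X> else g * D)"
  define k' where "k' = (\<lambda>n::nat. if n = 2 then (s + \<rho>) / \<X> else 0)"
  have rs: "r = (- s) ^ Suc 0 \<or> odd (Suc (Suc 0)) \<and> r = - ((- s) ^ Suc 0)"
  proof (rule orthogonal_scalar[where X = \<X> and d = d' and k = k'])
    show "- s \<noteq> 0" "r \<noteq> 0" "\<X> \<noteq> 0" using q_nz r_nz X_nz by (simp_all add: s_def)
    show "(- s - inverse (- s)) * \<X> = - s - inverse (- s) + r - inverse r" using zX unfolding qi(1) s_def by (simp add: algebra_simps)
    show "- s * - s \<noteq> - 1"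
    proof
      assume "- s * - s = - 1"
      then have "inverse (q * q) = -1" by (simp add: s_def)
      then have "q * q = -1" by (metis inverse_inverse_eq inverse_minus_eq inverse_1)
      then show False using q2 by simp
    qed
    have "(q + s) * (g * D) = s * \<X> + r - (s + \<rho>) / \<X>" using d X_nz by simp
    then have d2: "- (q + s) * (g * D) = - s * \<X> - r + (s + \<rho>) / \<X>" by (simp add: algebra_simps)
    have qs: "qn (- s) (Suc (Suc 0)) = - (q + s)" using qi(1) by simp
    show "scalar_chain (- s) r \<X> d' k' (Suc 0)"
      unfolding scalar_chain_def
    proof (intro conjI allI impI)
      fix i :: nat assume "i < Suc 0"
      then have i: "i = 0" by simp
      show "k' (Suc (Suc i)) * d' i = (- s) ^ i * inverse r - (- s) ^ Suc i - (- s) * k' (Suc i)"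
        using X_nz by (simp add: i k'_def d'_def \<rho>_def numeral_2_eq_2 add.commute)
      show "qn (- s) (Suc (Suc i)) * d' (Suc i) = (- s) ^ Suc i * \<X> - qn (- s) (Suc i) * r + k' (Suc (Suc i))"
        unfolding i qs using d2 by (simp add: d'_def k'_def numeral_2_eq_2)
    qed (simp_all add: d'_def k'_def)
    show "d' j \<noteq> 0" "qn (- s) (Suc j) \<noteq> 0" if "j < Suc 0" for j using that X_nz by (simp_all add: d'_def)
    show "\<X> * d' (Suc 0) = 1" using DX by (simp add: d'_def)
    define K where "K = (s + \<rho>) / \<X>"
    have k2: "k' (Suc (Suc 0)) = K" by (simp add: k'_def numeral_2_eq_2 K_def)
    have "K * \<X> = s + \<rho>" using X_nz by (simp add: K_def)
    then have "(q + s) * r = s * (\<rho> * \<X> - K * \<X>)" using e by (simp add: right_diff_distrib mult.assoc)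
    then show "qn (- s) (Suc (Suc 0)) * r = ((- s) ^ Suc 0 * inverse r - (- s) * k' (Suc (Suc 0))) * \<X>"
      unfolding qs k2 \<rho>_def by (simp add: algebra_simps)
    show "\<X> * (inverse (- s) * \<X> + r) \<noteq> inverse (- s) + inverse r"
      unfolding qi using col_dim by (simp add: algebra_simps)
  qed
  then have r: "r = - inverse q" by (simp add: s_def)
  have \<rho>q: "\<rho> = - q" using r by (simp add: \<rho>_def)
  have X2: "\<X> = 2"
  proof -
    have qs: "q * s = 1" using q_nz by (simp add: s_def)
    show ?thesis using e qs r unfolding \<rho>q s_def[symmetric] by Groebner_Basis.algebra
  qed
  note V = two_values[OF r X2]
  have gi: "inverse g = g" using g2 by (metis inverse_unique)
  \<comment> \<open>No hook beside [1^i] with i \<ge> 2 is a label, so there the first trace reads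
    2g = g + (next ratio) and the ratio \<open>g\<close> propagates. At the last column no next
    ratio exists, and 2g = g is the contradiction.\<close>
  have dl1: "dl (Col i) (Col (Suc i)) = g" if "0 < i" "Suc i \<le> N" for i
    using that
  proof (induction i)
    case (Suc i)
    show ?case
    proof (cases i)
      case 0
      then show ?thesis using V(4) by (simp add: numeral_2_eq_2)
    next
      case (Suc j)
      then have "dl (Col i) (Col (Suc i)) = g" using Suc.IH Suc.prems by simp
      moreover have "hook (Suc i) \<notin> L" using h Suc by simp
      moreover have "g * dc (Suc i) = dl (Col (Suc i)) (Col (Suc (Suc i)))"
        using Suc.prems g2 by (simp add: dc_def mult.assoc[symmetric])
      ultimately have "2 * g = g + dl (Col (Suc i)) (Col (Suc (Suc i)))"
        using col_traces(1)[of i] Suc.prems V(3) gi by simp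
      then show ?thesis by simp
    qed
  qed simp
  obtain m where m: "N = Suc (Suc m)" using N1 by (metis Suc_le_D numeral_2_eq_2 Suc_le_mono)
  have "2 * g = inverse (dl (Col (Suc m)) (Col (Suc (Suc m))))"
    using col_traces(1)[of "Suc m", unfolded m[symmetric]] h[of m, unfolded m[symmetric]] V(3) dc_top
    unfolding m[symmetric] by simp
  then have "2 * g = g" using dl1[of "Suc m"] gi m by simp
  then show False using g_nz by simp
qed

end

end

section \<open>Cups and caps from the braided structure\<close>

context strict_tensor_cat
begin

lemma tens_ident_eq_wh:
  "arr f \<Longrightarrow> f \<otimes>\<^sub>m ident C A = wh \<I> f A" "arr f \<Longrightarrow> ident C A \<otimes>\<^sub>m f = wh A f \<I>"
  using tens_ident_unit_left[of "f \<otimes>\<^sub>m ident C A" "dm f \<otimes>\<^sub>o A" "cd f \<otimes>\<^sub>o A"] tens_ident_unit_right[of f "dm f" "cd f"]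
  by (simp_all add: wh_def mor_iff)

lemma dsum_ext:
  assumes d: "dsum Y I Z inc pro" and f: "arr f" "dm f = Y" "arr h" "dm h = Y" "cd f = cd h"
    and e: "\<And>i. i \<in> I \<Longrightarrow> f \<cdot> inc i = h \<cdot> inc i"
  shows "f = h"
proof (rule mor_eqI)
  fix \<phi> assume "lf (dm h) (cd h) \<phi>"
  then show "\<phi> f = \<phi> h" using dsum_out[OF d f(1,2)] dsum_out[OF d f(3,4)] f(4,5) e by simp
qed (use f in simp_all)

lemma dsum_transport:
  assumes d: "dsum Y I Z inc pro" and iso: "\<And>i. i \<in> I \<Longrightarrow> isomorphic C (Z i) (Z' i)"
  shows "\<exists>inc' pro'. dsum Y I Z' inc' pro'"
proof -
  have "\<forall>i\<in>I. \<exists>u v. arr u \<and> dm u = Z i \<and> cd u = Z' i \<and> arr v \<and> dm v = Z' i \<and> cd v = Z i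
      \<and> v \<cdot> u = ident C (Z i) \<and> u \<cdot> v = ident C (Z' i)"
    using iso isomorphicE by metis
  then obtain u v where uv: "\<And>i. i \<in> I \<Longrightarrow> arr (u i) \<and> dm (u i) = Z i \<and> cd (u i) = Z' i \<and> arr (v i) \<and> dm (v i) = Z' i
      \<and> cd (v i) = Z i \<and> v i \<cdot> u i = ident C (Z i) \<and> u i \<cdot> v i = ident C (Z' i)"
    by metis
  note D = dsumD[OF d]
  have c: "(u j \<cdot> pro j) \<cdot> (inc i \<cdot> v i) = u j \<cdot> ((pro j \<cdot> inc i) \<cdot> v i)" if "i \<in> I" "j \<in> I" for i j
    using uv[OF that(1)] uv[OF that(2)] D that by (simp add: cmp_assoc)
  have e: "(inc i \<cdot> v i) \<cdot> (u i \<cdot> pro i) = inc i \<cdot> pro i" if "i \<in> I" for i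
    using uv[OF that] D(2-7)[OF that] reassoc[of "v i" "u i" "ident C (Z i)" "pro i"] by (simp add: cmp_assoc)
  have "dsum Y I Z' (\<lambda>i. inc i \<cdot> v i) (\<lambda>i. u i \<cdot> pro i)"
    unfolding dsum_def
  proof (intro conjI ballI allI impI)
    fix i assume i: "i \<in> I"
    note I = uv[OF i] D(2-8)[OF i]
    show "(u i \<cdot> pro i) \<cdot> (inc i \<cdot> v i) = ident C (Z' i)" unfolding c[OF i i] using I by simp
    show "arr (inc i \<cdot> v i)" "dm (inc i \<cdot> v i) = Z' i" "cd (inc i \<cdot> v i) = Y"
      "arr (u i \<cdot> pro i)" "dm (u i \<cdot> pro i) = Y" "cd (u i \<cdot> pro i) = Z' i"
      using I by simp_all
    fix j assume j: "j \<in> I" "i \<noteq> j"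
    show "(u j \<cdot> pro j) \<cdot> (inc i \<cdot> v i) = zero_mor C (Z' i) (Z' j)"
      unfolding c[OF i j(1)] D(9)[OF i j] using I uv[OF j(1)] by simp
  next
    fix \<phi> assume "lf Y Y \<phi>"
    then show "\<phi> (ident C Y) = (\<Sum>i\<in>I. \<phi> ((inc i \<cdot> v i) \<cdot> (u i \<cdot> pro i)))" using D(10) e by simp
  qed (rule D(1))
  then show ?thesis by blast
qed

text \<open>An endomorphism \<open>f\<close> of \<open>Y\<close>, rotated with \<open>ev\<close> and
  \<open>coev\<close>, becomes an endomorphism of \<open>X\<close>, hence a scalar \<open>a\<close>.
  Then \<open>f\<close> acts on \<open>coev\<close> by \<open>a\<close>, and the zigzag relation
  recovers \<open>f\<close> itself.\<close>

lemma dual_simple: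
  assumes X: "simple_ob C X" and d: "is_dual C Y X ev coev"
  shows "simple_ob C Y"
proof -
  have a [simp]: "arr ev" "dm ev = Y \<otimes>\<^sub>o X" "cd ev = \<I>" "arr coev" "dm coev = \<I>" "cd coev = X \<otimes>\<^sub>o Y"
    and z: "wh X ev \<I> \<cdot> wh \<I> coev X = ident C X" "wh \<I> ev Y \<cdot> wh Y coev \<I> = ident C Y"
    using d unfolding is_dual_def mor_iff by (auto simp: tens_ident_eq_wh)
  have "\<exists>a. f = a \<odot> ident C Y" if f: "arr f" "dm f = Y" "cd f = Y" for f
  proof -
    note [simp] = f
    obtain a where F: "wh X ev \<I> \<cdot> (wh X f X \<cdot> wh \<I> coev X) = a \<odot> ident C X"
      using simple_scalar[OF X, of "wh X ev \<I> \<cdot> (wh X f X \<cdot> wh \<I> coev X)"] by auto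
    have "a \<odot> coev = wh \<I> (a \<odot> ident C X) Y \<cdot> coev" by (simp add: wh_sc cmp_sc)
    also have "\<dots> = wh X ev Y \<cdot> (wh X f (X \<otimes>\<^sub>o Y) \<cdot> (wh \<I> coev (X \<otimes>\<^sub>o Y) \<cdot> coev))"
      unfolding F[symmetric] by (simp add: wh_cmp cmp_assoc)
    also have "wh \<I> coev (X \<otimes>\<^sub>o Y) \<cdot> coev = wh (X \<otimes>\<^sub>o Y) coev \<I> \<cdot> coev"
      using wh_swap[of coev coev \<I> \<I> \<I>] by simp
    also have "wh X f (X \<otimes>\<^sub>o Y) \<cdot> (wh (X \<otimes>\<^sub>o Y) coev \<I> \<cdot> coev) = wh (X \<otimes>\<^sub>o Y) coev \<I> \<cdot> (wh X f \<I> \<cdot> coev)"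
      using reassoc[OF wh_swap[of f coev X \<I> \<I>, simplified], of coev] by (simp add: cmp_assoc)
    also have "wh X ev Y \<cdot> (wh (X \<otimes>\<^sub>o Y) coev \<I> \<cdot> (wh X f \<I> \<cdot> coev)) = wh X (wh \<I> ev Y \<cdot> wh Y coev \<I>) \<I> \<cdot> (wh X f \<I> \<cdot> coev)"
      by (simp add: wh_cmp cmp_assoc)
    also have "\<dots> = wh X f \<I> \<cdot> coev" unfolding z by simp
    finally have c: "wh X f \<I> \<cdot> coev = a \<odot> coev" ..
    have "f = f \<cdot> (wh \<I> ev Y \<cdot> wh Y coev \<I>)" unfolding z by simp
    also have "\<dots> = (f \<cdot> wh \<I> ev Y) \<cdot> wh Y coev \<I>" by (simp add: cmp_assoc)
    also have "f \<cdot> wh \<I> ev Y = wh \<I> ev Y \<cdot> wh (Y \<otimes>\<^sub>o X) f \<I>"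
      using wh_swap[of ev f \<I> \<I> \<I>] by simp
    also have "(wh \<I> ev Y \<cdot> wh (Y \<otimes>\<^sub>o X) f \<I>) \<cdot> wh Y coev \<I> = wh \<I> ev Y \<cdot> wh Y (wh X f \<I> \<cdot> coev) \<I>"
      by (simp add: wh_cmp cmp_assoc)
    also have "\<dots> = a \<odot> ident C Y" unfolding c z(2)[symmetric] by (simp add: wh_sc cmp_sc)
    finally show ?thesis by blast
  qed
  moreover have "ident C Y \<noteq> zero_mor C Y Y"
  proof
    assume "ident C Y = zero_mor C Y Y"
    then have "wh X (ident C Y) \<I> \<cdot> coev = wh X (zero_mor C Y Y) \<I> \<cdot> coev" by simp
    then have "coev = zero_mor C \<I> (X \<otimes>\<^sub>o Y)" by simp
    then have "ident C X = zero_mor C X X" using z(1) by simp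
    then show False using simple_nz[OF X] by simp
  qed
  moreover have "a \<odot>\<^bsub>Hom C Y Y\<^esub> ident C Y \<in> mor C Y Y" for a
    unfolding sc_mor[OF ident_mor, symmetric] by (simp add: mor_iff)
  ultimately show ?thesis unfolding simple_ob_def sc_mor[OF ident_mor, symmetric] by (auto simp: mor_iff image_iff)
qed

end

section \<open>The skein relations derived from the braiding\<close>

context rigid_semisimple_braided_cat
begin

lemma braid_arr [simp]: "arr (braid C A B)" "dm (braid C A B) = A \<otimes>\<^sub>o B" "cd (braid C A B) = B \<otimes>\<^sub>o A"
  using braid_iso[of A B] unfolding is_iso_def mor_iff by simp_all

lemma braid_cancel:
  assumes "arr f" "arr h" "cd f = A \<otimes>\<^sub>o B" "cd h = A \<otimes>\<^sub>o B" "dm f = dm h" "braid C A B \<cdot> f = braid C A B \<cdot> h"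
  shows "f = h"
proof -
  obtain d where d: "arr d" "dm d = B \<otimes>\<^sub>o A" "cd d = A \<otimes>\<^sub>o B" "d \<cdot> braid C A B = ident C (A \<otimes>\<^sub>o B)"
    using braid_iso[of A B] unfolding is_iso_def mor_iff Bex_def by blast
  have "d \<cdot> (braid C A B \<cdot> f) = d \<cdot> (braid C A B \<cdot> h)" using assms by simp
  moreover have "d \<cdot> (braid C A B \<cdot> f) = f" "d \<cdot> (braid C A B \<cdot> h) = h"
    using reassoc[OF d(4), of f] reassoc[OF d(4), of h] d assms(1-5) by simp_all
  ultimately show ?thesis by simp
qed

text \<open>The hexagon identities with unit objects make these braidings idempotent, and they are
  invertible.\<close>

lemma braid_unit: "braid C A \<I> = ident C A" "braid C \<I> A = ident C A"
proof -
  have "braid C A \<I> = braid C A \<I> \<cdot> braid C A \<I>"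
    using hexagon_right[of A \<I> \<I>] by (simp add: tens_ident_eq_wh)
  then show "braid C A \<I> = ident C A" using braid_cancel[of "braid C A \<I>" "ident C A" A \<I>] by simp
  have "braid C \<I> A = braid C \<I> A \<cdot> braid C \<I> A"
    using hexagon_left[of \<I> \<I> A] by (simp add: tens_ident_eq_wh)
  then show "braid C \<I> A = ident C A" using braid_cancel[of "braid C \<I> A" "ident C A" \<I> A] by simp
qed

text \<open>Naturality of the braiding with respect to \<open>cup\<close>; the hexagon identities
  split the braiding past \<open>X \<otimes> X\<close> into two crossings.\<close>

lemma braid_slide:
  assumes f: "arr cup" "dm cup = \<I>" "cd cup = X \<otimes>\<^sub>o X"
  shows "wh \<I> (braid C X X) X \<cdot> (wh X (braid C X X) \<I> \<cdot> wh \<I> cup X) = wh X cup \<I>"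
    "wh X (braid C X X) \<I> \<cdot> (wh \<I> (braid C X X) X \<cdot> wh X cup \<I>) = wh \<I> cup X"
proof -
  have "braid C (X \<otimes>\<^sub>o X) X \<cdot> (cup \<otimes>\<^sub>m ident C X) = (ident C X \<otimes>\<^sub>m cup) \<cdot> braid C \<I> X"
    by (rule braid_natural) (use f in \<open>simp_all add: mor_iff\<close>)
  then show "wh \<I> (braid C X X) X \<cdot> (wh X (braid C X X) \<I> \<cdot> wh \<I> cup X) = wh X cup \<I>"
    unfolding hexagon_left braid_unit using f by (simp add: tens_ident_eq_wh cmp_assoc)
  have "braid C X (X \<otimes>\<^sub>o X) \<cdot> (ident C X \<otimes>\<^sub>m cup) = (cup \<otimes>\<^sub>m ident C X) \<cdot> braid C X \<I>"
    by (rule braid_natural) (use f in \<open>simp_all add: mor_iff\<close>)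
  then show "wh X (braid C X X) \<I> \<cdot> (wh \<I> (braid C X X) X \<cdot> wh X cup \<I>) = wh \<I> cup X"
    unfolding hexagon_right braid_unit using f by (simp add: tens_ident_eq_wh cmp_assoc)
qed

text \<open>Naturality of the braiding with respect to the braiding itself.\<close>

lemma yang_baxter:
  "wh \<I> (braid C X X) X \<cdot> (wh X (braid C X X) \<I> \<cdot> wh \<I> (braid C X X) X)
   = wh X (braid C X X) \<I> \<cdot> (wh \<I> (braid C X X) X \<cdot> wh X (braid C X X) \<I>)"
proof -
  have "braid C (X \<otimes>\<^sub>o X) X \<cdot> (braid C X X \<otimes>\<^sub>m ident C X) = (ident C X \<otimes>\<^sub>m braid C X X) \<cdot> braid C (X \<otimes>\<^sub>o X) X"
    by (rule braid_natural) (simp_all add: mor_iff)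
  then show ?thesis unfolding hexagon_left by (simp add: tens_ident_eq_wh cmp_assoc)
qed

text \<open>A nonzero \<open>\<I> \<rightarrow> X \<otimes> X\<close> identifies \<open>X\<close> with its dual.\<close>

lemma self_dual:
  assumes X: "simple_ob C X" and cup: "arr cup" "dm cup = \<I>" "cd cup = X \<otimes>\<^sub>o X" "cup \<noteq> zero_mor C \<I> (X \<otimes>\<^sub>o X)"
  obtains cap where "arr cap" "dm cap = X \<otimes>\<^sub>o X" "cd cap = \<I>"
    "wh X cap \<I> \<cdot> wh \<I> cup X = ident C X" "wh \<I> cap X \<cdot> wh X cup \<I> = ident C X"
proof -
  note [simp] = cup(1-3)
  obtain Y ev coev where d: "is_dual C Y X ev coev" using left_dual by blast
  have a [simp]: "arr ev" "dm ev = Y \<otimes>\<^sub>o X" "cd ev = \<I>" "arr coev" "dm coev = \<I>" "cd coev = X \<otimes>\<^sub>o Y"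
    and z: "wh X ev \<I> \<cdot> wh \<I> coev X = ident C X"
    using d unfolding is_dual_def mor_iff by (auto simp: tens_ident_eq_wh)
  define \<phi> where "\<phi> = wh \<I> ev X \<cdot> wh Y cup \<I>"
  have \<phi> [simp]: "arr \<phi>" "dm \<phi> = Y" "cd \<phi> = X" by (simp_all add: \<phi>_def)
  have "wh X \<phi> \<I> \<cdot> coev = wh X ev X \<cdot> (wh (X \<otimes>\<^sub>o Y) cup \<I> \<cdot> coev)"
    unfolding \<phi>_def by (simp add: wh_cmp cmp_assoc)
  also have "wh (X \<otimes>\<^sub>o Y) cup \<I> \<cdot> coev = wh \<I> coev (X \<otimes>\<^sub>o X) \<cdot> cup"
    using wh_swap[of coev cup \<I> \<I> \<I>] by simp
  also have "wh X ev X \<cdot> (wh \<I> coev (X \<otimes>\<^sub>o X) \<cdot> cup) = wh \<I> (wh X ev \<I> \<cdot> wh \<I> coev X) X \<cdot> cup"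
    by (simp add: wh_cmp cmp_assoc)
  finally have c: "wh X \<phi> \<I> \<cdot> coev = cup" unfolding z by simp
  have "\<phi> \<noteq> zero_mor C Y X" using c cup(4) by auto
  then obtain \<psi> where \<psi> [simp]: "arr \<psi>" "dm \<psi> = X" "cd \<psi> = Y" and i: "\<psi> \<cdot> \<phi> = ident C Y" "\<phi> \<cdot> \<psi> = ident C X"
    using schur[OF dual_simple[OF X d] X \<phi>] by metis
  define cap where "cap = ev \<cdot> wh \<I> \<psi> X"
  show ?thesis
  proof (rule that)
    show cap: "arr cap" "dm cap = X \<otimes>\<^sub>o X" "cd cap = \<I>" by (simp_all add: cap_def)
    have "wh X cap \<I> \<cdot> wh \<I> cup X = wh X ev \<I> \<cdot> (wh X (\<psi> \<cdot> \<phi>) X \<cdot> wh \<I> coev X)"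
      unfolding cap_def c[symmetric] by (simp add: wh_cmp cmp_assoc)
    then show "wh X cap \<I> \<cdot> wh \<I> cup X = ident C X" unfolding i using z by simp
    have "wh \<I> cap X \<cdot> wh X cup \<I> = wh \<I> ev X \<cdot> (wh \<I> \<psi> (X \<otimes>\<^sub>o X) \<cdot> wh X cup \<I>)"
      unfolding cap_def by (simp add: wh_cmp cmp_assoc)
    also have "wh \<I> \<psi> (X \<otimes>\<^sub>o X) \<cdot> wh X cup \<I> = wh Y cup \<I> \<cdot> \<psi>"
      using wh_swap[of \<psi> cup \<I> \<I> \<I>] by simp
    also have "wh \<I> ev X \<cdot> (wh Y cup \<I> \<cdot> \<psi>) = \<phi> \<cdot> \<psi>" unfolding \<phi>_def by (simp add: cmp_assoc)
    finally show "wh \<I> cap X \<cdot> wh X cup \<I> = ident C X" unfolding i .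
  qed
qed

text \<open>By Schur's lemma \<open>cap\<close> is \<open>x\<close> times the projection onto the
  unit, and the zigzag relation makes \<open>x\<close> nonzero. The Kauffman relation is checked
  summand by summand: off the unit it is the quadratic equation for \<open>\<theta> i\<close>, on
  the unit it is solved for \<open>\<kappa>\<close>.\<close>

lemma skein_exists:
  assumes X: "simple_ob C X" and d: "dsum (X \<otimes>\<^sub>o X) I Z inc pro" and e: "e \<in> I" "Z e = \<I>"
    and Z: "\<And>i. i \<in> I \<Longrightarrow> i \<noteq> e \<Longrightarrow> simple_ob C (Z i) \<and> \<not> isomorphic C (Z i) \<I>"
    and \<gamma>: "\<gamma> ^ 4 = 1" and t: "\<And>i. i \<in> I \<Longrightarrow> (\<gamma> \<odot> braid C X X) \<cdot> inc i = \<theta> i \<odot> inc i"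
    and \<theta>: "\<And>i. i \<in> I \<Longrightarrow> \<theta> i \<noteq> 0" "\<theta> e = inverse r" "\<And>i. i \<in> I \<Longrightarrow> i \<noteq> e \<Longrightarrow> \<theta> i - inverse (\<theta> i) = q - inverse q"
    and q: "q \<noteq> 0"
  obtains ti cap x \<kappa> where "skein C X (\<gamma> \<odot> braid C X X) ti (inc e) cap r q (\<gamma> * \<gamma>) x \<kappa>" "x \<noteq> 0"
proof -
  note D = dsumD[OF d]
  define t where "t = \<gamma> \<odot> braid C X X"
  define cup where "cup = inc e"
  have at [simp]: "arr t" "dm t = X \<otimes>\<^sub>o X" "cd t = X \<otimes>\<^sub>o X" by (simp_all add: t_def)
  have ac [simp]: "arr cup" "dm cup = \<I>" "cd cup = X \<otimes>\<^sub>o X" using D e by (simp_all add: cup_def)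
  have pc: "pro e \<cdot> cup = ident C \<I>" using D(8)[OF e(1)] e by (simp add: cup_def)
  have po [simp]: "arr (pro e)" "dm (pro e) = X \<otimes>\<^sub>o X" "cd (pro e) = \<I>" using D e by simp_all
  have "cup \<noteq> zero_mor C \<I> (X \<otimes>\<^sub>o X)" using pc simple_nz[OF unit_simple] by auto
  then obtain cap where cap [simp]: "arr cap" "dm cap = X \<otimes>\<^sub>o X" "cd cap = \<I>"
    and zz: "wh X cap \<I> \<cdot> wh \<I> cup X = ident C X" "wh \<I> cap X \<cdot> wh X cup \<I> = ident C X"
    using self_dual[OF X ac] by metis
  obtain x where x: "cap \<cdot> cup = x \<odot> ident C \<I>" using simple_scalar[OF unit_simple, of "cap \<cdot> cup"] by auto
  have "cap \<cdot> inc i = zero_mor C (Z i) \<I>" if "i \<in> I" "i \<noteq> e" for i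
    using schur_zero[OF _ unit_simple] Z[OF that] D(2-4)[OF that(1)] by simp
  then have "cap = (cap \<cdot> inc e) \<cdot> pro e" using dsum_out_eq[OF d cap(1,2), of e] e by simp
  then have cx: "cap = x \<odot> pro e" using x by (simp add: cup_def cmp_sc)
  have x0: "x \<noteq> 0"
  proof
    assume "x = 0"
    then have c: "cap = zero_mor C (X \<otimes>\<^sub>o X) \<I>" using sc_zero[of "pro e"] by (subst cx) simp
    have "ident C X = zero_mor C X X" using zz(1) unfolding c by simp
    then show False using simple_nz[OF X] by contradiction
  qed
  have tI: "t \<cdot> inc i = \<theta> i \<odot> inc i" if "i \<in> I" for i using t[OF that] by (simp add: t_def)
  have r: "r \<noteq> 0" using \<theta>(1)[OF e(1)] \<theta>(2) by auto
  have pI: "(pro e \<cdot> t) \<cdot> inc i = (inverse r \<odot> pro e) \<cdot> inc i" if i: "i \<in> I" for i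
  proof -
    note I = D(2-4)[OF i]
    have pI: "(pro e \<cdot> t) \<cdot> inc i = \<theta> i \<odot> (pro e \<cdot> inc i)" using tI[OF i] I by (simp add: cmp_assoc cmp_sc)
    also have "\<dots> = inverse r \<odot> (pro e \<cdot> inc i)"
    proof (cases "i = e")
      case False
      then show ?thesis using D(9)[OF i e(1)] by simp
    qed (simp add: \<theta>(2))
    finally show ?thesis using I by (simp add: cmp_sc)
  qed
  have pt: "pro e \<cdot> t = inverse r \<odot> pro e" by (rule dsum_ext[OF d]) (simp_all add: pI)
  obtain d' where d': "arr d'" "dm d' = X \<otimes>\<^sub>o X" "cd d' = X \<otimes>\<^sub>o X" 
    "d' \<cdot> braid C X X = ident C (X \<otimes>\<^sub>o X)" "braid C X X \<cdot> d' = ident C (X \<otimes>\<^sub>o X)"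
    using braid_iso[of X X] unfolding is_iso_def mor_iff Bex_def by blast
  have \<gamma>0: "\<gamma> \<noteq> 0" using \<gamma> by auto
  define ti where "ti = inverse \<gamma> \<odot> d'"
  have ati [simp]: "arr ti" "dm ti = X \<otimes>\<^sub>o X" "cd ti = X \<otimes>\<^sub>o X" using d' by (simp_all add: ti_def)
  have tt: "t \<cdot> ti = ident C (X \<otimes>\<^sub>o X)" "ti \<cdot> t = ident C (X \<otimes>\<^sub>o X)"
    using d' \<gamma>0 by (simp_all add: t_def ti_def cmp_sc)
  have tiI: "ti \<cdot> inc i = inverse (\<theta> i) \<odot> inc i" if "i \<in> I" for i
  proof -
    note I = D(2-4)[OF that]
    have "\<theta> i \<odot> (ti \<cdot> inc i) = ti \<cdot> (t \<cdot> inc i)" unfolding tI[OF that] using I by (simp add: cmp_sc)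
    also have "\<dots> = inc i" using reassoc[OF tt(2)] I by simp
    finally have "inverse (\<theta> i) \<odot> (\<theta> i \<odot> (ti \<cdot> inc i)) = inverse (\<theta> i) \<odot> inc i" by simp
    then show ?thesis using \<theta>(1)[OF that] I by simp
  qed
  define \<kappa> where "\<kappa> = (inverse r - r - (q - inverse q)) / x"
  have pl3: "arr (a \<boxplus> b \<boxplus> c)" "(a \<boxplus> b \<boxplus> c) \<cdot> f = a \<cdot> f \<boxplus> b \<cdot> f \<boxplus> c \<cdot> f" 
    if "arr a" "arr b" "arr c" "arr f" "dm a = cd f" "dm b = cd f" "dm c = cd f" "cd a = cd c" "cd b = cd c" for a b c f
    using that by (simp_all add: cmp_pl)
  have k: "t = ti \<boxplus> (q - inverse q) \<odot> ident C (X \<otimes>\<^sub>o X) \<boxplus> \<kappa> \<odot> (cup \<cdot> cap)"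
  proof (rule dsum_ext[OF d])
    fix i assume i: "i \<in> I"
    note I = D(2-4)[OF i]
    have cc: "(cup \<cdot> cap) \<cdot> inc i = (if i = e then x else 0) \<odot> inc i"
    proof (cases "i = e")
      case True
      have "(cup \<cdot> cap) \<cdot> cup = x \<odot> cup" by (simp add: cmp_assoc x cmp_sc)
      then show ?thesis using True by (simp add: cup_def)
    next
      case False
      have "pro e \<cdot> inc i = zero_mor C (Z i) \<I>" using D(9)[OF i e(1) False] e by simp
      then show ?thesis using False I sc_zero[of "inc i"] by (simp add: cmp_assoc cx cmp_sc)
    qed
    have "(ti \<boxplus> (q - inverse q) \<odot> ident C (X \<otimes>\<^sub>o X) \<boxplus> \<kappa> \<odot> (cup \<cdot> cap)) \<cdot> inc i
       = inverse (\<theta> i) \<odot> inc i \<boxplus> (q - inverse q) \<odot> inc i \<boxplus> (\<kappa> * (if i = e then x else 0)) \<odot> inc i"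
      using I by (subst pl3) (simp_all add: cmp_sc tiI[OF i] cc)
    also have "\<dots> = (inverse (\<theta> i) + (q - inverse q) + \<kappa> * (if i = e then x else 0)) \<odot> inc i"
      by (rule mor_eqI) (use I in \<open>auto simp: algebra_simps\<close>)
    also have "inverse (\<theta> i) + (q - inverse q) + \<kappa> * (if i = e then x else 0) = \<theta> i"
      using \<theta>(2,3) i x0 r by (cases "i = e") (auto simp: \<kappa>_def algebra_simps)
    finally show "t \<cdot> inc i = (ti \<boxplus> (q - inverse q) \<odot> ident C (X \<otimes>\<^sub>o X) \<boxplus> \<kappa> \<odot> (cup \<cdot> cap)) \<cdot> inc i"
      unfolding tI[OF i] ..
  qed simp_all
  have wt: "wh A t B = \<gamma> \<odot> wh A (braid C X X) B" for A B by (simp add: t_def wh_sc)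
  have "skein C X t ti cup cap r q (\<gamma> * \<gamma>) x \<kappa>"
  proof unfold_locales
    show "t \<cdot> cup = inverse r \<odot> cup" using tI[OF e(1)] \<theta>(2) by (simp add: cup_def)
    show "cap \<cdot> t = inverse r \<odot> cap" unfolding cx by (simp add: cmp_sc pt mult.commute)
    show "wh \<I> t X \<cdot> (wh X t \<I> \<cdot> wh \<I> cup X) = (\<gamma> * \<gamma>) \<odot> wh X cup \<I>"
      "wh X t \<I> \<cdot> (wh \<I> t X \<cdot> wh X cup \<I>) = (\<gamma> * \<gamma>) \<odot> wh \<I> cup X"
      unfolding wt using braid_slide[OF ac] by (simp_all add: cmp_sc)
    show "wh \<I> t X \<cdot> (wh X t \<I> \<cdot> wh \<I> t X) = wh X t \<I> \<cdot> (wh \<I> t X \<cdot> wh X t \<I>)"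
      unfolding wt using yang_baxter[of X] by (simp add: cmp_sc)
    show "\<gamma> * \<gamma> * (\<gamma> * \<gamma>) = 1" using \<gamma> by (simp add: numeral_eq_Suc mult_ac)
  qed (fact at ati ac cap tt zz x k r q)+
  then show ?thesis using that x0 unfolding t_def cup_def by blast
qed

end

section \<open>Orthogonal and symplectic label sets\<close>

text \<open>The second alternative is the orthogonal fusion label set with at most two boxes in the first two rows.\<close>

lemma orthogonal_labels_small:
  assumes "orthogonal_labels N L" "row_diagram 2 \<in> L"
  shows "0 < n \<Longrightarrow> column_diagram n \<in> L \<longleftrightarrow> n \<le> N"
    "(\<forall>n>0. hook n \<in> L \<longleftrightarrow> n < N) \<or> (\<forall>n. hook (Suc (Suc n)) \<notin> L) \<and> row_diagram 3 \<notin> L"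
  using assms unfolding orthogonal_labels_def labels_O_def labels_O_fusion_def labels_OSp_fusion_def
  by (auto simp: Suc_le_eq not_le)

lemma symplectic_labels_small:
  assumes "symplectic_labels N L" "row_diagram 2 \<in> L" "0 < n"
  shows "column_diagram n \<in> L \<longleftrightarrow> n \<le> N" "hook n \<in> L \<longleftrightarrow> n \<le> N"
  using assms unfolding symplectic_labels_def labels_Sp_def labels_Sp_fusion_def
  by (auto simp: Suc_le_eq not_le)

lemma column_length_empty [simp]: "column_length {} j = 0" "row_length {} j = 0"
  by (simp_all add: column_length_def row_length_def)

lemma labels_closed:
  assumes "orth_sympl_type C L V"
  shows "\<nu> \<in> L \<Longrightarrow> young \<nu>" "{} \<in> L" "column_diagram 1 \<in> L" "row_diagram 2 \<in> L" "column_diagram 2 \<in> L"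
  using assms young_diagrams(1)[of 0] unfolding orth_sympl_type_def labels_O_infinity_def orthogonal_labels_def labels_O_def
    labels_O_fusion_def labels_OSp_fusion_def symplectic_labels_def labels_Sp_def labels_Sp_fusion_def
  by auto

text \<open>Replacing \<open>V {}\<close> by the unit object changes no isomorphism class, so the
  given decompositions can be transported; at \<open>{}\<close> the identity serves as both
  inclusion and projection. The unit summand of \<open>X \<otimes> X\<close> then supplies the
  cup.\<close>

lemma fusion_skein_exists:
  fixes C :: "('o, 'm) tensor_cat" (structure) and V :: "diagram \<Rightarrow> 'o"
  assumes T: "orth_sympl_type C L V" and P: "has_parameters C V r q"
  obtains X t ti cup cap g x \<kappa> W inc pro where "fusion_skein C X t ti cup cap r q g x \<kappa> L W inc pro"
proof -
  interpret rigid_semisimple_braided_cat C using T unfolding orth_sympl_type_def by blast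
  note L = labels_closed[OF T]
  have F: "\<And>\<nu>. \<nu> \<in> L \<Longrightarrow> simple_ob C (V \<nu>)"
    "\<And>\<nu> \<mu>. \<nu> \<in> L \<Longrightarrow> \<mu> \<in> L \<Longrightarrow> isomorphic C (V \<nu>) (V \<mu>) \<Longrightarrow> \<nu> = \<mu>"
    "isomorphic C (V {}) \<I>"
    "\<And>\<nu>. \<nu> \<in> L \<Longrightarrow> is_direct_sum C (V \<nu> \<otimes>\<^sub>o V (column_diagram 1)) {\<mu> \<in> L. differ_by_box \<nu> \<mu>} V"
    using T unfolding orth_sympl_type_def has_fusion_rules_def row_1[symmetric] by blast+
  define X where "X = V (column_diagram 1)"
  define W where "W \<nu> = (if \<nu> = {} then \<I> else V \<nu>)" for \<nu>
  have ne: "column_diagram 1 \<noteq> {}" "column_diagram 2 \<noteq> {}" "row_diagram 2 \<noteq> {}" "column_diagram 2 \<noteq> row_diagram 2"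
    using diagram_simps(2)[of 0 0] diagram_simps(2)[of 1 0 2] diagram_simps(3)[of 0 0 2] diagram_simps(3)[of 1 0 2]
    by (metis empty_iff zero_less_one zero_less_numeral one_less_numeral_iff semiring_norm(76) zero_neq_one)+
  have W1: "W (column_diagram 1) = X" using ne by (simp add: W_def X_def)
  have iso: "isomorphic C (V \<nu>) (W \<nu>)" for \<nu>
    using F(3) isomorphicI[of "ident C (V \<nu>)" "ident C (V \<nu>)"] by (simp add: W_def)
  have Ws: "simple_ob C (W \<nu>)" if "\<nu> \<in> L" for \<nu>
    using F(1)[OF that] unit_simple by (simp add: W_def)
  have Wi: "\<nu> = \<mu>" if "\<nu> \<in> L" "\<mu> \<in> L" "isomorphic C (W \<nu>) (W \<mu>)" for \<nu> \<mu>
    using F(2)[OF that(1,2)] iso[of \<nu>] iso[of \<mu>] that(3) isomorphic_trans isomorphic_sym by blast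
  have nb0: "{\<mu> \<in> L. differ_by_box {} \<mu>} = {column_diagram 1}"
    using column_neighbours[of _ 0] differ_column[of 0] L by auto
  have "\<exists>i p. dsum (W \<nu> \<otimes>\<^sub>o X) {\<mu> \<in> L. differ_by_box \<nu> \<mu>} W i p
      \<and> (\<nu> = {} \<longrightarrow> i = (\<lambda>_. ident C X) \<and> p = (\<lambda>_. ident C X))" if \<nu>: "\<nu> \<in> L" for \<nu>
  proof (cases "\<nu> = {}")
    case True
    have "dsum X {column_diagram 1} W (\<lambda>_. ident C X) (\<lambda>_. ident C X)"
      unfolding dsum_def using W1 by simp
    then show ?thesis unfolding True nb0 by (auto simp: W_def)
  next
    case False
    then have "W \<nu> = V \<nu>" by (simp add: W_def)
    obtain i p where "dsum (V \<nu> \<otimes>\<^sub>o X) {\<mu> \<in> L. differ_by_box \<nu> \<mu>} V i p"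
      using is_direct_sum_dsum[OF F(4)[OF \<nu>]] unfolding X_def by blast
    from dsum_transport[OF this iso] show ?thesis using False \<open>W \<nu> = V \<nu>\<close> by simp
  qed
  then have "\<forall>\<nu>\<in>L. \<exists>i p. dsum (W \<nu> \<otimes>\<^sub>o X) {\<mu> \<in> L. differ_by_box \<nu> \<mu>} W i p
      \<and> (\<nu> = {} \<longrightarrow> i = (\<lambda>_. ident C X) \<and> p = (\<lambda>_. ident C X))" by blast
  from bchoice[OF this] obtain inc where "\<forall>\<nu>\<in>L. \<exists>p. dsum (W \<nu> \<otimes>\<^sub>o X) {\<mu> \<in> L. differ_by_box \<nu> \<mu>} W (inc \<nu>) p
      \<and> (\<nu> = {} \<longrightarrow> inc \<nu> = (\<lambda>_. ident C X) \<and> p = (\<lambda>_. ident C X))" ..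
  from bchoice[OF this] obtain pro where ip: "\<forall>\<nu>\<in>L. dsum (W \<nu> \<otimes>\<^sub>o X) {\<mu> \<in> L. differ_by_box \<nu> \<mu>} W (inc \<nu>) (pro \<nu>)
      \<and> (\<nu> = {} \<longrightarrow> inc \<nu> = (\<lambda>_. ident C X) \<and> pro \<nu> = (\<lambda>_. ident C X))" ..
  have fus: "dsum (W \<nu> \<otimes>\<^sub>o X) {\<mu> \<in> L. differ_by_box \<nu> \<mu>} W (inc \<nu>) (pro \<nu>)" if "\<nu> \<in> L" for \<nu>
    using ip that by simp
  have base: "inc {} = (\<lambda>_. ident C X)" "pro {} = (\<lambda>_. ident C X)" using ip L(2) by auto
  obtain \<gamma> where \<gamma>: "\<gamma> ^ 4 = 1"
    and act: "acts_by C (\<gamma> \<odot> braid C X X) (X \<otimes>\<^sub>o X) (V (row_diagram 2)) q"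
      "acts_by C (\<gamma> \<odot> braid C X X) (X \<otimes>\<^sub>o X) (V (column_diagram 2)) (- inverse q)"
      "acts_by C (\<gamma> \<odot> braid C X X) (X \<otimes>\<^sub>o X) \<I> (inverse r)"
    and rq: "r \<noteq> 0" "q \<noteq> 0" "q \<noteq> - inverse q"
  proof -
    have "\<gamma> \<odot>\<^bsub>Hom C (X \<otimes>\<^sub>o X) (X \<otimes>\<^sub>o X)\<^esub> braid C X X = \<gamma> \<odot> braid C X X" for \<gamma>
      by (rule sc_mor[symmetric]) (simp add: mor_iff)
    then show ?thesis using P that unfolding has_parameters_def Let_def row_1 X_def[symmetric] by auto
  qed
  define I where "I = {\<mu> \<in> L. differ_by_box (column_diagram 1) \<mu>}"
  define \<theta> where "\<theta> \<mu> = (if \<mu> = {} then inverse r else if \<mu> = row_diagram 2 then q else - inverse q)" for \<mu> :: diagram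
  have I: "i = {} \<or> i = column_diagram 2 \<or> i = row_diagram 2" if "i \<in> I" for i
    using column_neighbours[of i 1] L(1) that unfolding I_def row_2 by (auto simp: numeral_2_eq_2)
  have mem: "{} \<in> I" "column_diagram 2 \<in> I" "row_diagram 2 \<in> I"
    using L differ_column[of 0] differ_column[of 1] differ_hook[of 1] unfolding I_def row_2
    by (auto simp: numeral_2_eq_2 differ_by_box_def)
  have d: "dsum (X \<otimes>\<^sub>o X) I W (inc (column_diagram 1)) (pro (column_diagram 1))"
    using fus[OF L(3)] unfolding W1 I_def .
  have t: "(\<gamma> \<odot> braid C X X) \<cdot> inc (column_diagram 1) i = \<theta> i \<odot> inc (column_diagram 1) i" if "i \<in> I" for i
  proof -
    have m: "inc (column_diagram 1) i \<in> mor C (W i) (X \<otimes>\<^sub>o X)" using dsumD(2-4)[OF d that] by (simp add: mor_iff)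
    have "acts_by C (\<gamma> \<odot> braid C X X) (X \<otimes>\<^sub>o X) (W i) (\<theta> i)"
      using I[OF that] act ne by (auto simp: W_def \<theta>_def)
    then show ?thesis using m sc_mor[OF m] unfolding acts_by_def by simp
  qed
  obtain ti cap x \<kappa> where sk: "skein C X (\<gamma> \<odot> braid C X X) ti (inc (column_diagram 1) {}) cap r q (\<gamma> * \<gamma>) x \<kappa>"
    and x: "x \<noteq> 0"
  proof (rule skein_exists[where q=q and r=r, OF _ d mem(1) _ _ \<gamma> t])
    show "simple_ob C X" using Ws[OF L(3)] unfolding W1 .
    show "W {} = \<I>" by (simp add: W_def)
    then show "simple_ob C (W i) \<and> \<not> isomorphic C (W i) \<I>" if "i \<in> I" "i \<noteq> {}" for i
      using Ws Wi[of i "{}"] L(2) that by (auto simp: I_def)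
    show "\<theta> i \<noteq> 0" "\<theta> {} = inverse r" for i using rq by (auto simp: \<theta>_def)
    show "\<theta> i - inverse (\<theta> i) = q - inverse q" if "i \<noteq> {}" for i using that by (simp add: \<theta>_def)
  qed (use rq in blast)+
  have "fusion_skein C X (\<gamma> \<odot> braid C X X) ti (inc (column_diagram 1) {}) cap r q (\<gamma> * \<gamma>) x \<kappa> L W inc pro"
  proof (intro fusion_skein.intro fusion_skein_axioms.intro)
    show "(\<gamma> \<odot> braid C X X) \<cdot> inc (column_diagram 1) (row_diagram 2) = q \<odot> inc (column_diagram 1) (row_diagram 2)"
      "(\<gamma> \<odot> braid C X X) \<cdot> inc (column_diagram 1) (column_diagram 2) = (- inverse q) \<odot> inc (column_diagram 1) (column_diagram 2)"
      using t[OF mem(3)] t[OF mem(2)] ne by (simp_all add: \<theta>_def)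
    show "W {} = \<I>" by (simp add: W_def)
    show "inc {} (column_diagram 1) = ident C X" "pro {} (column_diagram 1) = ident C X" by (simp_all add: base)
  qed (fact sk L Ws Wi W1 fus rq x rigid_semisimple_braided_cat_axioms)+
  then show ?thesis using that by blast
qed

theorem lemma8p4:
  fixes C :: "('o, 'm) tensor_cat" and L :: "diagram set" and V :: "diagram \<Rightarrow> 'o"
    and r q :: complex and N :: nat
  assumes "orth_sympl_type C L V" and "has_parameters C V r q"
  shows "(orthogonal_labels N L \<longrightarrow> r = q ^ (N - 1) \<or> (odd N \<and> r = - (q ^ (N - 1)))) \<and>
         (symplectic_labels N L \<longrightarrow> r = - (q ^ (2 * N + 1)))"
proof (intro conjI impI)
  note L = labels_closed[OF assms(1)]
  obtain X t ti cup cap g x \<kappa> W inc pro where F: "fusion_skein C X t ti cup cap r q g x \<kappa> L W inc pro"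
    using fusion_skein_exists[OF assms] .
  {
    assume o: "orthogonal_labels N L"
    note O = orthogonal_labels_small[OF o L(4)]
    have c: "column_diagram n \<in> L \<longleftrightarrow> n \<le> N" for n using O(1)[of n] L(2) by (cases n) auto
    then have N: "2 \<le> N" using L(5) by blast
    show "r = q ^ (N - 1) \<or> (odd N \<and> r = - (q ^ (N - 1)))"
      using O(2)
    proof
      assume h: "\<forall>n>0. hook n \<in> L \<longleftrightarrow> n < N"
      show ?thesis
        by (rule fusion_skein.orthogonal_final[OF F c]) (use h N in auto)
    next
      assume h: "(\<forall>n. hook (Suc (Suc n)) \<notin> L) \<and> row_diagram 3 \<notin> L"
      have False
        by (rule fusion_skein.degenerate_fusion[OF F c]) (use h in auto)
      then show ?thesis ..
    qed
  }
  assume s: "symplectic_labels N L"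
  note S = symplectic_labels_small[OF s L(4)]
  have c: "column_diagram n \<in> L \<longleftrightarrow> n \<le> N" for n using S(1)[of n] L(2) by (cases n) auto
  then have N: "2 \<le> N" using L(5) by blast
  show "r = - (q ^ (2 * N + 1))"
    by (rule fusion_skein.symplectic_final[OF F c]) (use S N in auto)
qed

end
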